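(* Fix $c>0$ and $k\in(0,\sqrt c/2)$, let $\mu=\mu(\cdot;k)$ be the smooth solitary wave (momentum density) of the Novikov equation described in the context, and assume that the associated operator $\mathcal{L}$ satisfies the spectral assumption (A) of the context. Then $$\left\langle\mathcal{L}^{-1}\frac{\delta\mathcal{F}}{\delta m}(\mu),\frac{\delta\mathcal{F}}{\delta m}(\mu)\right\rangle=\frac{k^{11/3}(c-k^2)^2}{18c}\,\frac{\partial}{\partial k}\left[\frac1{k^2}\mathcal{F}(\mu(\cdot;k))\right].$$
   Context: Setting: for fixed $c>0$ and $k\in(0,\sqrt c/2)$, set $a=k(c-k^2)^{3/2}$ and $E=\frac{k^2(c-2k^2)}{2c}$; $\phi=\phi(\cdot;k)$ denotes the unique nonconstant smooth even function on $\mathbb{R}$ with $\phi'(0)=0$, $\phi(x)\to k$ as $x\to\pm\infty$ (exponentially fast, together with decay of all derivatives), $\phi^2<c$, and $\phi-\phi''=a(c-\phi^2)^{-3/2}$; it satisfies $\frac12(\phi')^2=E+\frac12\phi^2-\frac{a\phi}{c\sqrt{c-\phi^2}}$, depends smoothly on $k$, and is the profile of a smooth solitary wave $u(x,t)=\phi(x-ct)$ of the Novikov equation $u_t-u_{xxt}=u^2u_{xxx}-4u^2u_x+3uu_xu_{xx}$. Put $\mu=\phi-\phi''>0$, $\omega_0=-9a^{-2/3}$, $\omega_1=9c\,a^{-4/3}(2E+c)$. The operator $\mathcal{L}$ on $L^2(\mathbb{R})$ with domain $H^2(\mathbb{R})$ is $$\mathcal{L}=\frac23\left(-3\,\partial_x\left(\mu^{-8/3}\partial_x\right)+8\mu''\mu^{-11/3}-\frac{44}{3}(\mu')^2\mu^{-14/3}+15\mu^{-8/3}\right)-\frac{2\omega_1}{9}\mu^{-4/3}+2\omega_0(1-\partial_x^2)^{-1},$$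 where $(1-\partial_x^2)^{-1}$ is convolution with $\frac12e^{-|x|}$. Spectral assumption (A): the spectrum of the symmetric operator $\mathcal{L}$ on $L^2(\mathbb{R})$ consists of a simple negative eigenvalue, a simple eigenvalue at $\lambda=0$ (whose eigenspace is then spanned by $\mu'$), and the rest of the spectrum is strictly positive and uniformly bounded away from $0$. For each $k$, $\mathcal{F}(m)=\int_{\mathbb{R}}(m(1-\partial_x^2)^{-1}m-k^2)\,dx-3k^{4/3}\int_{\mathbb{R}}(m^{2/3}-k^{2/3})\,dx$, with first variation $\frac{\delta\mathcal{F}}{\delta m}(\mu)=2(1-\partial_x^2)^{-1}\mu-2k^{4/3}\mu^{-1/3}$ at $\mu$; in $\frac{\partial}{\partial k}[\,\cdot\,]$ the derivative is the total $k$-derivative of the displayed function of $k$ (the functional $\mathcal{F}$ itself depends explicitly on $k$). Under (A), the even function $\frac{\delta\mathcal{F}}{\delta m}(\mu)$ lies in the range of $\mathcal{L}$, and $\mathcal{L}^{-1}\frac{\delta\mathcal{F}}{\delta m}(\mu)$ denotes a preimage (unique up to multiples of the odd function $\mu'$, which do not affect the inner product). $\langle\cdot,\cdot\rangle$ is the $L^2(\mathbb{R})$ inner product. *)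

theory Defs
  imports "HOL-Analysis.Analysis"
begin

definition smooth :: "(real \<Rightarrow> real) \<Rightarrow> bool" where
  "smooth f \<longleftrightarrow> (\<forall>n x. (deriv ^^ n) f differentiable (at x))"

subsection \<open>The space L2, weak derivatives and H2\<close>

text \<open>Elements of \<open>L\<^sup>2(\<real>; \<complex>)\<close> are represented by Borel functions, and equality in \<open>L\<^sup>2\<close> is
  equality almost everywhere.\<close>

definition L2 :: "(real \<Rightarrow> complex) set" where
  "L2 = {f. f \<in> borel_measurable lborel \<and> integrable lborel (\<lambda>x. (cmod (f x))\<^sup>2)}"

definition l2norm :: "(real \<Rightarrow> complex) \<Rightarrow> real" where
  "l2norm f = sqrt (\<integral>x. (cmod (f x))\<^sup>2 \<partial>lborel)"

definition l2inner :: "(real \<Rightarrow> complex) \<Rightarrow> (real \<Rightarrow> complex) \<Rightarrow> complex" where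
  "l2inner f g = (\<integral>x. f x * cnj (g x) \<partial>lborel)"

definition test_function :: "(real \<Rightarrow> real) \<Rightarrow> bool" where
  "test_function \<eta> \<longleftrightarrow> smooth \<eta> \<and> (\<exists>R. \<forall>x. \<bar>x\<bar> > R \<longrightarrow> \<eta> x = 0)"

definition is_weak_deriv :: "(real \<Rightarrow> complex) \<Rightarrow> (real \<Rightarrow> complex) \<Rightarrow> bool" where
  "is_weak_deriv f g \<longleftrightarrow>
     (\<forall>\<eta>. test_function \<eta> \<longrightarrow>
        (\<integral>x. f x * of_real (deriv \<eta> x) \<partial>lborel) = - (\<integral>x. g x * of_real (\<eta> x) \<partial>lborel))"

definition H2 :: "(real \<Rightarrow> complex) set" where
  "H2 = {f \<in> L2. \<exists>g\<in>L2. \<exists>h\<in>L2. is_weak_deriv f g \<and> is_weak_deriv g h}"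

text \<open>Weak derivatives in \<open>L\<^sup>2\<close> are unique up to null sets; \<open>wderiv\<close> picks a representative.\<close>

definition wderiv :: "(real \<Rightarrow> complex) \<Rightarrow> real \<Rightarrow> complex" where
  "wderiv f = (SOME g. g \<in> L2 \<and> is_weak_deriv f g)"

subsection \<open>Spectrum of an unbounded operator on L2\<close>

text \<open>An operator is given by its domain \<open>D\<close> and its action \<open>T\<close>, whose values matter only on \<open>D\<close>
  and up to null sets.\<close>

definition resolvent_set ::
  "(real \<Rightarrow> complex) set \<Rightarrow> ((real \<Rightarrow> complex) \<Rightarrow> real \<Rightarrow> complex) \<Rightarrow> complex set" where
  "resolvent_set D T = {z.
     (\<forall>g\<in>L2. \<exists>w\<in>D. AE x in lborel. T w x - z * w x = g x) \<and>
     (\<forall>w\<in>D. (AE x in lborel. T w x - z * w x = 0) \<longrightarrow> (AE x in lborel. w x = 0)) \<and>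
     (\<exists>C. \<forall>w\<in>D. l2norm w \<le> C * l2norm (\<lambda>x. T w x - z * w x))}"

definition op_spectrum ::
  "(real \<Rightarrow> complex) set \<Rightarrow> ((real \<Rightarrow> complex) \<Rightarrow> real \<Rightarrow> complex) \<Rightarrow> complex set" where
  "op_spectrum D T = - resolvent_set D T"

text \<open>Simplicity is one-dimensionality of the eigenspace; for the symmetric operators
  considered here geometric and algebraic multiplicity agree.\<close>

definition simple_eigenvalue ::
  "(real \<Rightarrow> complex) set \<Rightarrow> ((real \<Rightarrow> complex) \<Rightarrow> real \<Rightarrow> complex) \<Rightarrow> complex \<Rightarrow> bool" where
  "simple_eigenvalue D T z \<longleftrightarrow>
     (\<exists>v\<in>D. (AE x in lborel. T v x = z * v x) \<and> \<not> (AE x in lborel. v x = 0) \<and>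
        (\<forall>w\<in>D. (AE x in lborel. T w x = z * w x) \<longrightarrow>
           (\<exists>s. AE x in lborel. w x = s * v x)))"

subsection \<open>Smooth solitary waves of the Novikov equation\<close>

definition wave_a :: "real \<Rightarrow> real \<Rightarrow> real" where
  "wave_a c k = k * (c - k\<^sup>2) powr (3/2)"

definition wave_E :: "real \<Rightarrow> real \<Rightarrow> real" where
  "wave_E c k = k\<^sup>2 * (c - 2 * k\<^sup>2) / (2 * c)"

definition \<omega>0 :: "real \<Rightarrow> real \<Rightarrow> real" where
  "\<omega>0 c k = - 9 * wave_a c k powr (-2/3)"

definition \<omega>1 :: "real \<Rightarrow> real \<Rightarrow> real" where
  "\<omega>1 c k = 9 * c * wave_a c k powr (-4/3) * (2 * wave_E c k + c)"

definition solitary_profile :: "real \<Rightarrow> real \<Rightarrow> (real \<Rightarrow> real) \<Rightarrow> bool" where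
  "solitary_profile c k \<phi> \<longleftrightarrow>
     smooth \<phi> \<and> \<not> \<phi> constant_on UNIV \<and> (\<forall>x. \<phi> (- x) = \<phi> x) \<and> deriv \<phi> 0 = 0 \<and>
     (\<phi> \<longlongrightarrow> k) at_top \<and> (\<phi> \<longlongrightarrow> k) at_bot \<and>
     (\<forall>n. \<exists>C r. r > 0 \<and> (\<forall>x. \<bar>(deriv ^^ n) (\<lambda>y. \<phi> y - k) x\<bar> \<le> C * exp (- r * \<bar>x\<bar>))) \<and>
     (\<forall>x. (\<phi> x)\<^sup>2 < c) \<and>
     (\<forall>x. \<phi> x - deriv (deriv \<phi>) x = wave_a c k * (c - (\<phi> x)\<^sup>2) powr (-3/2))"

definition momentum :: "(real \<Rightarrow> real) \<Rightarrow> real \<Rightarrow> real" where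
  "momentum \<phi> x = \<phi> x - deriv (deriv \<phi>) x"

text \<open>The operator \<open>(1 - \<partial>\<^sub>x\<^sup>2)\<^sup>-\<^sup>1\<close>, on real- and complex-valued functions.\<close>

definition helmholtz_inv ::
  "(real \<Rightarrow> 'a::{banach,second_countable_topology}) \<Rightarrow> real \<Rightarrow> 'a" where
  "helmholtz_inv f x = (\<integral>y. (exp (- \<bar>x - y\<bar>) / 2) *\<^sub>R f y \<partial>lborel)"

definition \<L> :: "real \<Rightarrow> real \<Rightarrow> (real \<Rightarrow> real) \<Rightarrow> (real \<Rightarrow> complex) \<Rightarrow> real \<Rightarrow> complex" where
  "\<L> c k \<mu> w x =
     2/3 * (- 3 * wderiv (\<lambda>y. of_real (\<mu> y powr (-8/3)) * wderiv w y) x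
            + of_real (8 * deriv (deriv \<mu>) x * \<mu> x powr (-11/3)
                       - 44/3 * (deriv \<mu> x)\<^sup>2 * \<mu> x powr (-14/3)
                       + 15 * \<mu> x powr (-8/3)) * w x)
     - of_real (2 * \<omega>1 c k / 9 * \<mu> x powr (-4/3)) * w x
     + of_real (2 * \<omega>0 c k) * helmholtz_inv w x"

definition spectral_assumption_A :: "real \<Rightarrow> real \<Rightarrow> (real \<Rightarrow> real) \<Rightarrow> bool" where
  "spectral_assumption_A c k \<mu> \<longleftrightarrow>
     (\<exists>\<nu> \<delta> S. \<nu> < 0 \<and> \<delta> > 0 \<and> S \<subseteq> {\<delta>..} \<and>
        op_spectrum H2 (\<L> c k \<mu>) = complex_of_real ` ({\<nu>, 0} \<union> S) \<and>
        simple_eigenvalue H2 (\<L> c k \<mu>) (complex_of_real \<nu>) \<and>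
        simple_eigenvalue H2 (\<L> c k \<mu>) 0)"

definition \<F> :: "real \<Rightarrow> (real \<Rightarrow> real) \<Rightarrow> real" where
  "\<F> k m = (\<integral>x. (m x * helmholtz_inv m x - k\<^sup>2) \<partial>lborel)
     - 3 * k powr (4/3) * (\<integral>x. (m x powr (2/3) - k powr (2/3)) \<partial>lborel)"

text \<open>The variational derivative of \<open>\<F> k\<close> at \<open>m\<close> with respect to the \<open>L\<^sup>2\<close> pairing, with \<open>k\<close> held fixed.\<close>

definition \<delta>\<F> :: "real \<Rightarrow> (real \<Rightarrow> real) \<Rightarrow> real \<Rightarrow> real" where
  "\<delta>\<F> k m x = 2 * helmholtz_inv m x - 2 * k powr (4/3) * m x powr (-1/3)"

end

theory Submission
  imports Defs
begin

text \<open>The momentum \<open>\<mu>\<close> is a critical point of a functional whose second variation is \<open>\<L>\<close>, with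
  multipliers depending on \<open>k\<close>. Differentiating the Euler-Lagrange equation with respect to \<open>k\<close> gives
  \<open>\<L> \<partial>\<^sub>k\<mu>\<close>, and its homogeneity in \<open>\<mu>\<close> gives \<open>\<L> \<mu>\<close>; both are combinations of \<open>\<phi>\<close> and \<open>\<mu>\<^sup>-\<^sup>1\<^sup>/\<^sup>3\<close>.
  The combination \<open>\<partial>\<^sub>k\<mu> - \<mu>/k\<close> decays at infinity, and is therefore mapped to a multiple of \<open>\<delta>\<F>\<close>; the
  formula follows by pairing it with \<open>\<delta>\<F>\<close>. Another preimage differs by a multiple of \<open>\<mu>'\<close>, because the
  kernel is one-dimensional, and \<open>\<mu>' \<delta>\<F>\<close> is the derivative of a decaying function.

  Smooth dependence on \<open>k\<close> comes from integrating the profile equation: with \<open>t = \<phi>/sqrt (c - \<phi>\<^sup>2)\<close> and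
  the reciprocal coordinate \<open>dy = (1 + t\<^sup>2) dx\<close> the first integral reads
  \<open>(dt/dy)\<^sup>2 = const (t - t\<^sub>0)\<^sup>2 (t\<^sub>1 - t)\<close>, so that \<open>t = t\<^sub>0 + (t\<^sub>1 - t\<^sub>0) (1 - \<tau>\<^sup>2)\<close> with \<open>\<tau>\<close> a hyperbolic tangent
  of \<open>y\<close>. In the variable \<open>\<tau> \<in> (-1, 1)\<close> everything is algebraic in \<open>k\<close>.\<close>

subsection \<open>Smooth functions and bump functions\<close>

text \<open>The division by \<open>k^2\<close> is a scaling: for positive \<open>m1\<close>,
  \<open>\<F> k\<close> at \<open>k * m1\<close> equals \<open>k^2\<close> times
  \<open>\<F> 1\<close> at \<open>m1\<close>. So \<open>\<F> k \<mu> / k^2\<close> is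
  \<open>\<F> 1\<close> at \<open>\<mu> / k\<close>, the explicit \<open>k\<close> disappears, and
  formally \<open>k^2\<close> times its derivative is the pairing of \<open>\<delta>\<F>\<close>
  with the \<open>k\<close>-derivative of \<open>\<mu>\<close> minus \<open>\<mu> / k\<close>. With
  \<open>q = sqrt (c - k^2)\<close>, \<open>a = k * q^3\<close> and
  \<open>K = a powr (-8/3)\<close>, \<open>\<L>\<close> sends that combination to
  \<open>18 * K * a * c * q\<close> times \<open>\<delta>\<F>\<close>; since
  \<open>1 / (K * a) = k powr (5/3) * q^5\<close>, this yields the prefactor. The obstacle is the
  chain rule: regularity in \<open>k\<close> is not among the hypotheses, and \<open>\<mu>\<close>
  does not decay on the line. In the variable \<open>\<tau>\<close> the functional is an integral
  over \<open>[-1, 1]\<close> of a function explicit in \<open>k\<close>, where the Leibniz rule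
  applies. That derivative is taken at fixed \<open>\<tau>\<close>, while the pairing uses the
  derivative at fixed \<open>x\<close>; the two integrands differ by the derivative of a decaying
  function.\<close>

definition nsmooth :: "nat \<Rightarrow> (real \<Rightarrow> real) \<Rightarrow> bool" where
  "nsmooth n f \<longleftrightarrow> (\<forall>m\<le>n. \<forall>x. (deriv ^^ m) f differentiable (at x))"

text \<open>The finite order serves as induction variable: the derivative of a product or of a
  composition is again built from products, of order one less, so closure properties are proved
  order by order.\<close>

lemma smooth_iff_nsmooth: "smooth f \<longleftrightarrow> (\<forall>n. nsmooth n f)"
  by (auto simp: smooth_def nsmooth_def)

lemma nsmooth_0: "nsmooth 0 f \<longleftrightarrow> (\<forall>x. f differentiable (at x))"
  by (simp add: nsmooth_def)

lemma nsmooth_Suc: "nsmooth (Suc n) f \<longleftrightarrow> (\<forall>x. f differentiable (at x)) \<and> nsmooth n (deriv f)"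
proof
  assume f: "nsmooth (Suc n) f"
  have "(deriv ^^ m) (deriv f) differentiable (at x)" if "m \<le> n" for m x
    using f that unfolding nsmooth_def by (metis Suc_le_mono comp_apply funpow_Suc_right)
  moreover have "f differentiable (at x)" for x
    using f unfolding nsmooth_def by (metis funpow_0 le0)
  ultimately show "(\<forall>x. f differentiable (at x)) \<and> nsmooth n (deriv f)"
    by (simp add: nsmooth_def)
next
  assume f: "(\<forall>x. f differentiable (at x)) \<and> nsmooth n (deriv f)"
  show "nsmooth (Suc n) f"
    unfolding nsmooth_def
  proof (intro allI impI)
    fix m x assume "m \<le> Suc n"
    then show "(deriv ^^ m) f differentiable (at x)"
      using f by (cases m) (auto simp: nsmooth_def funpow_Suc_right simp del: funpow.simps)
  qed
qed

lemma nsmooth_SucI: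
  assumes "\<And>x. (f has_real_derivative f' x) (at x)" "nsmooth n f'"
  shows "nsmooth (Suc n) f"
proof -
  have "deriv f = f'"
    using assms(1) by (auto intro: DERIV_imp_deriv)
  then show ?thesis
    using assms by (auto simp: nsmooth_Suc real_differentiable_def)
qed

lemma nsmooth_SucD: "nsmooth (Suc n) f \<Longrightarrow> nsmooth n f"
  by (simp add: nsmooth_def)

lemma nsmooth_has_deriv: "nsmooth n f \<Longrightarrow> (f has_real_derivative deriv f x) (at x)"
  by (metis DERIV_deriv_iff_real_differentiable funpow_0 le0 nsmooth_def)

lemma nsmooth_const: "nsmooth n (\<lambda>x. c)"
proof (induction n arbitrary: c)
  case (Suc n)
  show ?case by (rule nsmooth_SucI[where f' = "\<lambda>x. 0"]) (auto simp: Suc)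
qed (simp add: nsmooth_0)

lemma nsmooth_add: "nsmooth n f \<Longrightarrow> nsmooth n g \<Longrightarrow> nsmooth n (\<lambda>x. f x + g x)"
proof (induction n arbitrary: f g)
  case (Suc n)
  have *: "nsmooth n (\<lambda>x. deriv f x + deriv g x)"
    using Suc by (auto simp: nsmooth_Suc)
  show ?case
    by (rule nsmooth_SucI[OF _ *])
      (auto intro!: derivative_intros nsmooth_has_deriv Suc.prems)
qed (simp add: nsmooth_0)

lemma nsmooth_mult: "nsmooth n f \<Longrightarrow> nsmooth n g \<Longrightarrow> nsmooth n (\<lambda>x. f x * g x)"
proof (induction n arbitrary: f g)
  case (Suc n)
  have *: "nsmooth n (\<lambda>x. deriv f x * g x + f x * deriv g x)"
    using Suc.prems Suc.prems[THEN nsmooth_SucD]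
    by (intro nsmooth_add Suc.IH) (auto simp: nsmooth_Suc)
  show ?case
    by (rule nsmooth_SucI[OF _ *])
      (auto intro!: derivative_eq_intros nsmooth_has_deriv Suc.prems)
qed (simp add: nsmooth_0)

lemma nsmooth_affine_arg: "nsmooth n f \<Longrightarrow> nsmooth n (\<lambda>x. f (r * x + d))"
proof (induction n arbitrary: f)
  case 0
  have "((\<lambda>x. f (r * x + d)) has_real_derivative deriv f (r * x + d) * r) (at x)" for x
    by (rule DERIV_chain2[OF nsmooth_has_deriv[OF 0]]) (auto intro!: derivative_eq_intros)
  then show ?case by (auto simp: nsmooth_0 real_differentiable_def)
next
  case (Suc n)
  have d: "((\<lambda>x. f (r * x + d)) has_real_derivative deriv f (r * x + d) * r) (at x)" for x
    by (rule DERIV_chain2[OF nsmooth_has_deriv[OF Suc.prems]]) (auto intro!: derivative_eq_intros)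
  show ?case
    using Suc by (intro nsmooth_SucI[OF d] nsmooth_mult nsmooth_const) (auto simp: nsmooth_Suc)
qed

lemma smooth_const: "smooth (\<lambda>x. c)"
  by (simp add: smooth_iff_nsmooth nsmooth_const)

lemma smooth_add: "smooth f \<Longrightarrow> smooth g \<Longrightarrow> smooth (\<lambda>x. f x + g x)"
  by (simp add: smooth_iff_nsmooth nsmooth_add)

lemma smooth_mult: "smooth f \<Longrightarrow> smooth g \<Longrightarrow> smooth (\<lambda>x. f x * g x)"
  by (simp add: smooth_iff_nsmooth nsmooth_mult)

lemma smooth_power: "smooth f \<Longrightarrow> smooth (\<lambda>x. f x ^ n)"
  by (induction n) (auto intro: smooth_const smooth_mult)

lemma smooth_has_deriv: "smooth f \<Longrightarrow> (f has_real_derivative deriv f x) (at x)"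
  using nsmooth_has_deriv smooth_iff_nsmooth by blast

lemma smooth_deriv: "smooth f \<Longrightarrow> smooth (deriv f)"
  by (metis smooth_iff_nsmooth nsmooth_Suc)

lemma smooth_isCont: "smooth f \<Longrightarrow> isCont f x"
  using smooth_has_deriv DERIV_isCont by blast

text \<open>The power in the denominator makes the family closed under differentiation up to linear
  combinations, so one induction over the order of differentiability covers all its members. Only
  \<open>flat_exp 0\<close> is used for bumps.\<close>

definition flat_exp :: "nat \<Rightarrow> real \<Rightarrow> real" where
  "flat_exp n x = (if x \<le> 0 then 0 else exp (- 1 / x) / x ^ n)"

lemma flat_exp_tendsto_0: "(flat_exp n \<longlongrightarrow> 0) (at_right 0)"
proof -
  have "((\<lambda>x::real. inverse x ^ n / exp (inverse x)) \<longlongrightarrow> 0) (at_right 0)"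
    by (rule filterlim_compose[OF tendsto_power_div_exp_0 filterlim_inverse_at_top_right])
  then show ?thesis
    by (rule Lim_transform_eventually)
      (auto simp: flat_exp_def eventually_at_filter exp_minus divide_simps)
qed

lemma flat_exp_has_deriv:
  "(flat_exp n has_real_derivative flat_exp (n + 2) x - real n * flat_exp (n + 1) x) (at x)"
proof -
  consider "x < 0" | "x = 0" | "x > 0" by linarith
  then show ?thesis
  proof cases
    case 1
    have "((\<lambda>_. 0) has_real_derivative 0) (at x)" by simp
    then have "(flat_exp n has_real_derivative 0) (at x)"
      by (rule has_field_derivative_transform_within_open[where S = "{..<0}"])
        (use 1 in \<open>auto simp: flat_exp_def\<close>)
    then show ?thesis using 1 by (simp add: flat_exp_def)
  next
    case 2
    \<comment> \<open>To the right of 0 the difference quotient at 0 is the next member of the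
      family, \<open>flat_exp (n + 1)\<close>.\<close>
    have r: "((\<lambda>x. flat_exp n x / x) \<longlongrightarrow> 0) (at_right 0)"
      using flat_exp_tendsto_0[of "n + 1"]
      by (rule Lim_transform_eventually)
        (auto simp: flat_exp_def eventually_at_filter)
    have l: "((\<lambda>x. flat_exp n x / x) \<longlongrightarrow> 0) (at_left 0)"
      by (rule Lim_transform_eventually[OF tendsto_const])
        (auto simp: flat_exp_def eventually_at_filter)
    have "((\<lambda>x. flat_exp n x / x) \<longlongrightarrow> 0) (at 0)"
      using l r filterlim_split_at by blast
    then show ?thesis
      using 2 by (simp add: has_field_derivative_iff flat_exp_def)
  next
    case 3
    have "((\<lambda>x. exp (- 1 / x) / x ^ n) has_real_derivative
        exp (- 1 / x) / x ^ (n + 2) - real n * (exp (- 1 / x) / x ^ (n + 1))) (at x)"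
    proof (rule derivative_eq_intros DERIV_pow refl)+
      show "(exp (- 1 / x) * ((0 * x - - 1 * 1) / (x * x)) * x ^ n - exp (- 1 / x) * (real n * x ^ (n - Suc 0))) /
          (x ^ n * x ^ n) = exp (- 1 / x) / x ^ (n + 2) - real n * (exp (- 1 / x) / x ^ (n + 1))"
        using 3 by (cases n) (auto simp: field_simps power2_eq_square)
    qed (use 3 in auto)
    then have "(flat_exp n has_real_derivative
        exp (- 1 / x) / x ^ (n + 2) - real n * (exp (- 1 / x) / x ^ (n + 1))) (at x)"
      by (rule has_field_derivative_transform_within_open[where S = "{0<..}"])
        (use 3 in \<open>auto simp: flat_exp_def\<close>)
    then show ?thesis using 3 by (simp add: flat_exp_def)
  qed
qed

lemma nsmooth_flat_exp: "nsmooth m (flat_exp n)"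
proof (induction m arbitrary: n)
  case 0
  then show ?case using flat_exp_has_deriv by (auto simp: nsmooth_0 real_differentiable_def)
next
  case (Suc m)
  have "nsmooth m (\<lambda>x. flat_exp (n + 2) x + (- real n) * flat_exp (n + 1) x)"
    by (intro nsmooth_add nsmooth_mult nsmooth_const Suc)
  then show ?case
    by (intro nsmooth_SucI[OF flat_exp_has_deriv]) simp
qed

lemma flat_exp_0_bounds: "0 \<le> flat_exp 0 x" "flat_exp 0 x \<le> 1"
  by (auto simp: flat_exp_def)

text \<open>The factor \<open>n\<close> steepens both edges: the test functions stay below the
  indicator of the open interval and converge to it pointwise, as dominated convergence
  requires.\<close>

definition bump :: "real \<Rightarrow> real \<Rightarrow> nat \<Rightarrow> real \<Rightarrow> real" where
  "bump a b n x = flat_exp 0 (real n * x + (- real n * a)) * flat_exp 0 (- real n * x + real n * b)"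

lemma bump_support: "x \<notin> {a<..<b} \<Longrightarrow> bump a b n x = 0"
proof -
  assume "x \<notin> {a<..<b}"
  then consider "x \<le> a" | "b \<le> x" by force
  then show ?thesis
  proof cases
    case 1
    then have "real n * x + (- real n * a) \<le> 0" by (simp add: mult_left_mono)
    then show ?thesis by (simp add: bump_def flat_exp_def)
  next
    case 2
    then have "- real n * x + real n * b \<le> 0" by (simp add: mult_left_mono)
    then show ?thesis by (simp add: bump_def flat_exp_def)
  qed
qed

lemma test_function_bump: "test_function (bump a b n)"
proof -
  have "smooth (bump a b n)"
    unfolding bump_def smooth_iff_nsmooth
    by (intro allI nsmooth_mult nsmooth_affine_arg nsmooth_flat_exp)
  moreover have "bump a b n x = 0" if "\<bar>x\<bar> > \<bar>a\<bar> + \<bar>b\<bar>" for x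
    by (rule bump_support) (use that in auto)
  ultimately show ?thesis unfolding test_function_def by blast
qed

lemma bump_tendsto_indicator: "(\<lambda>n. bump a b n x) \<longlonglongrightarrow> indicator {a<..<b} x"
proof (cases "x \<in> {a<..<b}")
  case False
  then show ?thesis by (simp add: bump_support)
next
  case True
  have *: "(\<lambda>n. flat_exp 0 (real n * y)) \<longlonglongrightarrow> 1" if "y > 0" for y :: real
  proof -
    have "(\<lambda>n. exp (- (1 / y) * inverse (real n))) \<longlonglongrightarrow> exp (- (1 / y) * 0)"
      by (intro tendsto_intros lim_inverse_n)
    moreover have "\<forall>\<^sub>F n in sequentially. exp (- (1 / y) * inverse (real n)) = flat_exp 0 (real n * y)"
      using eventually_gt_at_top[of 0]
    proof eventually_elim
      case (elim n)
      then have "real n * y > 0" using that by simp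
      then have "\<not> real n * y \<le> 0" by linarith
      then show ?case using that elim by (simp add: flat_exp_def field_simps)
    qed
    ultimately show ?thesis by (simp add: tendsto_cong)
  qed
  have "(\<lambda>n. flat_exp 0 (real n * (x - a)) * flat_exp 0 (real n * (b - x))) \<longlonglongrightarrow> 1 * 1"
    using True by (intro tendsto_mult *) auto
  then show ?thesis using True by (simp add: bump_def algebra_simps)
qed

lemma abs_bump_le: "\<bar>bump a b n x\<bar> \<le> indicator {a<..<b} x"
proof (cases "x \<in> {a<..<b}")
  case True
  then show ?thesis
    using flat_exp_0_bounds by (auto simp: bump_def abs_mult intro!: mult_le_one)
qed (simp add: bump_support)

subsection \<open>Integrals over the real line\<close>

lemma integral_FTC_real_line:
  fixes f F :: "real \<Rightarrow> real"
  assumes F: "\<And>x. (F has_real_derivative f x) (at x)"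
    and f: "\<And>x. isCont f x" "integrable lborel f"
    and lim: "(F \<longlongrightarrow> A) at_bot" "(F \<longlongrightarrow> B) at_top"
  shows "(\<integral>x. f x \<partial>lborel) = B - A"
proof -
  have "(LBINT x=-\<infinity>..\<infinity>. f x) = B - A"
  proof (rule interval_integral_FTC_integrable)
    show "set_integrable lborel (einterval (- \<infinity>) \<infinity>) f"
      using f(2) by (simp add: set_integrable_def)
    show "((F \<circ> real_of_ereal) \<longlongrightarrow> A) (at_right (- \<infinity>))"
      using lim(1) by (simp add: ereal_tendsto_simps1)
    show "((F \<circ> real_of_ereal) \<longlongrightarrow> B) (at_left \<infinity>)"
      using lim(2) by (simp add: ereal_tendsto_simps1)
  qed (use F f in \<open>auto simp: has_real_derivative_iff_has_vector_derivative\<close>)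
  then show ?thesis
    by (simp add: interval_lebesgue_integral_def set_lebesgue_integral_def)
qed

lemma integrable_exp_abs:
  assumes "r > 0"
  shows "integrable lborel (\<lambda>x::real. exp (- r * \<bar>x\<bar>))"
proof -
  define f where "f x = indicator {0<..} x * exp (- r * x)" for x :: real
  have "set_integrable lborel (einterval 0 \<infinity>) (\<lambda>x. exp (- r * x))"
  proof (rule interval_integral_FTC_nonneg(1))
    show "((\<lambda>x. - exp (- r * x) / r) has_real_derivative exp (- r * x)) (at x)" for x
      using assms by (auto intro!: derivative_eq_intros)
    have "((\<lambda>x. - exp (- r * x) / r) \<longlongrightarrow> - exp (- r * 0) / r) (at_right 0)"
      using assms by (intro tendsto_intros) auto
    then show "(((\<lambda>x. - exp (- r * x) / r) \<circ> real_of_ereal) \<longlongrightarrow> - exp (- r * 0) / r) (at_right 0)"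
      by (simp add: zero_ereal_def ereal_tendsto_simps1)
    have "((\<lambda>x. - exp (- (r * x)) / r) \<longlongrightarrow> - 0 / r) at_top"
      using assms
      by (intro tendsto_intros filterlim_compose[OF exp_at_bot]
          filterlim_compose[OF filterlim_uminus_at_bot_at_top]
          filterlim_tendsto_pos_mult_at_top[OF tendsto_const] filterlim_ident) auto
    then show "(((\<lambda>x. - exp (- r * x) / r) \<circ> real_of_ereal) \<longlongrightarrow> 0) (at_left \<infinity>)"
      by (simp add: ereal_tendsto_simps1)
  qed (auto)
  moreover have "einterval 0 \<infinity> = {0::real<..}"
    by (auto simp: einterval_def zero_ereal_def)
  ultimately have f: "integrable lborel f"
    by (simp add: set_integrable_def f_def[abs_def])
  have "integrable lborel (\<lambda>x. f (0 + (- 1) * x))"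
    by (rule lborel_integrable_real_affine[OF f]) simp
  \<comment> \<open>The indicator restores the value 1 at the origin, which both one-sided
    exponentials omit, so the functions agree everywhere.\<close>
  then have "integrable lborel (\<lambda>x. f x + f (- x) + indicator {0} x)"
    using f by (intro Bochner_Integration.integrable_add) auto
  then show ?thesis
    by (rule back_subst[where P = "integrable lborel"]) (auto simp: f_def indicator_def)
qed

lemma integrable_exp_bounded:
  fixes f :: "real \<Rightarrow> 'a::{banach, second_countable_topology}"
  assumes "f \<in> borel_measurable lborel" "r > 0" "\<And>x. norm (f x) \<le> C * exp (- r * \<bar>x\<bar>)"
  shows "integrable lborel f"
proof (rule Bochner_Integration.integrable_bound)
  show "integrable lborel (\<lambda>x. C * exp (- r * \<bar>x\<bar>))"
    using integrable_exp_abs[OF assms(2)] by simp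
  show "AE x in lborel. norm (f x) \<le> norm (C * exp (- r * \<bar>x\<bar>))"
    using assms(3) by (auto intro!: AE_I2 order_trans[OF assms(3)])
qed (use assms in auto)

lemma continuous_borel_measurable_lborel:
  fixes f :: "real \<Rightarrow> real"
  shows "(\<And>x. isCont f x) \<Longrightarrow> f \<in> borel_measurable lborel"
  by (simp add: borel_measurable_continuous_onI continuous_at_imp_continuous_on)

text \<open>The kernel has a kink at \<open>x\<close>, so the integral is split there. The
  antiderivatives are \<open>exp (y - x) / 2 * (f - f')\<close> on the left and
  \<open>- exp (x - y) / 2 * (f + f')\<close> on the right, and their boundary values at
  \<open>x\<close> add up to \<open>f x\<close>. Boundedness suffices at infinity, which matters
  because the profile tends to \<open>k\<close> and not to 0.\<close>

lemma helmholtz_inv_of_helmholtz: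
  fixes f f' f'' :: "real \<Rightarrow> real"
  assumes f: "\<And>x. (f has_real_derivative f' x) (at x)"
    and f': "\<And>x. (f' has_real_derivative f'' x) (at x)"
    and cont: "\<And>x. isCont f'' x"
    and bd: "\<And>x. \<bar>f x\<bar> \<le> C" "\<And>x. \<bar>f' x\<bar> \<le> C" "\<And>x. \<bar>f'' x\<bar> \<le> C"
  shows "helmholtz_inv (\<lambda>y. f y - f'' y) x = f x"
proof -
  define G where "G y = exp (- \<bar>x - y\<bar>) / 2 * (f y - f'' y)" for y
  have fc: "isCont f y" for y using f DERIV_isCont by blast
  have "norm (G y) \<le> (exp \<bar>x\<bar> * C) * exp (- 1 * \<bar>y\<bar>)" for y
  proof -
    have "norm (G y) = exp (- \<bar>x - y\<bar>) / 2 * \<bar>f y - f'' y\<bar>"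
      by (simp add: G_def abs_mult)
    also have "\<dots> \<le> exp (\<bar>x\<bar> - \<bar>y\<bar>) / 2 * (2 * C)"
      using bd(1)[of y] bd(3)[of y] by (intro mult_mono) auto
    also have "\<dots> = (exp \<bar>x\<bar> * C) * exp (- 1 * \<bar>y\<bar>)"
      by (simp add: exp_diff exp_minus field_simps)
    finally show ?thesis .
  qed
  moreover have Gc: "isCont G y" for y
    unfolding G_def by (intro continuous_intros fc cont) auto
  ultimately have G: "integrable lborel G"
    by (intro integrable_exp_bounded[where r = 1 and C = "exp \<bar>x\<bar> * C"] continuous_borel_measurable_lborel) auto
  have e: "((\<lambda>y. exp (- \<bar>x - y\<bar>) :: real) \<longlongrightarrow> 0) F" if "filterlim abs at_top F" for F
  proof -
    have *: "filterlim (\<lambda>y. - \<bar>x\<bar> + \<bar>y\<bar>) at_top F"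
      by (rule filterlim_tendsto_add_at_top[OF tendsto_const that])
    have "filterlim (\<lambda>y. \<bar>x - y\<bar>) at_top F"
      by (rule filterlim_at_top_mono[OF *], rule always_eventually) auto
    then show ?thesis
      by (intro filterlim_compose[OF exp_at_bot] filterlim_compose[OF filterlim_uminus_at_bot_at_top])
  qed
  have lim0: "((\<lambda>y. exp (- \<bar>x - y\<bar>) / 2 * g y) \<longlongrightarrow> 0) F"
    if "filterlim abs at_top F" "\<And>y. \<bar>g y\<bar> \<le> 2 * C" for F and g :: "real \<Rightarrow> real"
  proof (rule tendsto_0_le[OF e[OF that(1)], where K = "C"])
    show "\<forall>\<^sub>F y in F. norm (exp (- \<bar>x - y\<bar>) / 2 * g y) \<le> norm (exp (- \<bar>x - y\<bar>)) * C"
    proof (rule always_eventually, intro allI)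
      fix y
      show "norm (exp (- \<bar>x - y\<bar>) / 2 * g y) \<le> norm (exp (- \<bar>x - y\<bar>)) * C"
        using mult_left_mono[OF that(2)[of y], of "exp (- \<bar>x - y\<bar>) / 2"] by (simp add: abs_mult)
    qed
  qed
  have f'c: "isCont f' y" for y using f' DERIV_isCont by blast
  have "(LBINT y=-\<infinity>..ereal x. G y) = exp (- \<bar>x - x\<bar>) / 2 * (f x - f' x) - 0"
  proof (rule interval_integral_FTC_integrable)
    define F where "F y = exp (y - x) / 2 * (f y - f' y)" for y
    show "(F has_vector_derivative G y) (at y)" if "ereal y < ereal x" for y
    proof -
      have "(F has_real_derivative exp (y - x) / 2 * (f y - f'' y)) (at y)"
        unfolding F_def by (rule derivative_eq_intros f f' refl | simp add: field_simps)+
      then show ?thesis using that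
        by (simp add: G_def has_real_derivative_iff_has_vector_derivative)
    qed
    show "set_integrable lborel (einterval (- \<infinity>) (ereal x)) G"
      unfolding set_integrable_def by (rule integrable_mult_indicator[OF _ G]) auto
    have "((\<lambda>y. exp (- \<bar>x - y\<bar>) / 2 * (f y - f' y)) \<longlongrightarrow> 0) at_bot"
    proof (rule lim0)
      show "filterlim abs at_top (at_bot :: real filter)"
        by (simp add: filterlim_at_bot_mirror filterlim_abs_real)
      show "\<bar>f y - f' y\<bar> \<le> 2 * C" for y using bd(1)[of y] bd(2)[of y] by linarith
    qed
    then have "(F \<longlongrightarrow> 0) at_bot"
      by (rule Lim_transform_eventually) (auto simp: F_def eventually_at_bot_linorder intro!: exI[of _ x])
    then show "((F \<circ> real_of_ereal) \<longlongrightarrow> 0) (at_right (- \<infinity>))"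
      by (simp add: ereal_tendsto_simps1)
    have "(F \<longlongrightarrow> F x) (at_left x)"
      unfolding F_def by (intro tendsto_intros isCont_tendsto_compose[OF fc] isCont_tendsto_compose[OF f'c]) auto
    then show "((F \<circ> real_of_ereal) \<longlongrightarrow> exp (- \<bar>x - x\<bar>) / 2 * (f x - f' x)) (at_left (ereal x))"
      by (simp add: ereal_tendsto_simps1 F_def)
  qed (use Gc in auto)
  moreover have "(LBINT y=ereal x..\<infinity>. G y) = 0 - (- exp (- \<bar>x - x\<bar>) / 2 * (f x + f' x))"
  proof (rule interval_integral_FTC_integrable)
    define F where "F y = - exp (x - y) / 2 * (f y + f' y)" for y
    show "(F has_vector_derivative G y) (at y)" if "ereal x < ereal y" for y
    proof -
      have "(F has_real_derivative exp (x - y) / 2 * (f y - f'' y)) (at y)"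
        unfolding F_def by (rule derivative_eq_intros f f' refl | simp add: field_simps)+
      then show ?thesis using that
        by (simp add: G_def has_real_derivative_iff_has_vector_derivative)
    qed
    show "set_integrable lborel (einterval (ereal x) \<infinity>) G"
      unfolding set_integrable_def by (rule integrable_mult_indicator[OF _ G]) auto
    have "((\<lambda>y. exp (- \<bar>x - y\<bar>) / 2 * (- (f y + f' y))) \<longlongrightarrow> 0) at_top"
    proof (rule lim0)
      show "filterlim abs at_top (at_top :: real filter)"
        by (rule filterlim_abs_real)
      show "\<bar>- (f y + f' y)\<bar> \<le> 2 * C" for y using bd(1)[of y] bd(2)[of y] by linarith
    qed
    then have "(F \<longlongrightarrow> 0) at_top"
      by (rule Lim_transform_eventually) (auto simp: F_def eventually_at_top_linorder algebra_simps intro!: exI[of _ x])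
    then show "((F \<circ> real_of_ereal) \<longlongrightarrow> 0) (at_left \<infinity>)"
      by (simp add: ereal_tendsto_simps1)
    have "(F \<longlongrightarrow> F x) (at_right x)"
      unfolding F_def by (intro tendsto_intros isCont_tendsto_compose[OF fc] isCont_tendsto_compose[OF f'c]) auto
    then show "((F \<circ> real_of_ereal) \<longlongrightarrow> - exp (- \<bar>x - x\<bar>) / 2 * (f x + f' x)) (at_right (ereal x))"
      by (simp add: ereal_tendsto_simps1 F_def)
  qed (use Gc in auto)
  moreover have "(LBINT y=-\<infinity>..ereal x. G y) + (LBINT y=ereal x..\<infinity>. G y) = (LBINT y=-\<infinity>..\<infinity>. G y)"
    by (rule interval_integral_sum) (use G in \<open>simp add: interval_lebesgue_integrable_def set_integrable_def\<close>)
  moreover have "(LBINT y=-\<infinity>..\<infinity>. G y) = (\<integral>y. G y \<partial>lborel)"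
    by (simp add: interval_lebesgue_integral_def set_lebesgue_integral_def)
  ultimately show ?thesis
    by (simp add: helmholtz_inv_def G_def field_simps)
qed

lemma helmholtz_inv_of_real:
  "helmholtz_inv (\<lambda>y. complex_of_real (f y)) x = of_real (helmholtz_inv f x)"
proof -
  have "helmholtz_inv (\<lambda>y. complex_of_real (f y)) x =
      (\<integral>y. complex_of_real ((exp (- \<bar>x - y\<bar>) / 2) *\<^sub>R f y) \<partial>lborel)"
    unfolding helmholtz_inv_def by (intro Bochner_Integration.integral_cong) (auto simp: scaleR_conv_of_real)
  then show ?thesis
    by (simp add: integral_complex_of_real helmholtz_inv_def del: of_real_mult)
qed

subsection \<open>Square-integrable functions and weak derivatives\<close>

lemma L2_measurable: "f \<in> L2 \<Longrightarrow> f \<in> borel_measurable lborel"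
  by (simp add: L2_def)

lemma L2_integrable_mult:
  assumes f: "f \<in> L2" and g: "g \<in> L2"
  shows "integrable lborel (\<lambda>x. f x * g x)"
proof (rule Bochner_Integration.integrable_bound)
  show "integrable lborel (\<lambda>x. (cmod (f x))^2 + (cmod (g x))^2)"
    using f g by (intro Bochner_Integration.integrable_add) (auto simp: L2_def)
  show "(\<lambda>x. f x * g x) \<in> borel_measurable lborel"
    using f g by (intro borel_measurable_times L2_measurable)
  show "AE x in lborel. norm (f x * g x) \<le> norm ((cmod (f x))^2 + (cmod (g x))^2)"
  proof (rule AE_I2)
    fix x
    have "2 * (cmod (f x) * cmod (g x)) \<le> (cmod (f x))^2 + (cmod (g x))^2"
      using sum_squares_bound[of "cmod (f x)" "cmod (g x)"] by simp
    moreover have "0 \<le> cmod (f x) * cmod (g x)" by simp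
    ultimately have "cmod (f x) * cmod (g x) \<le> (cmod (f x))^2 + (cmod (g x))^2"
      by linarith
    then show "norm (f x * g x) \<le> norm ((cmod (f x))^2 + (cmod (g x))^2)"
      by (simp add: norm_mult)
  qed
qed

lemma L2_add:
  assumes f: "f \<in> L2" and g: "g \<in> L2"
  shows "(\<lambda>x. f x + g x) \<in> L2"
  unfolding L2_def
proof (intro CollectI conjI)
  show "(\<lambda>x. f x + g x) \<in> borel_measurable lborel"
    using L2_measurable[OF f] L2_measurable[OF g] by measurable
  show "integrable lborel (\<lambda>x. (cmod (f x + g x))^2)"
  proof (rule Bochner_Integration.integrable_bound)
    show "integrable lborel (\<lambda>x. 2 * (cmod (f x))^2 + 2 * (cmod (g x))^2)"
      using f g by (intro Bochner_Integration.integrable_add) (auto simp: L2_def)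
    show "(\<lambda>x. (cmod (f x + g x))^2) \<in> borel_measurable lborel"
      using L2_measurable[OF f] L2_measurable[OF g] by measurable
    show "AE x in lborel. norm ((cmod (f x + g x))^2) \<le> norm (2 * (cmod (f x))^2 + 2 * (cmod (g x))^2)"
    proof (rule AE_I2)
      fix x
      have "(cmod (f x + g x))^2 \<le> (cmod (f x) + cmod (g x))^2"
        by (intro power_mono norm_triangle_ineq) auto
      also have "\<dots> \<le> 2 * (cmod (f x))^2 + 2 * (cmod (g x))^2"
        using sum_squares_bound[of "cmod (f x)" "cmod (g x)"] by (simp add: power2_sum)
      finally show "norm ((cmod (f x + g x))^2) \<le> norm (2 * (cmod (f x))^2 + 2 * (cmod (g x))^2)"
        by simp
    qed
  qed
qed

lemma L2_mult_bounded:
  assumes f: "f \<in> L2" and m: "m \<in> borel_measurable lborel" "\<And>x. cmod (m x) \<le> C"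
  shows "(\<lambda>x. m x * f x) \<in> L2"
  unfolding L2_def
proof (intro CollectI conjI)
  show "(\<lambda>x. m x * f x) \<in> borel_measurable lborel"
    using L2_measurable[OF f] m(1) by measurable
  show "integrable lborel (\<lambda>x. (cmod (m x * f x))^2)"
  proof (rule Bochner_Integration.integrable_bound)
    show "integrable lborel (\<lambda>x. C^2 * (cmod (f x))^2)"
      using f by (auto simp: L2_def)
    show "(\<lambda>x. (cmod (m x * f x))^2) \<in> borel_measurable lborel"
      using L2_measurable[OF f] m(1) by measurable
    show "AE x in lborel. norm ((cmod (m x * f x))^2) \<le> norm (C^2 * (cmod (f x))^2)"
      by (rule AE_I2) (auto simp: norm_mult power_mult_distrib intro!: mult_right_mono power_mono m)
  qed
qed

lemma L2_scale: "f \<in> L2 \<Longrightarrow> (\<lambda>x. s * f x) \<in> L2"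
  by (rule L2_mult_bounded[where C = "cmod s"]) auto

lemma L2_exp_bounded:
  assumes "\<And>x. isCont f x" "r > 0" "\<And>x. \<bar>f x\<bar> \<le> C * exp (- r * \<bar>x\<bar>)"
  shows "(\<lambda>x. complex_of_real (f x)) \<in> L2"
  unfolding L2_def
proof safe
  have m: "f \<in> borel_measurable lborel"
    using assms(1) by (rule continuous_borel_measurable_lborel)
  then show "(\<lambda>x. complex_of_real (f x)) \<in> borel_measurable lborel"
    by measurable
  show "integrable lborel (\<lambda>x. (cmod (complex_of_real (f x)))^2)"
  proof (rule integrable_exp_bounded[where r = "2 * r" and C = "C^2"])
    fix x
    have "(\<bar>f x\<bar>)^2 \<le> (C * exp (- r * \<bar>x\<bar>))^2"
      by (intro power_mono assms) auto
    also have "\<dots> = C^2 * exp (- (2 * r) * \<bar>x\<bar>)"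
      by (simp add: power_mult_distrib exp_double[symmetric] mult.assoc)
    finally show "norm ((cmod (complex_of_real (f x)))^2) \<le> C^2 * exp (- (2 * r) * \<bar>x\<bar>)"
      by simp
  qed (use assms m in auto)
qed

lemma test_function_deriv:
  assumes "test_function \<eta>"
  shows "test_function (deriv \<eta>)"
proof -
  obtain R where R: "\<And>x. \<bar>x\<bar> > R \<Longrightarrow> \<eta> x = 0"
    using assms by (auto simp: test_function_def)
  have "deriv \<eta> x = 0" if "\<bar>x\<bar> > R" for x
  proof (rule DERIV_imp_deriv)
    have "((\<lambda>_. 0) has_real_derivative 0) (at x)" by simp
    then show "(\<eta> has_real_derivative 0) (at x)"
      by (rule has_field_derivative_transform_within_open[where S = "{x. \<bar>x\<bar> > R}"])
        (use that R in \<open>auto intro!: open_Collect_less continuous_intros\<close>)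
  qed
  then show ?thesis
    using assms smooth_deriv by (auto simp: test_function_def)
qed

lemma test_function_L2:
  assumes "test_function \<eta>"
  shows "(\<lambda>x. complex_of_real (\<eta> x)) \<in> L2"
proof -
  obtain R where R: "\<And>x. \<bar>x\<bar> > R \<Longrightarrow> \<eta> x = 0"
    using assms by (auto simp: test_function_def)
  have cont: "isCont \<eta> x" for x
    using assms by (auto simp: test_function_def smooth_isCont)
  have "compact (\<eta> ` {-R..R})"
    by (intro compact_continuous_image continuous_at_imp_continuous_on) (auto simp: cont)
  then obtain B where B: "\<And>x. x \<in> {-R..R} \<Longrightarrow> \<bar>\<eta> x\<bar> \<le> B"
    by (metis (no_types, lifting) bounded_iff compact_imp_bounded imageI real_norm_def)
  show ?thesis
  proof (rule L2_exp_bounded[where r = 1 and C = "\<bar>B\<bar> * exp \<bar>R\<bar>"])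
    fix x
    show "\<bar>\<eta> x\<bar> \<le> \<bar>B\<bar> * exp \<bar>R\<bar> * exp (- 1 * \<bar>x\<bar>)"
    proof (cases "\<bar>x\<bar> > R")
      case False
      then have "\<bar>\<eta> x\<bar> \<le> \<bar>B\<bar> * 1"
        using B[of x] by (simp add: abs_le_iff) linarith
      also have "\<dots> \<le> \<bar>B\<bar> * exp (\<bar>R\<bar> - \<bar>x\<bar>)"
        using False by (intro mult_left_mono) auto
      finally show ?thesis by (simp add: exp_diff exp_minus field_simps)
    qed (simp add: R)
  qed (auto simp: cont)
qed

text \<open>Bumps reduce the claim to vanishing integrals over bounded intervals, and induction over
  Borel sets extends this to all measurable sets.\<close>

lemma AE_zero_of_test_functions:
  assumes g: "g \<in> L2"
    and 0: "\<And>\<eta>. test_function \<eta> \<Longrightarrow> (\<integral>x. g x * of_real (\<eta> x) \<partial>lborel) = 0"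
  shows "AE x in lborel. g x = 0"
proof -
  note [measurable] = L2_measurable[OF g]
  have ind: "(\<lambda>x. complex_of_real (indicator {a<..<b} x)) \<in> L2" for a b :: real
  proof -
    have "(\<lambda>x. (cmod (complex_of_real (indicator {a<..<b} x)))^2) = indicator {a<..<b}"
      by (auto simp: indicator_def)
    moreover have "integrable lborel (indicator {a<..<b} :: real \<Rightarrow> real)"
      by (cases "a \<le> b") (auto intro!: integrable_real_indicator)
    ultimately show ?thesis by (simp add: L2_def)
  qed
  have int: "integrable lborel (\<lambda>x. g x * of_real (indicator {a<..<b} x))" for a b :: real
    by (rule L2_integrable_mult[OF g ind])
  have box: "(\<integral>x. g x * of_real (indicator {a<..<b} x) \<partial>lborel) = 0" for a b :: real
  proof -
    have "(\<lambda>n. \<integral>x. g x * of_real (bump a b n x) \<partial>lborel) \<longlonglongrightarrow>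
        (\<integral>x. g x * of_real (indicator {a<..<b} x) \<partial>lborel)"
    proof (rule integral_dominated_convergence[where w = "\<lambda>x. norm (g x * of_real (indicator {a<..<b} x))"])
      show "integrable lborel (\<lambda>x. norm (g x * of_real (indicator {a<..<b} x)))"
        using int by (rule integrable_norm)
      show "(\<lambda>x. g x * of_real (bump a b n x)) \<in> borel_measurable lborel" for n
        using test_function_L2[OF test_function_bump] g
        by (intro borel_measurable_times L2_measurable)
      show "AE x in lborel. (\<lambda>n. g x * of_real (bump a b n x)) \<longlonglongrightarrow> g x * of_real (indicator {a<..<b} x)"
        by (intro AE_I2 tendsto_mult tendsto_const tendsto_of_real bump_tendsto_indicator)
      show "AE x in lborel. norm (g x * of_real (bump a b n x)) \<le> norm (g x * of_real (indicator {a<..<b} x))" for n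
        using abs_bump_le by (auto intro!: AE_I2 mult_left_mono simp: norm_mult)
    qed measurable
    then show ?thesis
      by (simp add: 0[OF test_function_bump] LIMSEQ_const_iff)
  qed
  \<comment> \<open>A square-integrable function need not be integrable on the line; cut off to a
    bounded interval it is.\<close>
  have "AE x in lborel. g x * of_real (indicator {-real N<..<real N} x) = 0" for N
  proof (rule sigma_finite_measure.density_zero[OF sigma_finite_lborel])
    let ?f = "\<lambda>x. g x * of_real (indicator {-real N<..<real N} x)"
    show f: "integrable lborel ?f" by (rule int)
    fix A :: "real set"
    assume "A \<in> sets lborel"
    then have "A \<in> sets borel" by simp
    then show "set_lebesgue_integral lborel A ?f = 0"
    proof (induction A rule: borel_set_induct)
      case empty
      show ?case by (simp add: set_lebesgue_integral_def)
    next
      case (interval a b)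
      have "set_lebesgue_integral lborel {a..b} ?f =
          (\<integral>x. g x * of_real (indicator {max a (-real N)<..<min b (real N)} x) \<partial>lborel)"
        unfolding set_lebesgue_integral_def
      proof (rule integral_cong_AE)
        show "AE x in lborel. indicator {a..b} x *\<^sub>R ?f x =
            g x * of_real (indicator {max a (-real N)<..<min b (real N)} x)"
          using AE_lborel_singleton[of a] AE_lborel_singleton[of b]
          by eventually_elim (auto simp: indicator_def)
      qed auto
      then show ?case
        using box by simp
    next
      case (compl A)
      have s: "set_integrable lborel B ?f" if "B \<in> sets lborel" for B
        unfolding set_integrable_def using that f by (rule integrable_mult_indicator)
      have "set_lebesgue_integral lborel (A \<union> - A) ?f =
          set_lebesgue_integral lborel A ?f + set_lebesgue_integral lborel (- A) ?f"
        by (rule set_integral_Un) (use compl in \<open>auto intro!: s\<close>)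
      moreover have "set_lebesgue_integral lborel UNIV ?f = 0"
        using box[of "-real N" "real N"] by (simp add: set_lebesgue_integral_def)
      ultimately show ?case
        using compl by simp
    next
      case (union A)
      have "set_lebesgue_integral lborel (\<Union> (range A)) ?f = (\<Sum>i. set_lebesgue_integral lborel (A i) ?f)"
      proof (rule lebesgue_integral_countable_add)
        show "set_integrable lborel (\<Union> (range A)) ?f"
          unfolding set_integrable_def using union by (intro integrable_mult_indicator f) auto
      qed (use union in \<open>auto simp: disjoint_family_on_def\<close>)
      then show ?case
        by (simp add: union)
    qed
  qed
  then have "AE x in lborel. \<forall>N. g x * of_real (indicator {-real N<..<real N} x) = 0"
    unfolding AE_all_countable by blast
  then show ?thesis
  proof eventually_elim
    case (elim x)
    obtain N where "\<bar>x\<bar> < real N" using reals_Archimedean2 by blast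
    then show ?case using elim[rule_format, of N] by (auto simp: indicator_def)
  qed
qed

lemma weak_deriv_unique:
  assumes "is_weak_deriv f g" "is_weak_deriv f h" "g \<in> L2" "h \<in> L2"
  shows "AE x in lborel. g x = h x"
proof -
  have d: "(\<lambda>x. g x + (- 1) * h x) \<in> L2"
    using assms by (intro L2_add L2_scale)
  have "AE x in lborel. g x + (- 1) * h x = 0"
  proof (rule AE_zero_of_test_functions[OF d])
    fix \<eta> assume \<eta>: "test_function \<eta>"
    have "(\<integral>x. g x * of_real (\<eta> x) \<partial>lborel) = (\<integral>x. h x * of_real (\<eta> x) \<partial>lborel)"
      using assms(1)[unfolded is_weak_deriv_def, rule_format, OF \<eta>]
        assms(2)[unfolded is_weak_deriv_def, rule_format, OF \<eta>] by simp
    then show "(\<integral>x. (g x + (- 1) * h x) * of_real (\<eta> x) \<partial>lborel) = 0"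
      using L2_integrable_mult[OF assms(3) test_function_L2[OF \<eta>]]
        L2_integrable_mult[OF assms(4) test_function_L2[OF \<eta>]]
      by (simp add: algebra_simps)
  qed
  then show ?thesis by simp
qed

text \<open>Makes the choice in \<open>wderiv\<close> harmless: once some weak derivative in
  \<open>L2\<close> is exhibited, the chosen one agrees with it almost everywhere.\<close>

lemma wderiv_props:
  assumes "is_weak_deriv f g" "g \<in> L2"
  shows "wderiv f \<in> L2" "is_weak_deriv f (wderiv f)" "AE x in lborel. wderiv f x = g x"
proof -
  have "wderiv f \<in> L2 \<and> is_weak_deriv f (wderiv f)"
    unfolding wderiv_def by (rule someI[of _ g]) (use assms in auto)
  then show "wderiv f \<in> L2" "is_weak_deriv f (wderiv f)" "AE x in lborel. wderiv f x = g x"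
    using weak_deriv_unique assms by blast+
qed

lemma is_weak_deriv_cong_AE:
  assumes "is_weak_deriv f h" "AE x in lborel. f x = g x" "f \<in> L2" "g \<in> L2"
  shows "is_weak_deriv g h"
  unfolding is_weak_deriv_def
proof (intro allI impI)
  fix \<eta> assume \<eta>: "test_function \<eta>"
  note [measurable] = L2_measurable[OF test_function_L2[OF test_function_deriv[OF \<eta>]]]
    L2_measurable[OF assms(3)] L2_measurable[OF assms(4)]
  have "(\<integral>x. g x * of_real (deriv \<eta> x) \<partial>lborel) = (\<integral>x. f x * of_real (deriv \<eta> x) \<partial>lborel)"
    using assms(2) by (intro integral_cong_AE) auto
  then show "(\<integral>x. g x * of_real (deriv \<eta> x) \<partial>lborel) = - (\<integral>x. h x * of_real (\<eta> x) \<partial>lborel)"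
    using assms(1) \<eta> by (simp add: is_weak_deriv_def)
qed

lemma is_weak_deriv_lincomb:
  assumes "is_weak_deriv f f'" "is_weak_deriv g g'" "f \<in> L2" "f' \<in> L2" "g \<in> L2" "g' \<in> L2"
  shows "is_weak_deriv (\<lambda>x. f x + s * g x) (\<lambda>x. f' x + s * g' x)"
  unfolding is_weak_deriv_def
proof (intro allI impI)
  fix \<eta> assume \<eta>: "test_function \<eta>"
  have i: "integrable lborel (\<lambda>x. h x * of_real (\<eta> x))"
    "integrable lborel (\<lambda>x. h x * of_real (deriv \<eta> x))" if "h \<in> L2" for h
    using that \<eta> by (auto intro!: L2_integrable_mult test_function_L2 test_function_deriv)
  show "(\<integral>x. (f x + s * g x) * of_real (deriv \<eta> x) \<partial>lborel) = - (\<integral>x. (f' x + s * g' x) * of_real (\<eta> x) \<partial>lborel)"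
    using assms(1,2) \<eta> i[OF assms(3)] i[OF assms(4)] i[OF assms(5)] i[OF assms(6)]
    by (simp add: is_weak_deriv_def distrib_right mult.assoc)
qed

text \<open>The product of \<open>p\<close> with a test function is again a test function, and
  testing \<open>f\<close> against it gives the product rule.\<close>

lemma is_weak_deriv_smooth_mult:
  assumes fg: "is_weak_deriv f g" "f \<in> L2" "g \<in> L2" and p: "smooth p"
  shows "is_weak_deriv (\<lambda>x. of_real (p x) * f x) (\<lambda>x. of_real (deriv p x) * f x + of_real (p x) * g x)"
  unfolding is_weak_deriv_def
proof (intro allI impI)
  fix \<eta> assume \<eta>: "test_function \<eta>"
  then have s: "smooth \<eta>" by (simp add: test_function_def)
  have t: "test_function (\<lambda>x. q x * \<zeta> x)" if "smooth q" "test_function \<zeta>" for q \<zeta>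
    using that unfolding test_function_def by (metis mult_zero_right smooth_mult)
  have d: "deriv (\<lambda>x. p x * \<eta> x) x = deriv p x * \<eta> x + p x * deriv \<eta> x" for x
    by (rule DERIV_imp_deriv) (auto intro!: derivative_eq_intros smooth_has_deriv p s)
  have i: "integrable lborel (\<lambda>x. h x * of_real (p x * \<eta> x))"
    "integrable lborel (\<lambda>x. h x * of_real (p x * deriv \<eta> x))"
    "integrable lborel (\<lambda>x. h x * of_real (deriv p x * \<eta> x))" if "h \<in> L2" for h
    using that \<eta> p by (auto intro!: L2_integrable_mult test_function_L2 t test_function_deriv smooth_deriv
        simp del: of_real_mult)
  have "(\<integral>x. f x * of_real (deriv p x * \<eta> x + p x * deriv \<eta> x) \<partial>lborel) =
      - (\<integral>x. g x * of_real (p x * \<eta> x) \<partial>lborel)"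
    using fg(1)[unfolded is_weak_deriv_def, rule_format, OF t[OF p \<eta>]] by (simp only: d)
  then have "(\<integral>x. f x * of_real (p x * deriv \<eta> x) \<partial>lborel) =
     - (\<integral>x. f x * of_real (deriv p x * \<eta> x) \<partial>lborel) - (\<integral>x. g x * of_real (p x * \<eta> x) \<partial>lborel)"
    using i[OF fg(2)] by (simp add: distrib_left eq_diff_eq minus_diff_eq del: of_real_mult) (simp add: eq_neg_iff_add_eq_0 add.commute add.left_commute)
  also have "\<dots> = - (\<integral>x. f x * of_real (deriv p x * \<eta> x) + g x * of_real (p x * \<eta> x) \<partial>lborel)"
    using i[OF fg(2)] i[OF fg(3)] by (simp del: of_real_mult)
  finally show "(\<integral>x. of_real (p x) * f x * of_real (deriv \<eta> x) \<partial>lborel) =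
      - (\<integral>x. (of_real (deriv p x) * f x + of_real (p x) * g x) * of_real (\<eta> x) \<partial>lborel)"
    by (simp add: algebra_simps)
qed

lemma is_weak_deriv_classical:
  assumes f: "\<And>x. (f has_real_derivative f' x) (at x)" "\<And>x. isCont f' x"
    and L: "(\<lambda>x. complex_of_real (f x)) \<in> L2" "(\<lambda>x. complex_of_real (f' x)) \<in> L2"
  shows "is_weak_deriv (\<lambda>x. of_real (f x)) (\<lambda>x. of_real (f' x))"
  unfolding is_weak_deriv_def
proof (intro allI impI)
  fix \<eta> assume \<eta>: "test_function \<eta>"
  then have s: "smooth \<eta>" by (simp add: test_function_def)
  obtain R where R: "\<And>x. \<bar>x\<bar> > R \<Longrightarrow> \<eta> x = 0"
    using \<eta> by (auto simp: test_function_def)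
  have i: "integrable lborel (\<lambda>x. f' x * \<eta> x)" "integrable lborel (\<lambda>x. f x * deriv \<eta> x)"
    using L2_integrable_mult[OF L(2) test_function_L2[OF \<eta>]]
      L2_integrable_mult[OF L(1) test_function_L2[OF test_function_deriv[OF \<eta>]]]
    by (simp_all only: of_real_mult[symmetric] complex_of_real_integrable_eq)
  have fc: "isCont f x" for x using f(1) DERIV_isCont by blast
  have "(\<integral>x. f' x * \<eta> x + f x * deriv \<eta> x \<partial>lborel) = 0 - 0"
  proof (rule integral_FTC_real_line)
    show "((\<lambda>x. f x * \<eta> x) has_real_derivative f' x * \<eta> x + f x * deriv \<eta> x) (at x)" for x
      by (rule derivative_eq_intros f smooth_has_deriv s | simp)+
    show "isCont (\<lambda>x. f' x * \<eta> x + f x * deriv \<eta> x) x" for x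
      by (intro continuous_intros f fc smooth_isCont smooth_deriv s)
    show "((\<lambda>x. f x * \<eta> x) \<longlongrightarrow> 0) at_bot"
      by (rule Lim_transform_eventually[OF tendsto_const])
        (use R in \<open>auto simp: eventually_at_bot_dense intro!: exI[of _ "- \<bar>R\<bar>"]\<close>)
    show "((\<lambda>x. f x * \<eta> x) \<longlongrightarrow> 0) at_top"
      by (rule Lim_transform_eventually[OF tendsto_const])
        (use R in \<open>auto simp: eventually_at_top_dense intro!: exI[of _ "\<bar>R\<bar>"]\<close>)
  qed (use i in auto)
  then have "(\<integral>x. f x * deriv \<eta> x \<partial>lborel) = - (\<integral>x. f' x * \<eta> x \<partial>lborel)"
    using i by simp
  then show "(\<integral>x. of_real (f x) * of_real (deriv \<eta> x) \<partial>lborel) =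
      - (\<integral>x. complex_of_real (f' x) * of_real (\<eta> x) \<partial>lborel)"
    unfolding of_real_mult[symmetric] integral_complex_of_real by simp
qed

lemma helmholtz_inv_lincomb:
  assumes "f \<in> L2" "g \<in> L2"
  shows "helmholtz_inv (\<lambda>y. f y + s * g y) x = helmholtz_inv f x + s * helmholtz_inv g x"
proof -
  have e: "(\<lambda>y. complex_of_real (exp (- \<bar>x - y\<bar>) / 2)) \<in> L2"
  proof (rule L2_exp_bounded[where r = 1 and C = "exp \<bar>x\<bar>"])
    fix y
    have "\<bar>exp (- \<bar>x - y\<bar>) / 2\<bar> \<le> exp (\<bar>x\<bar> - \<bar>y\<bar>)"
      using exp_le_cancel_iff[of "- \<bar>x - y\<bar>" "\<bar>x\<bar> - \<bar>y\<bar>"] exp_gt_zero[of "- \<bar>x - y\<bar>"]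
      by (simp del: exp_le_cancel_iff exp_gt_zero) linarith
    then show "\<bar>exp (- \<bar>x - y\<bar>) / 2\<bar> \<le> exp \<bar>x\<bar> * exp (- 1 * \<bar>y\<bar>)"
      by (simp add: exp_diff exp_minus field_simps)
  qed (auto intro!: continuous_intros)
  have "integrable lborel (\<lambda>y. (exp (- \<bar>x - y\<bar>) / 2) *\<^sub>R h y)" if "h \<in> L2" for h :: "real \<Rightarrow> complex"
    using L2_integrable_mult[OF e that] by (simp add: scaleR_conv_of_real)
  note i = this[OF assms(1)] this[OF assms(2)]
  have "helmholtz_inv (\<lambda>y. f y + s * g y) x =
      (\<integral>y. (exp (- \<bar>x - y\<bar>) / 2) *\<^sub>R f y + s * ((exp (- \<bar>x - y\<bar>) / 2) *\<^sub>R g y) \<partial>lborel)"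
    unfolding helmholtz_inv_def
    by (intro Bochner_Integration.integral_cong) (auto simp: scaleR_conv_of_real algebra_simps)
  also have "\<dots> = helmholtz_inv f x + s * helmholtz_inv g x"
    unfolding helmholtz_inv_def
    using i by (simp only: Bochner_Integration.integral_add integrable_mult_right integral_mult_right_zero)
  finally show ?thesis .
qed

text \<open>\<open>\<L>\<close> contains two nested choices of weak derivatives. The inner one is
  replaced up to a null set, which leaves the weak derivative of the weighted function unchanged,
  and then the outer one. The bounds on the weight and its derivative keep the products in
  \<open>L2\<close>.\<close>

lemma \<L>_eq:
  assumes w: "w \<in> L2" "g \<in> L2" "h \<in> L2" "is_weak_deriv w g" "is_weak_deriv g h"
    and p: "smooth p" "\<And>x. \<bar>p x\<bar> \<le> C" "\<And>x. \<bar>deriv p x\<bar> \<le> C"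
    and \<mu>: "\<And>x. \<mu> x powr (-8/3) = p x"
  shows "AE x in lborel. \<L> c k \<mu> w x =
     2/3 * (- 3 * (of_real (deriv p x) * g x + of_real (p x) * h x)
            + of_real (8 * deriv (deriv \<mu>) x * \<mu> x powr (-11/3)
                       - 44/3 * (deriv \<mu> x)^2 * \<mu> x powr (-14/3)
                       + 15 * \<mu> x powr (-8/3)) * w x)
     - of_real (2 * \<omega>1 c k / 9 * \<mu> x powr (-4/3)) * w x
     + of_real (2 * \<omega>0 c k) * helmholtz_inv w x"
proof -
  have pm: "(\<lambda>x. complex_of_real (p x)) \<in> borel_measurable lborel"
    "(\<lambda>x. complex_of_real (deriv p x)) \<in> borel_measurable lborel"
    using continuous_borel_measurable_lborel[OF smooth_isCont[OF p(1)]]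
      continuous_borel_measurable_lborel[OF smooth_isCont[OF smooth_deriv[OF p(1)]]] by measurable
  have mult: "(\<lambda>x. of_real (p x) * f x) \<in> L2" "(\<lambda>x. of_real (deriv p x) * f x) \<in> L2" if "f \<in> L2" for f
    using L2_mult_bounded[OF that pm(1), of C] L2_mult_bounded[OF that pm(2), of C] p by auto
  note w' = wderiv_props[OF w(4,2)]
  have "is_weak_deriv (\<lambda>x. of_real (p x) * g x) (\<lambda>x. of_real (deriv p x) * g x + of_real (p x) * h x)"
    using w p by (intro is_weak_deriv_smooth_mult)
  then have "is_weak_deriv (\<lambda>x. of_real (p x) * wderiv w x) (\<lambda>x. of_real (deriv p x) * g x + of_real (p x) * h x)"
    by (rule is_weak_deriv_cong_AE) (use w'(3) in \<open>auto intro!: mult w w'(1)\<close>)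
  then have "AE x in lborel. wderiv (\<lambda>x. of_real (p x) * wderiv w x) x =
      of_real (deriv p x) * g x + of_real (p x) * h x"
    by (rule wderiv_props) (intro L2_add mult w)
  then show ?thesis
    by eventually_elim (simp only: \<L>_def \<mu>)
qed

subsection \<open>Bounded and exponentially decaying functions\<close>

lemma exp_abs_tendsto_0:
  assumes "r > 0" "filterlim abs at_top F"
  shows "((\<lambda>x::real. exp (- r * \<bar>x\<bar>)) \<longlongrightarrow> 0) F"
proof -
  have "filterlim (\<lambda>x. r * \<bar>x\<bar>) at_top F"
    using assms by (intro filterlim_tendsto_pos_mult_at_top[OF tendsto_const])
  then show ?thesis
    by (auto intro: filterlim_compose[OF exp_at_bot filterlim_compose[OF filterlim_uminus_at_bot_at_top]])
qed

text \<open>Constants and rates are quantified away in this predicate and the next, so that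
  integrability, boundary limits and membership in \<open>H2\<close> of long expressions follow from
  closure rules alone.\<close>

definition bdd_fun :: "(real \<Rightarrow> real) \<Rightarrow> bool" where
  "bdd_fun f \<longleftrightarrow> (\<exists>B. \<forall>x. \<bar>f x\<bar> \<le> B)"

definition exp_decay :: "(real \<Rightarrow> real) \<Rightarrow> bool" where
  "exp_decay f \<longleftrightarrow> (\<exists>C r. 0 < r \<and> (\<forall>x. \<bar>f x\<bar> \<le> C * exp (- r * \<bar>x\<bar>)))"

lemma bdd_fun_const: "bdd_fun (\<lambda>x. d)"
  by (auto simp: bdd_fun_def)

lemma bdd_fun_minus: "bdd_fun f \<Longrightarrow> bdd_fun (\<lambda>x. - f x)"
  by (auto simp: bdd_fun_def)

lemma bdd_fun_add: "bdd_fun f \<Longrightarrow> bdd_fun g \<Longrightarrow> bdd_fun (\<lambda>x. f x + g x)"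
  unfolding bdd_fun_def by (meson abs_triangle_ineq add_mono order_trans)

lemma bdd_fun_diff: "bdd_fun f \<Longrightarrow> bdd_fun g \<Longrightarrow> bdd_fun (\<lambda>x. f x - g x)"
  using bdd_fun_add[of f "\<lambda>x. - g x"] bdd_fun_minus[of g] by simp

lemma bdd_fun_mult: "bdd_fun f \<Longrightarrow> bdd_fun g \<Longrightarrow> bdd_fun (\<lambda>x. f x * g x)"
proof -
  assume "bdd_fun f" "bdd_fun g"
  then obtain A B where "\<And>x. \<bar>f x\<bar> \<le> A" "\<And>x. \<bar>g x\<bar> \<le> B" by (auto simp: bdd_fun_def)
  then have "\<bar>f x * g x\<bar> \<le> A * B" for x
    unfolding abs_mult by (intro mult_mono) (auto intro: order_trans[OF abs_ge_zero])
  then show ?thesis by (auto simp: bdd_fun_def)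
qed

lemma bdd_fun_power: "bdd_fun f \<Longrightarrow> bdd_fun (\<lambda>x. f x ^ n)"
  by (induction n) (auto intro: bdd_fun_const bdd_fun_mult)

text \<open>Meant for \<open>\<rho>\<close>, \<open>s\<close> and \<open>1 / s\<close>, whose
  squares are rational in \<open>t\<close>.\<close>

lemma bdd_fun_of_square: "bdd_fun (\<lambda>x. (f x)^2) \<Longrightarrow> bdd_fun f"
proof -
  assume "bdd_fun (\<lambda>x. (f x)^2)"
  then obtain B where B: "\<And>x. \<bar>(f x)^2\<bar> \<le> B" by (auto simp: bdd_fun_def)
  have "\<bar>f x\<bar> \<le> 1 + B" for x
  proof -
    have "0 \<le> (\<bar>f x\<bar> - 1)^2" by simp
    then have "2 * \<bar>f x\<bar> \<le> 1 + (f x)^2" by (simp add: power2_diff)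
    then show ?thesis using B[of x] by simp
  qed
  then show ?thesis by (auto simp: bdd_fun_def)
qed

lemmas bdd_fun_intros = bdd_fun_const bdd_fun_minus bdd_fun_add bdd_fun_diff bdd_fun_mult bdd_fun_power

lemma exp_decay_imp_bdd: "exp_decay f \<Longrightarrow> bdd_fun f"
proof -
  assume "exp_decay f"
  then obtain C r where r: "0 < r" "\<And>x. \<bar>f x\<bar> \<le> C * exp (- r * \<bar>x\<bar>)" by (auto simp: exp_decay_def)
  have "0 \<le> C" using r(2)[of 0] by simp
  then have "C * exp (- r * \<bar>x\<bar>) \<le> C * 1" for x using r(1) by (intro mult_left_mono) auto
  then have "\<bar>f x\<bar> \<le> C" for x using order_trans[OF r(2)[of x]] by simp
  then show ?thesis by (auto simp: bdd_fun_def)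
qed

lemma exp_decay_add:
  assumes "exp_decay f" "exp_decay g"
  shows "exp_decay (\<lambda>x. f x + g x)"
proof -
  obtain A r B d where r: "0 < r" "\<And>x. \<bar>f x\<bar> \<le> A * exp (- r * \<bar>x\<bar>)"
    and d: "0 < d" "\<And>x. \<bar>g x\<bar> \<le> B * exp (- d * \<bar>x\<bar>)"
    using assms by (auto simp: exp_decay_def)
  have A: "0 \<le> A" using r(2)[of 0] by simp
  have B: "0 \<le> B" using d(2)[of 0] by simp
  have "\<bar>f x + g x\<bar> \<le> (A + B) * exp (- min r d * \<bar>x\<bar>)" for x
  proof -
    have "exp (- r * \<bar>x\<bar>) \<le> exp (- min r d * \<bar>x\<bar>)" "exp (- d * \<bar>x\<bar>) \<le> exp (- min r d * \<bar>x\<bar>)"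
      by (auto intro!: mult_right_mono)
    then have "A * exp (- r * \<bar>x\<bar>) \<le> A * exp (- min r d * \<bar>x\<bar>)" "B * exp (- d * \<bar>x\<bar>) \<le> B * exp (- min r d * \<bar>x\<bar>)"
      using A B by (auto intro!: mult_left_mono)
    then show ?thesis
      using r(2)[of x] d(2)[of x] by (simp add: distrib_right) linarith
  qed
  moreover have "0 < min r d" using r d by simp
  ultimately show ?thesis unfolding exp_decay_def by blast
qed

lemma exp_decay_mult:
  assumes "bdd_fun g" "exp_decay f"
  shows "exp_decay (\<lambda>x. g x * f x)"
proof -
  obtain A r B where r: "0 < r" "\<And>x. \<bar>f x\<bar> \<le> A * exp (- r * \<bar>x\<bar>)" "\<And>x. \<bar>g x\<bar> \<le> B"
    using assms by (auto simp: exp_decay_def bdd_fun_def)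
  have "0 \<le> B" using order_trans[OF abs_ge_zero r(3)[of 0]] .
  then have "\<bar>g x * f x\<bar> \<le> (B * A) * exp (- r * \<bar>x\<bar>)" for x
    unfolding abs_mult mult.assoc by (intro mult_mono r) auto
  then show ?thesis using r(1) unfolding exp_decay_def by blast
qed

lemma exp_decay_mult': "exp_decay f \<Longrightarrow> bdd_fun g \<Longrightarrow> exp_decay (\<lambda>x. f x * g x)"
  using exp_decay_mult[of g f] by (simp add: mult.commute)

text \<open>Half of the rate is spent on absorbing the linear factor. The factor in view is the
  coordinate shift \<open>\<Xi>\<close>, whose derivative is bounded.\<close>

lemma exp_decay_mult_linear:
  assumes "exp_decay f" "\<And>x. \<bar>X x\<bar> \<le> A + B * \<bar>x\<bar>" "0 \<le> B"
  shows "exp_decay (\<lambda>x. f x * X x)"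
proof -
  obtain C r where r: "0 < r" "\<And>x. \<bar>f x\<bar> \<le> C * exp (- r * \<bar>x\<bar>)"
    using assms by (auto simp: exp_decay_def)
  have C: "0 \<le> C" using r(2)[of 0] by simp
  have A: "0 \<le> A" using order_trans[OF abs_ge_zero assms(2)[of 0]] by simp
  have "\<bar>f x * X x\<bar> \<le> (C * (A + 2 * B / r)) * exp (- (r / 2) * \<bar>x\<bar>)" for x
  proof -
    have "1 + r / 2 * \<bar>x\<bar> \<le> exp (r / 2 * \<bar>x\<bar>)" by (rule exp_ge_add_one_self)
    moreover have "0 \<le> r / 2 * \<bar>x\<bar>" using r by simp
    ultimately have e: "1 \<le> exp (r / 2 * \<bar>x\<bar>)" "r / 2 * \<bar>x\<bar> \<le> exp (r / 2 * \<bar>x\<bar>)" by linarith+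
    have "B * \<bar>x\<bar> = (2 * B / r) * (r / 2 * \<bar>x\<bar>)" using r by simp
    also have "\<dots> \<le> (2 * B / r) * exp (r / 2 * \<bar>x\<bar>)"
      using e(2) r assms(3) by (intro mult_left_mono) auto
    finally have "A + B * \<bar>x\<bar> \<le> A * exp (r / 2 * \<bar>x\<bar>) + (2 * B / r) * exp (r / 2 * \<bar>x\<bar>)"
      using mult_left_mono[OF e(1) A] by simp
    then have X: "\<bar>X x\<bar> \<le> (A + 2 * B / r) * exp (r / 2 * \<bar>x\<bar>)"
      using assms(2)[of x] by (simp add: distrib_right)
    have "\<bar>f x * X x\<bar> \<le> (C * exp (- r * \<bar>x\<bar>)) * ((A + 2 * B / r) * exp (r / 2 * \<bar>x\<bar>))"
      unfolding abs_mult using C by (intro mult_mono r X) auto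
    also have "\<dots> = (C * (A + 2 * B / r)) * (exp (- r * \<bar>x\<bar>) * exp (r / 2 * \<bar>x\<bar>))" by simp
    also have "exp (- r * \<bar>x\<bar>) * exp (r / 2 * \<bar>x\<bar>) = exp (- (r / 2) * \<bar>x\<bar>)"
      by (simp flip: exp_add)
    finally show ?thesis .
  qed
  moreover have "0 < r / 2" using r by simp
  ultimately show ?thesis unfolding exp_decay_def by blast
qed

lemma exp_decay_tendsto_0:
  assumes "exp_decay f"
  shows "(f \<longlongrightarrow> 0) at_top" "(f \<longlongrightarrow> 0) at_bot"
proof -
  obtain C r where r: "0 < r" "\<And>x. \<bar>f x\<bar> \<le> C * exp (- r * \<bar>x\<bar>)"
    using assms by (auto simp: exp_decay_def)
  have "(f \<longlongrightarrow> 0) F" if F: "filterlim abs at_top F" for F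
  proof -
    have "((\<lambda>x. C * exp (- r * \<bar>x\<bar>)) \<longlongrightarrow> C * 0) F"
      by (rule tendsto_mult[OF tendsto_const exp_abs_tendsto_0[OF r(1) F]])
    then have "((\<lambda>x. C * exp (- r * \<bar>x\<bar>)) \<longlongrightarrow> 0) F" by (simp only: mult_zero_right)
    then show ?thesis
      by (rule Lim_null_comparison[OF always_eventually, rotated]) (use r in auto)
  qed
  then show "(f \<longlongrightarrow> 0) at_top" "(f \<longlongrightarrow> 0) at_bot"
    using filterlim_abs_real filterlim_abs_real[unfolded filterlim_at_top_mirror, simplified] by blast+
qed

lemma exp_decay_integrable:
  assumes "exp_decay f" "\<And>x. isCont f x"
  shows "integrable lborel f"
  using assms integrable_exp_bounded[OF continuous_borel_measurable_lborel[OF assms(2)]]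
  unfolding exp_decay_def by auto

lemma exp_decay_L2:
  assumes "exp_decay f" "\<And>x. isCont f x"
  shows "(\<lambda>x. complex_of_real (f x)) \<in> L2"
  using assms L2_exp_bounded[OF assms(2)] unfolding exp_decay_def by auto

lemma classical_H2:
  assumes "\<And>x. (w has_real_derivative w1 x) (at x)" "\<And>x. (w1 has_real_derivative w2 x) (at x)"
    "\<And>x. isCont w2 x" "exp_decay w" "exp_decay w1" "exp_decay w2"
  shows "(\<lambda>x. complex_of_real (w x)) \<in> L2" "(\<lambda>x. complex_of_real (w1 x)) \<in> L2" (is ?g2) "(\<lambda>x. complex_of_real (w2 x)) \<in> L2" (is ?g3)
    "is_weak_deriv (\<lambda>x. of_real (w x)) (\<lambda>x. of_real (w1 x))" (is ?g4)
    "is_weak_deriv (\<lambda>x. of_real (w1 x)) (\<lambda>x. of_real (w2 x))" (is ?g5)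
    "(\<lambda>x. complex_of_real (w x)) \<in> H2"
proof -
  have c: "isCont w x" "isCont w1 x" for x using assms(1,2) DERIV_isCont by blast+
  show L: "(\<lambda>x. complex_of_real (w x)) \<in> L2" ?g2 ?g3
    using assms c by (auto intro: exp_decay_L2)
  show d: ?g4
    ?g5
    using assms c L by (auto intro: is_weak_deriv_classical)
  show "(\<lambda>x. complex_of_real (w x)) \<in> H2"
    unfolding H2_def using L d by blast
qed

subsection \<open>Solitary waves in reciprocal coordinates\<close>

lemma continuous_antiderivative:
  fixes f :: "real \<Rightarrow> real"
  assumes "\<And>x. isCont f x"
  obtains F where "\<And>x. (F has_real_derivative f x) (at x)"
  using einterval_antiderivative[of "-\<infinity>" "\<infinity>" f] assms
  by (auto simp: has_real_derivative_iff_has_vector_derivative)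

text \<open>A Gronwall argument: \<open>2 * \<bar>u * u'\<bar>\<close> is at most
  \<open>(1 + G) * u^2\<close>, so with \<open>A\<close> an antiderivative of \<open>1 + G\<close>,
  the product \<open>u^2 * exp (- A)\<close> is nonincreasing and \<open>u^2 * exp A\<close> is
  nondecreasing; a zero spreads to the right by the former and to the left by the latter.\<close>

lemma zero_of_deriv_bound:
  fixes u u' G :: "real \<Rightarrow> real"
  assumes u: "\<And>x. (u has_real_derivative u' x) (at x)"
    and G: "\<And>x. isCont G x" "\<And>x. (u' x)^2 \<le> G x * (u x)^2" and z: "u x0 = 0"
  shows "u x = 0"
proof -
  obtain A where A: "\<And>x. (A has_real_derivative 1 + G x) (at x)"
    using continuous_antiderivative[of "\<lambda>x. 1 + G x"] G(1) by (auto intro: continuous_intros)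
  have b: "\<bar>2 * u y * u' y\<bar> \<le> (1 + G y) * (u y)^2" for y
  proof -
    have "\<bar>2 * u y * u' y\<bar> \<le> (u y)^2 + (u' y)^2"
      using zero_le_power2[of "u y - u' y"] zero_le_power2[of "u y + u' y"]
      by (simp add: power2_diff power2_sum abs_le_iff)
    then show ?thesis using G(2)[of y] by (simp add: algebra_simps)
  qed
  show ?thesis
  proof (cases "x0 \<le> x")
    case True
    have "(u x)^2 * exp (- A x) \<le> (u x0)^2 * exp (- A x0)"
    proof (rule DERIV_nonpos_imp_nonincreasing[where f = "\<lambda>y. (u y)^2 * exp (- A y)", OF True])
      fix y
      have "((\<lambda>y. (u y)^2 * exp (- A y)) has_real_derivative
          (2 * u y * u' y - (1 + G y) * (u y)^2) * exp (- A y)) (at y)"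
        by (rule derivative_eq_intros u A refl | simp add: algebra_simps)+
      moreover have "(2 * u y * u' y - (1 + G y) * (u y)^2) * exp (- A y) \<le> 0"
        using b[of y] by (intro mult_nonpos_nonneg) auto
      ultimately show "\<exists>z. ((\<lambda>y. (u y)^2 * exp (- A y)) has_real_derivative z) (at y) \<and> z \<le> 0"
        by blast
    qed
    then show ?thesis using z by (simp add: mult_le_0_iff not_le[symmetric])
  next
    case False
    have "(u x)^2 * exp (A x) \<le> (u x0)^2 * exp (A x0)"
    proof (rule DERIV_nonneg_imp_nondecreasing[where f = "\<lambda>y. (u y)^2 * exp (A y)"])
      fix y
      have "((\<lambda>y. (u y)^2 * exp (A y)) has_real_derivative
          (2 * u y * u' y + (1 + G y) * (u y)^2) * exp (A y)) (at y)"
        by (rule derivative_eq_intros u A refl | simp add: algebra_simps)+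
      moreover have "(2 * u y * u' y + (1 + G y) * (u y)^2) * exp (A y) \<ge> 0"
        using b[of y] by (intro mult_nonneg_nonneg) auto
      ultimately show "\<exists>z. ((\<lambda>y. (u y)^2 * exp (A y)) has_real_derivative z) (at y) \<and> 0 \<le> z"
        by blast
    qed (use False in auto)
    then show ?thesis using z by (simp add: mult_le_0_iff not_le[symmetric])
  qed
qed

lemma powr_of_root:
  fixes y :: real
  assumes "0 < y" "z = y ^ n" "n > 0"
  shows "z powr (r / real n) = y powr r"
  using assms by (simp add: powr_realpow[symmetric] powr_powr)

text \<open>In terms of the profile, with \<open>q = sqrt (c - k\<^sup>2)\<close>: \<open>s = sqrt (c - \<phi>\<^sup>2)\<close>, \<open>t = \<phi>/s\<close>, which tends to \<open>k/q\<close>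
  at infinity, and \<open>\<rho> = - \<phi>'/(s (t - k/q))\<close>. Up to a constant, \<open>\<rho>\<close> is the hyperbolic tangent \<open>\<tau>\<close>.\<close>

locale novikov_wave =
  fixes k q :: real and t s \<rho> :: "real \<Rightarrow> real"
  assumes k: "0 < k" and q: "0 < q" and kq: "3 * k^2 < q^2"
    and t': "(t has_real_derivative - \<rho> x * (t x - k / q) * (1 + (t x)^2)) (at x)"
    and s': "(s has_real_derivative s x * t x * \<rho> x * (t x - k / q)) (at x)"
    and \<rho>': "(\<rho> has_real_derivative k * q ^ 3 / (k^2 + q^2)^2 * (t x - k / q) * (1 + (t x)^2)) (at x)"
    and s_pos: "0 < s x"
    and s_sq: "(s x)^2 * (1 + (t x)^2) = k^2 + q^2"
    and \<rho>_sq: "(k^2 + q^2)^2 * (\<rho> x)^2 = q^2 * (q^2 - k^2 - 2 * k * q * t x)"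
    and t_gt: "k / q < t x"
    and \<rho>_0: "\<rho> 0 = 0"
    and decay: "\<exists>C r. 0 < r \<and> (\<forall>x. t x - k / q \<le> C * exp (- r * \<bar>x\<bar>))"

lemma wave_a_eq:
  assumes "0 < q" "c = k^2 + q^2"
  shows "wave_a c k = k * q ^ 3"
proof -
  have "(c - k^2) powr (3 / real 2) = q powr 3"
    by (rule powr_of_root) (use assms in auto)
  then show ?thesis
    using assms by (simp add: wave_a_def powr_numeral)
qed

text \<open>The value of \<open>E\<close> belongs to an orbit asymptotic to the state
  \<open>t = k / q\<close>. Multiplying by \<open>1 + t^2\<close> eliminates \<open>s\<close> and
  leaves a cubic in \<open>t\<close> with a double root there; the simple root is the crest.\<close>

lemma first_integral_factor:
  fixes k q t s E c :: real
  assumes "0 < q" "c = k^2 + q^2" "0 < k" "s^2 * (1 + t^2) = c"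
    "E = k^2 * (c - 2 * k^2) / (2 * c)"
  shows "c^2 * (2 * E + (s * t)^2 - 2 * (k * q ^ 3) * t / c) = s^2 * (t - k / q)^2 * (q^2 * (q^2 - k^2 - 2 * k * q * t))"
proof -
  have c: "c > 0" using assms by (simp add: add_pos_pos)
  have p: "1 + t^2 > 0" by (simp add: add_pos_nonneg)
  have "(1 + t^2) * (c^2 * (2 * E + (s * t)^2 - 2 * (k * q ^ 3) * t / c)) =
     c * (k^2 * (q^2 - k^2) * (1 + t^2) + c * (s^2 * (1 + t^2)) * t^2 - 2 * (k * q ^ 3) * t * (1 + t^2))"
  proof -
    have "c^2 * (2 * E) = c * (k^2 * (c - 2 * k^2))" "c^2 * (2 * (k * q ^ 3) * t / c) = c * (2 * (k * q ^ 3) * t)"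
      using c unfolding assms(5) by (simp_all add: power2_eq_square)
    moreover have "c - 2 * k^2 = q^2 - k^2" using assms(2) by simp
    ultimately have *: "c^2 * (2 * E + (s * t)^2 - 2 * (k * q ^ 3) * t / c) =
        c * (k^2 * (q^2 - k^2)) + c^2 * (s * t)^2 - c * (2 * (k * q ^ 3) * t)"
      by (simp only: ring_distribs)
    show ?thesis unfolding * unfolding power_mult_distrib by algebra
  qed
  also have "\<dots> = c * ((q * t - k)^2 * (q^2 - k^2 - 2 * k * q * t))"
    unfolding assms(4) unfolding assms(2) by algebra
  also have "\<dots> = (s^2 * (1 + t^2)) * ((t - k / q)^2 * (q^2 * (q^2 - k^2 - 2 * k * q * t)))"
    unfolding assms(4) using assms(1) by (simp add: field_simps power2_eq_square)
  also have "\<dots> = (1 + t^2) * (s^2 * (t - k / q)^2 * (q^2 * (q^2 - k^2 - 2 * k * q * t)))"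
    by (simp add: algebra_simps)
  finally show ?thesis using p by simp
qed

text \<open>Transfers the decay of \<open>\<phi> - k\<close> to \<open>t - k / q\<close>. The upper
  bound on \<open>t\<close> bounds \<open>s\<close> from below, namely
  \<open>4 * k^2 * q^2 \<le> c * s^2\<close>. Then
  \<open>c * (q^2 - s^2) = s^2 * q^2 * u * (t + k / q)\<close> is compared with
  \<open>q^2 - s^2 = (f - k) * (f + k)\<close>.\<close>

lemma profile_bound:
  fixes k q t s c f :: real
  assumes q: "0 < q" and k: "0 < k" and c: "c = k^2 + q^2" and s: "0 < s" "s^2 * (1 + t^2) = c"
    and f: "f = s * t" and t: "k / q < t" "2 * k * q * t \<le> q^2 - k^2" and u: "u = t - k / q"
  shows "4 * k^2 * q ^ 3 * u \<le> c^2 * \<bar>f - k\<bar>"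
proof -
  have c_pos: "c > 0" using c q by (simp add: add_nonneg_pos)
  have t0: "0 < k / q" using k q by simp
  then have t_pos: "0 < t" using t by simp
  have u_pos: "0 < u" using t u by simp
  have "(2 * k * q * t)^2 \<le> (q^2 - k^2)^2"
    using t(2) t_pos k q by (intro power_mono) auto
  then have "(4 * k^2 * q^2) * (1 + t^2) \<le> c^2"
    unfolding c by (simp add: algebra_simps power2_eq_square)
  also have "c^2 = (c * s^2) * (1 + t^2)" using s by (simp add: power2_eq_square mult.assoc)
  finally have s_ge: "4 * k^2 * q^2 \<le> c * s^2"
    by (rule mult_right_le_imp_le) (simp add: add_pos_nonneg)
  have c': "q^2 * (1 + (k / q)^2) = c" using q c by (simp add: field_simps)
  have "c * (q^2 - s^2) = (s^2 * (1 + t^2)) * q^2 - (q^2 * (1 + (k / q)^2)) * s^2"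
    unfolding s c' by (simp add: algebra_simps)
  also have "\<dots> = s^2 * q^2 * u * (t + k / q)"
    unfolding u by (simp add: algebra_simps power2_eq_square)
  finally have key: "c * (q^2 - s^2) = s^2 * q^2 * u * (t + k / q)" .
  have "0 < s^2 * q^2 * u * (t + k / q)" using s q u_pos t_pos t0 by simp
  then have "0 < c * (q^2 - s^2)" unfolding key .
  then have sq: "s^2 < q^2" using c_pos by (simp add: zero_less_mult_iff)
  then have "s < q" using q s(1) by (simp add: power_less_imp_less_base)
  have fk: "(f - k) * (f + k) = q^2 - s^2"
    using s(2) unfolding f c by (simp add: algebra_simps power2_eq_square)
  have fk_pos: "0 < f + k" using f s t_pos k by (simp add: add_pos_pos)
  have "0 < (f - k) * (f + k)" unfolding fk using sq by simp
  then have f_gt: "0 < f - k" using fk_pos by (simp add: zero_less_mult_iff)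
  have "s * t \<le> q * t" using \<open>s < q\<close> t_pos by simp
  then have le: "f + k \<le> q * (t + k / q)" using f q by (simp add: field_simps)
  have "s^2 * q^2 * u * (t + k / q) = c * (f - k) * (f + k)"
    using key fk by (simp add: mult.assoc)
  also have "\<dots> \<le> c * (f - k) * (q * (t + k / q))"
    using le f_gt c_pos by (intro mult_left_mono) auto
  finally have "(s^2 * q * u) * (q * (t + k / q)) \<le> (c * (f - k)) * (q * (t + k / q))"
    by (simp only: mult_ac power2_eq_square)
  then have *: "s^2 * q * u \<le> c * (f - k)"
    by (rule mult_right_le_imp_le) (use q t_pos t0 in auto)
  have "4 * k^2 * q ^ 3 * u = (4 * k^2 * q^2) * (q * u)" by (simp add: power2_eq_square power3_eq_cube)
  also have "\<dots> \<le> (c * s^2) * (q * u)" using s_ge q u_pos by (intro mult_right_mono) auto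
  also have "\<dots> = c * (s^2 * q * u)" by simp
  also have "\<dots> \<le> c * (c * (f - k))" using * c_pos by (intro mult_left_mono) auto
  finally show ?thesis using f_gt by (simp add: power2_eq_square mult.assoc)
qed

lemma solitary_profile_wave:
  assumes prof: "solitary_profile c k \<phi>" and c: "c = k^2 + q^2" and q: "0 < q" and k: "0 < k"
    and kq: "3 * k^2 < q^2"
  obtains t s \<rho> where "novikov_wave k q t s \<rho>" "\<And>x. \<phi> x = s x * t x"
    "\<And>x. deriv \<phi> x = - s x * \<rho> x * (t x - k / q)" "\<And>x. momentum \<phi> x = k * q ^ 3 / s x ^ 3"
    "smooth \<phi>"
proof -
  define a where "a = k * q ^ 3"
  define s where "s x = sqrt (c - (\<phi> x)^2)" for x
  define t where "t x = \<phi> x / s x" for x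
  define u where "u x = t x - k / q" for x
  have c_pos: "c > 0" using c q by (simp add: add_nonneg_pos)
  have sm: "smooth \<phi>" and lt: "\<And>x. (\<phi> x)^2 < c" and lim: "(\<phi> \<longlongrightarrow> k) at_top"
    and d0: "deriv \<phi> 0 = 0" and nc: "\<not> \<phi> constant_on UNIV"
    and dec: "\<And>n. \<exists>C r. r > 0 \<and> (\<forall>x. \<bar>(deriv ^^ n) (\<lambda>y. \<phi> y - k) x\<bar> \<le> C * exp (- r * \<bar>x\<bar>))"
    and ode: "\<And>x. \<phi> x - deriv (deriv \<phi>) x = wave_a c k * (c - (\<phi> x)^2) powr (-3/2)"
    using prof by (auto simp: solitary_profile_def)
  have s_pos: "s x > 0" for x using lt[of x] by (simp add: s_def)
  have s2: "(s x)^2 = c - (\<phi> x)^2" for x using lt[of x] by (simp add: s_def)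
  have \<phi>: "\<phi> x = s x * t x" for x using s_pos[of x] by (simp add: t_def)
  have s_sq: "(s x)^2 * (1 + (t x)^2) = c" for x
    using s2[of x] unfolding \<phi>[of x] by (simp add: algebra_simps power_mult_distrib)
  have "(c - (\<phi> x)^2) powr (-3/2) = 1 / s x ^ 3" for x
  proof -
    have "(c - (\<phi> x)^2) powr (-3 / real 2) = s x powr (-3)"
      by (rule powr_of_root) (use s_pos s2 in auto)
    then show ?thesis using s_pos[of x] by (simp add: powr_minus_divide powr_numeral)
  qed
  then have ode': "\<phi> x - deriv (deriv \<phi>) x = a / s x ^ 3" for x
    using ode[of x] by (simp add: wave_a_eq[OF q c] a_def)
  have \<phi>1: "(\<phi> has_real_derivative deriv \<phi> x) (at x)" for x
    by (rule smooth_has_deriv[OF sm])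
  have \<phi>2: "(deriv \<phi> has_real_derivative \<phi> x - a / s x ^ 3) (at x)" for x
    using smooth_has_deriv[OF smooth_deriv[OF sm], of x] ode'[of x] by (simp add: algebra_simps)
  have s1: "(s has_real_derivative - t x * deriv \<phi> x) (at x)" for x
  proof -
    have "((\<lambda>x. sqrt (c - (\<phi> x)^2)) has_real_derivative
       inverse (sqrt (c - (\<phi> x)^2)) / 2 * (- 2 * \<phi> x * deriv \<phi> x)) (at x)"
      using lt[of x] by (auto intro!: derivative_eq_intros \<phi>1)
    then show ?thesis
      by (simp add: s_def[symmetric] t_def field_simps)
  qed
  have t1: "(t has_real_derivative deriv \<phi> x * c / s x ^ 3) (at x)" for x
  proof -
    have "((\<lambda>x. \<phi> x / s x) has_real_derivative
       (deriv \<phi> x * s x - \<phi> x * (- t x * deriv \<phi> x)) / (s x * s x)) (at x)"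
      using s_pos[of x] by (intro derivative_intros \<phi>1 s1) auto
    moreover have "(deriv \<phi> x * s x - \<phi> x * (- t x * deriv \<phi> x)) / (s x * s x) = deriv \<phi> x * c / s x ^ 3"
      using s_pos[of x] unfolding s_sq[of x, symmetric] \<phi>[of x]
      by (simp add: field_simps power2_eq_square power3_eq_cube)
    ultimately show ?thesis by (simp add: t_def[abs_def])
  qed
  have cont: "isCont t x" "isCont s x" for x using t1 s1 DERIV_isCont by blast+
  define I where "I x = (deriv \<phi> x)^2 / 2 - (\<phi> x)^2 / 2 + a * t x / c" for x
  have I0: "(I has_real_derivative 0) (at x)" for x
  proof -
    have "(I has_real_derivative deriv \<phi> x * (\<phi> x - a / s x ^ 3) - \<phi> x * deriv \<phi> x + a * (deriv \<phi> x * c / s x ^ 3) / c) (at x)"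
      unfolding I_def by (rule derivative_eq_intros \<phi>1 \<phi>2 t1 refl | use c_pos in simp)+
    then show ?thesis using c_pos s_pos[of x] by (simp add: algebra_simps)
  qed
  have sk: "sqrt (c - k^2) = q" using c q by simp
  have lim_t: "(t \<longlongrightarrow> k / q) at_top"
  proof -
    have "((\<lambda>x. \<phi> x / sqrt (c - (\<phi> x)^2)) \<longlongrightarrow> k / sqrt (c - k^2)) at_top"
      by (intro tendsto_intros lim) (use sk q in auto)
    then show ?thesis by (simp add: sk t_def[abs_def] s_def)
  qed
  have lim_d: "(deriv \<phi> \<longlongrightarrow> 0) at_top"
  proof (rule exp_decay_tendsto_0)
    have "deriv (\<lambda>y. \<phi> y - k) x = deriv \<phi> x" for x
      by (rule DERIV_imp_deriv) (auto intro!: derivative_eq_intros \<phi>1)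
    then show "exp_decay (deriv \<phi>)"
      using dec[of 1] by (simp add: exp_decay_def)
  qed
  \<comment> \<open>The conserved quantity is evaluated in the limit at infinity, where
    \<open>\<phi>\<close> tends to \<open>k\<close> and its derivative to 0.\<close>
  have I: "I x = wave_E c k" for x
  proof -
    have I_const: "I y = I 0" for y
      using I0 DERIV_isconst_all by blast
    have "(I \<longlongrightarrow> I 0) at_top"
      by (rule Lim_transform_eventually[OF tendsto_const]) (simp add: I_const[symmetric])
    moreover have "(I \<longlongrightarrow> 0^2 / 2 - k^2 / 2 + a * (k / q) / c) at_top"
      unfolding I_def by (rule tendsto_intros lim_d lim lim_t | use c_pos in simp)+
    ultimately have "I 0 = 0^2 / 2 - k^2 / 2 + a * (k / q) / c"
      by (rule tendsto_unique[rotated]) simp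
    also have "\<dots> = wave_E c k"
    proof -
      have "a * (k / q) = k^2 * q^2" using q by (simp add: a_def power2_eq_square power3_eq_cube)
      then have "2 * c * (0^2 / 2 - k^2 / 2 + a * (k / q) / c) = 2 * (k^2 * q^2) - c * k^2"
        using c_pos by (simp add: field_simps)
      also have "\<dots> = k^2 * (c - 2 * k^2)" unfolding c by algebra
      finally show ?thesis using c_pos by (simp add: wave_E_def field_simps)
    qed
    finally show ?thesis using I_const[of x] by simp
  qed
  have fi: "c^2 * (deriv \<phi> x)^2 = (s x)^2 * (u x)^2 * (q^2 * (q^2 - k^2 - 2 * k * q * t x))" for x
  proof -
    have "(deriv \<phi> x)^2 = 2 * wave_E c k + (s x * t x)^2 - 2 * (k * q ^ 3) * t x / c"
      using I[of x] by (simp add: I_def a_def \<phi>[symmetric] field_simps)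
    then show ?thesis
      using first_integral_factor[OF q c k s_sq wave_E_def, of x] by (simp add: u_def)
  qed
  have u1: "(u has_real_derivative deriv \<phi> x * c / s x ^ 3) (at x)" for x
    unfolding u_def by (auto intro!: derivative_eq_intros t1)
  \<comment> \<open>Uniqueness for the first-order equation: a profile that reached its asymptotic
    state would stay there and be constant.\<close>
  have u_ne: "u x \<noteq> 0" for x
  proof
    assume "u x = 0"
    have "u y = 0" for y
    proof (rule zero_of_deriv_bound[OF u1 _ _ \<open>u x = 0\<close>])
      fix y
      show "isCont (\<lambda>y. q^2 * (q^2 - k^2 - 2 * k * q * t y) / (s y) ^ 4) y"
        using s_pos[of y] by (intro continuous_intros cont) auto
      have "(deriv \<phi> y * c / s y ^ 3)^2 = (c^2 * (deriv \<phi> y)^2) / s y ^ 6"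
        by (simp add: power_mult_distrib power_divide power_mult[symmetric] mult.commute)
      also have "\<dots> = q^2 * (q^2 - k^2 - 2 * k * q * t y) / (s y) ^ 4 * (u y)^2"
      proof -
        have *: "s y ^ 6 = (s y)^2 * s y ^ 4" by (simp flip: power_add)
        show ?thesis unfolding fi * using s_pos[of y] by (simp del: power_add_numeral)
      qed
      finally show "(deriv \<phi> y * c / s y ^ 3)^2 \<le> q^2 * (q^2 - k^2 - 2 * k * q * t y) / (s y) ^ 4 * (u y)^2"
        by simp
    qed
    then have "deriv \<phi> y = 0" for y using fi[of y] c_pos by simp
    then have "(\<phi> has_real_derivative 0) (at y)" for y using \<phi>1[of y] by simp
    then have "\<phi> constant_on UNIV"
      using DERIV_isconst_all[of \<phi>] unfolding constant_on_def by blast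
    then show False using nc by simp
  qed
  define \<rho> where "\<rho> x = - deriv \<phi> x / (s x * u x)" for x
  have d\<phi>: "deriv \<phi> x = - s x * \<rho> x * u x" for x
    using s_pos[of x] u_ne[of x] by (simp add: \<rho>_def)
  have \<rho>_sq: "c^2 * (\<rho> x)^2 = q^2 * (q^2 - k^2 - 2 * k * q * t x)" for x
    using fi[of x] s_pos[of x] u_ne[of x]
    by (simp add: d\<phi> power_mult_distrib mult.left_commute[of "c^2"] mult.commute[of "(\<rho> x)^2"] mult.assoc)
  have s1': "(s has_real_derivative s x * t x * \<rho> x * u x) (at x)" for x
    using s1[of x] by (simp add: d\<phi> algebra_simps)
  have u1': "(u has_real_derivative - \<rho> x * u x * (1 + (t x)^2)) (at x)" for x
  proof -
    have "deriv \<phi> x * c / s x ^ 3 = - \<rho> x * u x * (1 + (t x)^2)"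
      using s_pos[of x] unfolding s_sq[of x, symmetric]
      by (simp add: d\<phi> field_simps power2_eq_square power3_eq_cube)
    then show ?thesis using u1[of x] by (simp only:)
  qed
  \<comment> \<open>Differentiating \<open>\<rho>_sq\<close> would require division by
    \<open>\<rho>\<close>, which vanishes at the crest. The quotient defining \<open>\<rho>\<close>
    is differentiated instead, with the second-order equation for \<open>\<phi>\<close>.\<close>
  have \<rho>1: "(\<rho> has_real_derivative k * q ^ 3 / c^2 * u x * (1 + (t x)^2)) (at x)" for x
  proof -
    let ?s = "s x" and ?t = "t x" and ?u = "u x" and ?r = "\<rho> x"
    have nz: "?s \<noteq> 0" "?u \<noteq> 0" using s_pos[of x] u_ne[of x] by auto
    have "(\<rho> has_real_derivative (- (\<phi> x - a / ?s ^ 3) * (?s * ?u) - (- deriv \<phi> x) *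
         (?s * ?t * ?r * ?u * ?u + (- ?r * ?u * (1 + ?t^2)) * ?s)) / (?s * ?u * (?s * ?u))) (at x)"
      unfolding \<rho>_def[abs_def] using nz
      by (intro derivative_intros \<phi>2 s1'[unfolded \<rho>_def] u1'[unfolded \<rho>_def]) auto
    moreover have "(- (\<phi> x - a / ?s ^ 3) * (?s * ?u) - (- deriv \<phi> x) *
         (?s * ?t * ?r * ?u * ?u + (- ?r * ?u * (1 + ?t^2)) * ?s)) / (?s * ?u * (?s * ?u)) =
       k * q ^ 3 / c^2 * ?u * (1 + ?t^2)"
    proof -
      have e1: "a / ?s ^ 3 = a * ?s * (1 + ?t^2)^2 / c^2"
      proof -
        have c2: "c^2 = ?s ^ 3 * (?s * (1 + ?t^2)^2)" unfolding s_sq[of x, symmetric] by algebra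
        have "1 + ?t^2 \<noteq> 0" by (smt (verit) zero_le_power2)
        then have "?s * (1 + ?t^2)^2 \<noteq> 0" using nz by simp
        then show ?thesis
          unfolding c2 mult.assoc[of a] by (rule nonzero_mult_divide_mult_cancel_right[symmetric])
      qed
      have "- (c^2 * ?t - a * (1 + ?t^2)^2) - (c^2 * ?r^2) * ?u * (?t * ?u - (1 + ?t^2)) =
         a * ?u^2 * (1 + ?t^2)"
      proof -
        have qu: "q * ?u = q * ?t - k" using q by (simp add: u_def field_simps)
        have "q * (- (c^2 * ?t - a * (1 + ?t^2)^2) - (c^2 * ?r^2) * ?u * (?t * ?u - (1 + ?t^2))) =
           q * (a * ?u^2 * (1 + ?t^2))"
          unfolding \<rho>_sq using qu unfolding a_def c by algebra
        then show ?thesis using q by simp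
      qed
      then have e2: "- (?t - a * (1 + ?t^2)^2 / c^2) - ?r^2 * ?u * (?t * ?u - (1 + ?t^2)) =
         a / c^2 * ?u^2 * (1 + ?t^2)"
        using c_pos by (simp add: field_simps)
      have "(- (\<phi> x - a / ?s ^ 3) * (?s * ?u) - (- deriv \<phi> x) *
         (?s * ?t * ?r * ?u * ?u + (- ?r * ?u * (1 + ?t^2)) * ?s)) =
          ?s^2 * ?u * (- (?t - a * (1 + ?t^2)^2 / c^2) - ?r^2 * ?u * (?t * ?u - (1 + ?t^2)))"
        unfolding e1 \<phi>[of x] d\<phi>[of x] by (simp add: algebra_simps power2_eq_square)
      also have "\<dots> = (?s * ?u * (?s * ?u)) * (k * q ^ 3 / c^2 * ?u * (1 + ?t^2))"
        unfolding e2 by (simp add: a_def power2_eq_square)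
      finally show ?thesis using nz by simp
    qed
    ultimately show ?thesis by simp
  qed
  have \<rho>0: "\<rho> 0 = 0" by (simp add: \<rho>_def d0)
  \<comment> \<open>At the crest \<open>\<rho>\<close> vanishes, so \<open>t\<close> takes the
    simple root \<open>(q^2 - k^2) / (2 * k * q)\<close>, which exceeds \<open>k / q\<close> because
    \<open>3 * k^2 < q^2\<close>.\<close>
  have u0: "u 0 > 0"
  proof -
    have "2 * k * q * t 0 = q^2 - k^2" using \<rho>_sq[of 0] \<rho>0 q by simp
    moreover have "2 * k * q * u 0 = 2 * k * q * t 0 - 2 * k^2"
      using q by (simp add: u_def right_diff_distrib power2_eq_square)
    ultimately have "2 * k * q * u 0 > 0" using kq by linarith
    then show ?thesis by (rule zero_less_mult_pos) (use k q in simp)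
  qed
  have u_pos: "u x > 0" for x
  proof (rule ccontr)
    assume "\<not> u x > 0"
    then have "u x \<le> 0" by simp
    have cu: "isCont u y" for y using u1 DERIV_isCont by blast
    have "\<exists>y. u y = 0"
      using IVT'[of u x 0 0] IVT2'[of u x 0 0] \<open>u x \<le> 0\<close> u0 cu
      by (metis continuous_at_imp_continuous_on linear less_imp_le)
    then show False using u_ne by blast
  qed
  have decu: "\<exists>C r. 0 < r \<and> (\<forall>x. u x \<le> C * exp (- r * \<bar>x\<bar>))"
  proof -
    obtain C r where r: "r > 0" "\<And>x. \<bar>\<phi> x - k\<bar> \<le> C * exp (- r * \<bar>x\<bar>)"
      using dec[of 0] by auto
    have "u x \<le> (c^2 / (4 * k^2 * q ^ 3) * C) * exp (- r * \<bar>x\<bar>)" for x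
    proof -
      have "4 * k^2 * q ^ 3 * u x \<le> c^2 * \<bar>\<phi> x - k\<bar>"
      proof (rule profile_bound[OF q k c s_pos s_sq \<phi> _ _ u_def])
        show "k / q < t x" using u_pos[of x] by (simp add: u_def)
        have "0 \<le> q^2 * (q^2 - k^2 - 2 * k * q * t x)"
          unfolding \<rho>_sq[symmetric] by simp
        then show "2 * k * q * t x \<le> q^2 - k^2" using q by (simp add: zero_le_mult_iff)
      qed
      also have "\<dots> \<le> c^2 * (C * exp (- r * \<bar>x\<bar>))"
        by (intro mult_left_mono r) auto
      finally show ?thesis using q k by (simp add: field_simps)
    qed
    then show ?thesis using r(1) by blast
  qed
  show thesis
  proof (rule that[of t s \<rho>])
    show "novikov_wave k q t s \<rho>"
      unfolding novikov_wave_def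
    proof (intro conjI allI)
      fix x
      show "(t has_real_derivative - \<rho> x * (t x - k / q) * (1 + (t x)^2)) (at x)"
        using DERIV_add[OF u1'[of x] DERIV_const[of "k / q"]] by (simp add: u_def)
    qed (use k q kq s1' \<rho>1 s_pos s_sq \<rho>_sq u_pos \<rho>0 decu in \<open>auto simp: u_def c\<close>)
  qed (use \<phi> d\<phi> ode' sm in \<open>auto simp: u_def momentum_def a_def\<close>)
qed

subsection \<open>Polynomial identities\<close>


text \<open>As in the identities below, \<open>u = t - k / q\<close> enters without division as
  \<open>q * u = q * t - k\<close>, and the square of \<open>\<rho>\<close> is eliminated by the
  first integral where it occurs. Claims not directly polynomial in these data are first multiplied
  by a power of \<open>q\<close>, cancelled at the end.\<close>

lemma T_deriv_identity:
  fixes k q t u \<rho> c :: real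
  assumes u: "q * u = q * t - k" and q: "q \<noteq> 0"
    and r: "c^2 * \<rho>^2 = q^2 * (q^2 - k^2 - 2 * k * q * t)"
  shows "t * (q^2 * u * (3 * k * q * t - q^2)) - c^2 * \<rho>^2 * u^2
    = q * u * (5 * k * q^2 * t^2 - (2 * q ^ 3 + k^2 * q) * t + k * q^2 - k ^ 3)"
proof -
  have "q * (t * (q^2 * u * (3 * k * q * t - q^2)) - q^2 * (q^2 - k^2 - 2 * k * q * t) * u^2)
    = q * (q * u * (5 * k * q^2 * t^2 - (2 * q ^ 3 + k^2 * q) * t + k * q^2 - k ^ 3))"
    using u by algebra
  then show ?thesis using q unfolding r by simp
qed

lemma \<rho>u_deriv_identity:
  fixes k q t u \<rho> c :: real
  assumes u: "q * u = q * t - k" and q: "q \<noteq> 0"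
    and r: "c^2 * \<rho>^2 = q^2 * (q^2 - k^2 - 2 * k * q * t)"
  shows "k * q ^ 3 * u^2 - c^2 * \<rho>^2 * u = q^2 * u * (3 * k * q * t - q^2)"
  unfolding r using u by algebra

lemma euler_lagrange_identity:
  fixes k q t u \<rho> c :: real
  assumes u: "q * u = q * t - k" and q: "q \<noteq> 0" and c: "c = k^2 + q^2"
    and r: "c^2 * \<rho>^2 = q^2 * (q^2 - k^2 - 2 * k * q * t)"
  shows "c^2 - c^2 * \<rho>^2 * t^2 * u^2
     - (1 + t^2) * (q * u * (5 * k * q^2 * t^2 - (2 * q ^ 3 + k^2 * q) * t + k * q^2 - k ^ 3))
    = (1 + t^2)^2 * (q^2 * (q^2 + 3 * k^2) - 3 * k * q ^ 3 * t)"
proof -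
  have "q^2 * (c^2 - q^2 * (q^2 - k^2 - 2 * k * q * t) * t^2 * u^2
     - (1 + t^2) * (q * u * (5 * k * q^2 * t^2 - (2 * q ^ 3 + k^2 * q) * t + k * q^2 - k ^ 3)))
    = q^2 * ((1 + t^2)^2 * (q^2 * (q^2 + 3 * k^2) - 3 * k * q ^ 3 * t))"
    using u unfolding c by algebra
  then show ?thesis using q unfolding r by simp
qed

text \<open>The part free of \<open>\<Xi>\<close> of the equation for \<open>\<L>\<close> on the
  explicit preimage, cleared of denominators. The linear function \<open>\<nu>\<close> is the
  coefficient of \<open>\<rho> * u\<close> in the derivative of \<open>n \<Xi>\<close>.\<close>

lemma preimage_identity:
  fixes k q t u c W P \<tau> \<nu> \<nu>t N G :: real
  assumes u: "q * u = q * t - k" and c: "c = k^2 + q^2" and W: "W = q^2 - 3 * k^2" and P: "P = 1 + t^2"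
    and \<tau>: "\<tau> = 2 * k * q - (q^2 + 3 * k^2) * t"
    and \<nu>t: "\<nu>t = 2 * q ^ 4 + 13 * k^2 * q^2 + 3 * k ^ 4" and \<nu>: "\<nu> = \<nu>t * t - 2 * k * q * c"
    and N: "N = q * u * (5 * k * q^2 * t^2 - (2 * q ^ 3 + k^2 * q) * t + k * q^2 - k ^ 3)"
    and G: "G = q^2 * u * (3 * k * q * t - q^2)" and q: "q \<noteq> 0"
  shows "- 2 * (P * G * \<nu> - P * (q^2 * (q^2 - k^2 - 2 * k * q * t)) * u^2 * \<nu>t
        + N * (P * (k^2 * (5 * q^2 - 3 * k^2)) - 2 * c * t * \<tau>) + 2 * t * (q^2 * (q^2 - k^2 - 2 * k * q * t)) * u^2 * \<nu>)
     + (8 * q^2 * (q^2 + 3 * k^2) - 30 * (k * q ^ 3) * t) * (P * (t * c * \<tau>) - P^2 * (k^2 * W))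
     - 6 * (k * q ^ 3) * (P * c * \<tau> - P^2 * (q^2 * W * t)) = P^2 * (12 * c * q * u * (k * q^2 * W))"
   (is "?L = ?R")
proof -
  have "q^2 * ?L = q^2 * ?R"
    unfolding \<tau> \<nu> \<nu>t N G c W P using u by algebra
  then show ?thesis using q by simp
qed

text \<open>The part free of \<open>\<Xi>\<close> of the statement that the variation of
  \<open>\<phi>\<close> is the Helmholtz inverse of the variation of the momentum.\<close>

lemma helmholtz_identity:
  fixes k q t u c W P \<tau> G :: real
  assumes u: "q * u = q * t - k" and c: "c = k^2 + q^2" and W: "W = q^2 - 3 * k^2" and P: "P = 1 + t^2"
    and \<tau>: "\<tau> = 2 * k * q - (q^2 + 3 * k^2) * t"
    and G: "G = q^2 * u * (3 * k * q * t - q^2)" and q: "q \<noteq> 0"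
  shows "(q^2 * (q^2 + 3 * k^2) - 3 * k * q ^ 3 * t) * (P * c * \<tau> - P^2 * (q^2 * W * t))
     - (P * G * (q^2 * (q^2 + 9 * k^2)) + G * (P * (k^2 * (5 * q^2 - 3 * k^2)) - 2 * c * t * \<tau>)
        + q^2 * W * (P^2 * G - 2 * t * P * (q^2 * (q^2 - k^2 - 2 * k * q * t)) * u^2))
     - 2 * t * (q^2 * (q^2 - k^2 - 2 * k * q * t)) * u^2 * (q^2 * (q^2 + 9 * k^2) + q^2 * W * P)
     = 3 * (k * q ^ 3) * (P * (t * c * \<tau>) - P^2 * (k^2 * W))"
   (is "?L = ?R")
proof -
  have "q^2 * ?L = q^2 * ?R"
    unfolding \<tau> G c W P using u by algebra
  then show ?thesis using q by simp
qed

text \<open>The part free of \<open>\<Xi>\<close> of the comparison between the pairing and the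
  parametric derivative of the functional; \<open>e\<close> stands for \<open>1 / P\<close>.\<close>

lemma potential_identity:
  fixes k q t u c W P e \<theta> y y' G D :: real
  assumes u: "q * u = q * t - k" and c: "c = k^2 + q^2" and W: "W = q^2 - 3 * k^2" and P: "P = 1 + t^2"
    and e: "P * e = 1"
    and \<theta>: "\<theta> = 2 * k * q - (q^2 + 3 * k^2) * t"
    and y': "y' = k^2 * (5 * q^2 - 3 * k^2)" and y: "y = y' * t + 2 * k * q * c"
    and G: "G = q^2 * u * (3 * k * q * t - q^2)" and q: "q \<noteq> 0"
    and D: "D = q * u * (- (k * q^2 * (2 * q^2 - 3 * k^2) * P) + 2 * k^2 * q^2 * (q * t + k) - 2 * k^2 * q * \<theta>
      - 2 * k ^ 3 * W + 4 * k^2 * (q * t + k) * t * \<theta> * e)"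
  shows "6 * (k * q ^ 3) * P * u * (t * c * \<theta> * e - k^2 * W) - c * D =
    - (k * q ^ 3) * u^2 * (3 * t - u) * (y' - 2 * c * t * \<theta> * e) - G * y
    - 2 * t * (q^2 * (q^2 - k^2 - 2 * k * q * t)) * u^2 * e * y + q^2 * (q^2 - k^2 - 2 * k * q * t) * u^2 * y'"
   (is "?L = ?R")
proof -
  have "q ^ 3 * ?L = q ^ 3 * ?R"
    unfolding D y y' \<theta> G W c using u e P by algebra
  then show ?thesis using q by simp
qed


context novikov_wave
begin

subsection \<open>The operator on waves\<close>

definition c :: real where "c = k^2 + q^2"
abbreviation a :: real where "a \<equiv> k * q ^ 3"
text \<open>Equal to \<open>c - 4 * k^2\<close>, whose positivity is the condition
  \<open>k < sqrt c / 2\<close>; the crest lies at height \<open>W / (2 * k * q)\<close> above the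
  asymptotic value of \<open>t\<close>.\<close>

abbreviation W :: real where "W \<equiv> q^2 - 3 * k^2"

definition u :: "real \<Rightarrow> real" where "u x = t x - k / q"
definition P :: "real \<Rightarrow> real" where "P x = 1 + (t x)^2"
text \<open>The logarithmic derivative of \<open>s\<close>; the momentum \<open>a / s^3\<close>
  therefore has logarithmic derivative \<open>- 3 * T\<close>.\<close>

definition T :: "real \<Rightarrow> real" where "T x = t x * (\<rho> x * u x)"
text \<open>\<open>P * G / c^2\<close> and, with the next definition, \<open>P * N / c^2\<close> are
  the derivatives of \<open>\<rho> * u\<close> and \<open>T\<close>. Once the square of
  \<open>\<rho>\<close> is eliminated they are polynomials in \<open>t\<close> divisible by
  \<open>u\<close>, hence decay.\<close>

definition G :: "real \<Rightarrow> real" where "G x = q^2 * u x * (3 * k * q * t x - q^2)"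
definition N :: "real \<Rightarrow> real" where
  "N x = q * u x * (5 * k * q^2 * (t x)^2 - (2 * q ^ 3 + k^2 * q) * t x + k * q^2 - k ^ 3)"

text \<open>The derivatives of \<open>G\<close> and \<open>N\<close> with respect to \<open>t\<close>.\<close>

definition G' :: "real \<Rightarrow> real" where "G' x = 6 * k * q ^ 3 * t x - q ^ 4 - 3 * k^2 * q^2"
definition N' :: "real \<Rightarrow> real" where
  "N' x = 15 * k * q ^ 3 * (t x)^2 - (4 * q ^ 4 + 12 * k^2 * q^2) * t x + 3 * k * q ^ 3"

lemma c_pos: "0 < c"
  using q by (simp add: c_def add_nonneg_pos)

lemma \<rho>_square: "c^2 * (\<rho> x)^2 = q^2 * (q^2 - k^2 - 2 * k * q * t x)"
  using \<rho>_sq by (simp add: c_def)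

lemma qu: "q * u x = q * t x - k"
  using q by (simp add: u_def field_simps)

lemma u_pos: "0 < u x"
  using t_gt[of x] by (simp add: u_def)

lemma P_pos: "0 < P x"
  by (simp add: P_def add_pos_nonneg)

lemma sP: "(s x)^2 * P x = c"
  using s_sq by (simp add: P_def c_def)

lemma s4P: "s x ^ 4 * (P x)^2 = c^2"
  unfolding sP[of x, symmetric] by (simp add: power_mult_distrib flip: power_mult)

lemma t_deriv: "(t has_real_derivative - (\<rho> x * u x) * P x) (at x)"
  using t'[of x] by (simp add: u_def P_def)

lemma u_deriv: "(u has_real_derivative - (\<rho> x * u x) * P x) (at x)"
  unfolding u_def[abs_def] by (auto intro!: derivative_eq_intros t_deriv simp: u_def)

lemma P_deriv: "(P has_real_derivative 2 * t x * (- (\<rho> x * u x) * P x)) (at x)"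
  unfolding P_def[abs_def] by (auto intro!: derivative_eq_intros t_deriv simp: P_def)

lemma s_deriv: "(s has_real_derivative s x * T x) (at x)"
  using s'[of x] by (simp add: T_def u_def mult.assoc)

lemma \<rho>u_deriv: "((\<lambda>x. \<rho> x * u x) has_real_derivative P x * G x / c^2) (at x)"
proof -
  have "((\<lambda>x. \<rho> x * u x) has_real_derivative
      (a / c^2 * u x * P x) * u x + (- (\<rho> x * u x) * P x) * \<rho> x) (at x)"
    using DERIV_mult[OF \<rho>'[of x] u_deriv[of x]] by (simp add: u_def P_def c_def)
  moreover have "(a / c^2 * u x * P x) * u x + (- (\<rho> x * u x) * P x) * \<rho> x = P x * G x / c^2"
  proof -
    have "c^2 * ((a / c^2 * u x * P x) * u x + (- (\<rho> x * u x) * P x) * \<rho> x) =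
        P x * (a * (u x)^2 - c^2 * (\<rho> x)^2 * u x)"
      using c_pos by (simp add: algebra_simps power2_eq_square)
    also have "\<dots> = P x * G x"
      using \<rho>u_deriv_identity[OF qu _ \<rho>_square, of x] q by (simp add: G_def)
    finally show ?thesis using c_pos by (simp add: eq_divide_eq mult.commute)
  qed
  ultimately show ?thesis by simp
qed

lemma \<rho>u_sq: "c^2 * (\<rho> x * u x)^2 = q^2 * (q^2 - k^2 - 2 * k * q * t x) * (u x)^2"
  using \<rho>_square[of x] by (simp add: power_mult_distrib mult.assoc[symmetric])

lemma T_deriv: "(T has_real_derivative P x * N x / c^2) (at x)"
proof -
  have "(T has_real_derivative (- (\<rho> x * u x) * P x) * (\<rho> x * u x) + P x * G x / c^2 * t x) (at x)"
    unfolding T_def[abs_def] by (rule DERIV_mult[OF t_deriv \<rho>u_deriv])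
  moreover have "(- (\<rho> x * u x) * P x) * (\<rho> x * u x) + P x * G x / c^2 * t x = P x * N x / c^2"
  proof -
    have "c^2 * ((- (\<rho> x * u x) * P x) * (\<rho> x * u x) + P x * G x / c^2 * t x) =
        P x * (t x * G x - c^2 * (\<rho> x)^2 * (u x)^2)"
      using c_pos by (simp add: algebra_simps power2_eq_square)
    also have "\<dots> = P x * N x"
      using T_deriv_identity[OF qu _ \<rho>_square, of x] q by (simp add: G_def N_def)
    finally show ?thesis using c_pos by (simp add: eq_divide_eq mult.commute)
  qed
  ultimately show ?thesis by simp
qed

lemma G_deriv: "(G has_real_derivative G' x * (- (\<rho> x * u x) * P x)) (at x)"
proof -
  have "G = (\<lambda>x. (q * t x - k) * (q * (3 * k * q * t x - q^2)))"
    by (rule ext) (simp add: G_def qu[symmetric] power2_eq_square)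
  then show ?thesis
    by (auto intro!: derivative_eq_intros t_deriv simp: G'_def) (simp add: algebra_simps eval_nat_numeral)
qed

lemma N_deriv: "(N has_real_derivative N' x * (- (\<rho> x * u x) * P x)) (at x)"
proof -
  have "N = (\<lambda>x. (q * t x - k) * (5 * k * q^2 * (t x)^2 - (2 * q ^ 3 + k^2 * q) * t x + k * q^2 - k ^ 3))"
    by (rule ext) (simp add: N_def qu[symmetric])
  then show ?thesis
    by (auto intro!: derivative_eq_intros t_deriv simp: N'_def) (simp add: algebra_simps eval_nat_numeral)
qed

text \<open>The left side is \<open>(s - s'') / s\<close>, and \<open>s\<close> is proportional to
  the power -1/3 of the momentum. With \<open>s^4 * P^2 = c^2\<close> this is the Euler-Lagrange
  equation after application of the Helmholtz operator; \<open>q^2 * (q^2 + 3 * k^2)\<close> is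
  \<open>c * (2 * E + c)\<close>.\<close>

lemma euler_lagrange: "1 - (T x)^2 - P x * N x / c^2 = (P x)^2 / c^2 * (q^2 * (q^2 + 3 * k^2) - 3 * a * t x)"
proof -
  have "c^2 * (1 - (T x)^2 - P x * N x / c^2) = c^2 - c^2 * (\<rho> x)^2 * (t x)^2 * (u x)^2 - P x * N x"
    using c_pos by (simp add: T_def algebra_simps power2_eq_square)
  also have "\<dots> = (P x)^2 * (q^2 * (q^2 + 3 * k^2) - 3 * a * t x)"
    using euler_lagrange_identity[OF qu _ c_def \<rho>_square, of x] q by (simp add: N_def P_def mult.assoc)
  finally show ?thesis using c_pos by (simp add: eq_divide_eq mult.commute)
qed

lemma isCont_t: "isCont t x" and isCont_s: "isCont s x" and isCont_\<rho>: "isCont \<rho> x"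
  and isCont_u: "isCont u x" and isCont_P: "isCont P x" and isCont_T: "isCont T x"
  and isCont_G: "isCont G x" and isCont_N: "isCont N x"
  using t_deriv s_deriv \<rho>' u_deriv P_deriv T_deriv G_deriv N_deriv DERIV_isCont by blast+

lemma isCont_G': "isCont G' x" and isCont_N': "isCont N' x"
  unfolding G'_def[abs_def] N'_def[abs_def] by (intro continuous_intros isCont_t)+

lemma bdd_t: "bdd_fun t"
proof -
  have "\<bar>t x\<bar> \<le> (q^2 - k^2) / (2 * k * q)" for x
  proof -
    have "0 \<le> q^2 * (q^2 - k^2 - 2 * k * q * t x)" unfolding \<rho>_square[symmetric] by simp
    then have "2 * k * q * t x \<le> q^2 - k^2" using q by (simp add: zero_le_mult_iff)
    then have "t x \<le> (q^2 - k^2) / (2 * k * q)" using k q by (simp add: field_simps)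
    moreover have "0 < k / q" using k q by simp
    then have "0 < t x" using t_gt[of x] by linarith
    ultimately show ?thesis by simp
  qed
  then show ?thesis by (auto simp: bdd_fun_def)
qed

lemma bdd_P: "bdd_fun P"
  unfolding P_def[abs_def] by (intro bdd_fun_intros bdd_t)

lemma bdd_u: "bdd_fun u"
  unfolding u_def[abs_def] by (intro bdd_fun_intros bdd_t)

lemma bdd_\<rho>: "bdd_fun \<rho>"
proof (rule bdd_fun_of_square)
  have "(\<rho> x)^2 = 1 / c^2 * (q^2 * (q^2 - k^2 - 2 * k * q * t x))" for x
    unfolding \<rho>_square[of x, symmetric] using c_pos by simp
  then show "bdd_fun (\<lambda>x. (\<rho> x)^2)" by (simp only:) (intro bdd_fun_intros bdd_t)
qed

lemma bdd_inv_s: "bdd_fun (\<lambda>x. 1 / s x)"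
proof (rule bdd_fun_of_square)
  have "(1 / s x)^2 = 1 / c * P x" for x
    unfolding sP[of x, symmetric] using s_pos[of x] P_pos[of x] by (simp add: power_divide)
  then show "bdd_fun (\<lambda>x. (1 / s x)^2)" by (simp only:) (intro bdd_fun_intros bdd_P)
qed

lemma bdd_inv_P: "bdd_fun (\<lambda>x. 1 / P x)"
proof -
  have "\<bar>1 / P x\<bar> \<le> 1" for x using P_pos[of x] by (simp add: P_def divide_le_eq)
  then show ?thesis by (auto simp: bdd_fun_def)
qed

lemma bdd_s: "bdd_fun s"
proof (rule bdd_fun_of_square)
  have "(s x)^2 = c * (1 / P x)" for x
    unfolding sP[of x, symmetric] using P_pos[of x] by simp
  then show "bdd_fun (\<lambda>x. (s x)^2)" by (simp only:) (intro bdd_fun_intros bdd_inv_P)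
qed

lemma bdd_T: "bdd_fun T" and bdd_G: "bdd_fun G" and bdd_N: "bdd_fun N"
  and bdd_G': "bdd_fun G'" and bdd_N': "bdd_fun N'"
  unfolding T_def[abs_def] G_def[abs_def] N_def[abs_def] G'_def[abs_def] N'_def[abs_def]
  by (intro bdd_fun_intros bdd_t bdd_\<rho> bdd_u)+

lemmas bdd_wave = bdd_t bdd_P bdd_u bdd_\<rho> bdd_inv_s bdd_inv_P bdd_s bdd_T bdd_G bdd_N bdd_G' bdd_N'

lemma exp_decay_u: "exp_decay u"
  using decay u_pos unfolding exp_decay_def u_def by (simp add: less_imp_le abs_of_pos)

text \<open>This is why \<open>s\<close> is used as a variable: every fractional power of the
  momentum in \<open>\<L>\<close> becomes an integer power of \<open>s\<close>.\<close>

lemma powr_momentum: "(a / s x ^ 3) powr (- real n / 3) = a powr (- real n / 3) * s x ^ n"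
proof -
  have "(s x ^ 3) powr (- real n / real 3) = s x powr (- real n)"
    by (rule powr_of_root) (use s_pos in auto)
  also have "\<dots> = 1 / s x ^ n"
    using s_pos[of x] by (simp add: powr_minus_divide powr_realpow)
  finally have *: "(s x ^ 3) powr (- real n / 3) = 1 / s x ^ n" by simp
  have "(a / s x ^ 3) powr (- real n / 3) = a powr (- real n / 3) / (s x ^ 3) powr (- real n / 3)"
    by (rule powr_divide)
  then show ?thesis unfolding * by simp
qed

definition K :: real where "K = a powr (-8/3)"

lemma powr_a:
  "a powr (-11/3) = K / a" "a powr (-14/3) = K / a^2" "a powr (-2/3) = K * a^2"
  "a powr (-4/3) * a powr (-4/3) = K"
proof -
  have a: "0 < a" using k q by simp
  have "a powr (-11/3) = a powr (-8/3 - 1)" "a powr (-14/3) = a powr (-8/3 - 2)" by simp_all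
  then show "a powr (-11/3) = K / a" "a powr (-14/3) = K / a^2"
    using a by (simp_all only: powr_diff K_def powr_one powr_numeral)
  have "a powr (-2/3) = a powr (-8/3 + 2)" by simp
  then show "a powr (-2/3) = K * a^2"
    using a by (simp only: powr_add K_def powr_numeral)
  show "a powr (-4/3) * a powr (-4/3) = K"
    by (simp add: K_def powr_add[symmetric])
qed

lemma inverse_s_cube_deriv: "((\<lambda>x. d / s x ^ 3) has_real_derivative - 3 * T x * (d / s x ^ 3)) (at x)"
proof -
  have s0: "s x \<noteq> 0" using s_pos[of x] by simp
  have p: "((\<lambda>x. s x ^ 3) has_real_derivative 3 * T x * s x ^ 3) (at x)"
    by (rule DERIV_cong[OF DERIV_power[OF s_deriv]]) (simp add: power2_eq_square power3_eq_cube)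
  have "((\<lambda>x. d / s x ^ 3) has_real_derivative (0 * s x ^ 3 - d * (3 * T x * s x ^ 3)) / (s x ^ 3 * s x ^ 3)) (at x)"
    by (rule DERIV_divide[OF DERIV_const p]) (use s0 in simp)
  then show ?thesis
    by (rule DERIV_cong) (use s0 in \<open>simp add: divide_simps\<close>)
qed

lemma momentum_deriv2:
  "((\<lambda>x. - 3 * T x * (a / s x ^ 3)) has_real_derivative
    (9 * (T x)^2 - 3 * (P x * N x / c^2)) * (a / s x ^ 3)) (at x)"
proof -
  have "((\<lambda>x. - 3 * T x * (a / s x ^ 3)) has_real_derivative
    (- 3 * (P x * N x / c^2)) * (a / s x ^ 3) + (- 3 * T x * (a / s x ^ 3)) * (- 3 * T x)) (at x)"
    by (intro DERIV_mult inverse_s_cube_deriv DERIV_cmult T_deriv)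
  then show ?thesis by (rule DERIV_cong) algebra
qed

lemma weight_deriv: "deriv (\<lambda>x. (a / s x ^ 3) powr (-8/3)) x = 8 * T x * (K * s x ^ 8)"
proof (rule DERIV_imp_deriv)
  have "((\<lambda>x. K * s x ^ 8) has_real_derivative 8 * T x * (K * s x ^ 8)) (at x)"
    by (rule DERIV_cong[OF DERIV_cmult[OF DERIV_power[OF s_deriv]]]) (simp add: eval_nat_numeral)
  then show "((\<lambda>x. (a / s x ^ 3) powr (-8/3)) has_real_derivative 8 * T x * (K * s x ^ 8)) (at x)"
    using powr_momentum[of _ 8] by (simp add: K_def)
qed

lemma weight_smooth_bounded:
  assumes \<phi>: "smooth \<phi>" "\<And>x. \<phi> x = s x * t x"
  obtains C where "smooth (\<lambda>x. (a / s x ^ 3) powr (-8/3))" "\<And>x. \<bar>(a / s x ^ 3) powr (-8/3)\<bar> \<le> C"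
    "\<And>x. \<bar>deriv (\<lambda>x. (a / s x ^ 3) powr (-8/3)) x\<bar> \<le> C"
proof -
  have p: "(a / s x ^ 3) powr (-8/3) = K * s x ^ 8" for x
    using powr_momentum[of x 8] by (simp add: K_def)
  have "c + (- 1) * (\<phi> x)^2 = (s x)^2" for x
    using sP[of x] by (simp add: P_def \<phi>(2) algebra_simps power_mult_distrib)
  \<comment> \<open>The exponent 8 is even, so the weight is a polynomial in the smooth function
    \<open>\<phi>\<close> and no square root has to be shown smooth.\<close>
  then have "(\<lambda>x. (a / s x ^ 3) powr (-8/3)) = (\<lambda>x. K * (c + (- 1) * (\<phi> x)^2) ^ 4)"
    unfolding p by (simp flip: power_mult)
  then have sm: "smooth (\<lambda>x. (a / s x ^ 3) powr (-8/3))"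
    by (simp only:) (intro smooth_mult smooth_const smooth_power smooth_add \<phi>)
  have "bdd_fun (\<lambda>x. K * s x ^ 8)" "bdd_fun (\<lambda>x. 8 * T x * (K * s x ^ 8))"
    by (intro bdd_fun_intros bdd_wave)+
  then obtain B1 B2 where B: "\<And>x. \<bar>K * s x ^ 8\<bar> \<le> B1" "\<And>x. \<bar>8 * T x * (K * s x ^ 8)\<bar> \<le> B2"
    unfolding bdd_fun_def by blast
  show thesis
  proof (rule that[OF sm, of "max B1 B2"])
    show "\<bar>(a / s x ^ 3) powr (-8/3)\<bar> \<le> max B1 B2" for x
      unfolding p using B(1)[of x] by simp
    show "\<bar>deriv (\<lambda>x. (a / s x ^ 3) powr (-8/3)) x\<bar> \<le> max B1 B2" for x
      unfolding weight_deriv using B(2)[of x] by simp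
  qed
qed

text \<open>Here \<open>3 * a * n / s^3\<close> is a variation of the momentum and
  \<open>s * m\<close> the corresponding variation of \<open>\<phi>\<close>. By
  \<open>euler_lagrange\<close>, \<open>mn\<close> says that the Helmholtz operator maps
  \<open>s * m\<close> to \<open>3 * a * n / s^3\<close>, so the nonlocal term of
  \<open>\<L>\<close> is known without integration and \<open>\<L>\<close> becomes an explicit local
  expression in \<open>n\<close> and \<open>m\<close>.\<close>

lemma \<L>_weighted:
  fixes \<phi> n n1 n2 m m1 m2 :: "real \<Rightarrow> real"
  assumes \<phi>: "smooth \<phi>" "\<And>x. \<phi> x = s x * t x"
    and n: "\<And>x. (n has_real_derivative n1 x) (at x)" "\<And>x. (n1 has_real_derivative n2 x) (at x)"
      "\<And>x. isCont n2 x" "exp_decay n" "exp_decay n1" "exp_decay n2"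
    and m: "\<And>x. (m has_real_derivative m1 x) (at x)" "\<And>x. (m1 has_real_derivative m2 x) (at x)"
      "\<And>x. isCont m2 x" "bdd_fun m" "bdd_fun m1" "bdd_fun m2"
    and mn: "\<And>x. (P x)^2 * (q^2 * (q^2 + 3 * k^2) - 3 * a * t x) * m x - c^2 * m2 x - 2 * T x * c^2 * m1 x
      = 3 * a * (P x)^2 * n x"
  shows "(\<lambda>x. complex_of_real (3 * a * n x / s x ^ 3)) \<in> H2" (is ?g1)
    "AE x in lborel. \<L> c k (\<lambda>x. a / s x ^ 3) (\<lambda>x. complex_of_real (3 * a * n x / s x ^ 3)) x =
      of_real (K * (3 * a * s x ^ 5 * (- 2 * (n2 x + 2 * T x * n1 x)
         + (P x)^2 / c^2 * (8 * (q^2 * (q^2 + 3 * k^2)) - 30 * a * t x) * n x) - 18 * a^2 * s x * m x))"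
    (is "AE x in lborel. _ = of_real (?V x)")
proof -
  let ?T1 = "\<lambda>x. P x * N x / c^2"
  define w where "w x = 3 * a * n x / s x ^ 3" for x
  define w1 where "w1 x = 3 * a / s x ^ 3 * (n1 x - 3 * T x * n x)" for x
  define w2 where "w2 x = 3 * a / s x ^ 3 * (n2 x - 6 * T x * n1 x + (9 * (T x)^2 - 3 * ?T1 x) * n x)" for x
  have s0: "s x \<noteq> 0" for x using s_pos[of x] by simp
  have a0: "a \<noteq> 0" using k q by simp
  have nc: "isCont n x" "isCont n1 x" "isCont m x" "isCont m1 x" for x
    using n m DERIV_isCont by blast+
  have is3: "((\<lambda>x. 3 * a / s x ^ 3) has_real_derivative - 3 * T x * (3 * a / s x ^ 3)) (at x)" for x
    by (rule inverse_s_cube_deriv)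
  have w1: "(w has_real_derivative w1 x) (at x)" for x
  proof -
    have "w = (\<lambda>x. 3 * a / s x ^ 3 * n x)" by (simp add: w_def[abs_def])
    moreover have "((\<lambda>x. 3 * a / s x ^ 3 * n x) has_real_derivative w1 x) (at x)"
      by (rule DERIV_cong[OF DERIV_mult[OF is3 n(1)]]) (simp only: w1_def, algebra)
    ultimately show ?thesis by (simp only:)
  qed
  have w2: "(w1 has_real_derivative w2 x) (at x)" for x
  proof -
    have "((\<lambda>x. n1 x - 3 * T x * n x) has_real_derivative n2 x - (3 * ?T1 x * n x + n1 x * (3 * T x))) (at x)"
      by (intro DERIV_diff DERIV_mult DERIV_cmult T_deriv n)
    from DERIV_mult[OF is3[of x] this] show ?thesis
      unfolding w1_def[abs_def] by (rule DERIV_cong) (simp only: w2_def, algebra)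
  qed
  have is3b: "bdd_fun (\<lambda>x. 3 * a / s x ^ 3)"
  proof -
    have "bdd_fun (\<lambda>x. 3 * a * (1 / s x) ^ 3)" by (intro bdd_fun_intros bdd_wave)
    then show ?thesis by (simp add: power_divide)
  qed
  have T1b: "bdd_fun ?T1"
  proof -
    have "bdd_fun (\<lambda>x. P x * N x * (1 / c^2))" by (intro bdd_fun_intros bdd_wave)
    then show ?thesis by simp
  qed
  have wdec: "exp_decay w" "exp_decay w1" "exp_decay w2"
  proof -
    show "exp_decay w"
      using exp_decay_mult[OF is3b n(4)] by (simp add: w_def[abs_def])
    have "exp_decay (\<lambda>x. 3 * a / s x ^ 3 * (n1 x + (- 3 * T x) * n x))"
      by (intro exp_decay_mult[OF is3b] exp_decay_add exp_decay_mult n bdd_fun_intros bdd_wave)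
    then show "exp_decay w1" by (simp add: w1_def[abs_def])
    have "exp_decay (\<lambda>x. 3 * a / s x ^ 3 * (n2 x + ((- 6 * T x) * n1 x + (9 * (T x)^2 - 3 * ?T1 x) * n x)))"
      by (intro exp_decay_mult[OF is3b] exp_decay_add exp_decay_mult n bdd_fun_intros bdd_wave T1b)
    then show "exp_decay w2" by (simp add: w2_def[abs_def] algebra_simps)
  qed
  have w2c: "isCont w2 x" for x
    unfolding w2_def[abs_def]
    by (intro continuous_intros isCont_s isCont_T isCont_P isCont_N nc n) (use s0 c_pos in auto)
  note H = classical_H2[OF w1 w2 w2c wdec]
  show ?g1
    using H(6) by (simp add: w_def[abs_def])
  have psi: "s x * m x - s x * (m2 x + 2 * T x * m1 x + ((T x)^2 + ?T1 x) * m x) = w x" for x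
  proof -
    have "c^2 * (s x ^ 3 * (s x * m x - s x * (m2 x + 2 * T x * m1 x + ((T x)^2 + ?T1 x) * m x))) =
        s x ^ 4 * (c^2 * (1 - (T x)^2 - ?T1 x) * m x - c^2 * m2 x - 2 * T x * c^2 * m1 x)"
      by algebra
    also have "\<dots> = s x ^ 4 * (3 * a * (P x)^2 * n x)"
      unfolding euler_lagrange mn[of x, symmetric] using c_pos by simp
    also have "\<dots> = c^2 * (3 * a * n x)"
      unfolding s4P[of x, symmetric] by simp
    finally have "s x ^ 3 * (s x * m x - s x * (m2 x + 2 * T x * m1 x + ((T x)^2 + ?T1 x) * m x)) = 3 * a * n x"
      using c_pos by simp
    then show ?thesis using s0[of x] by (simp add: w_def eq_divide_eq mult.commute)
  qed
  have helm: "helmholtz_inv w x = s x * m x" for x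
  proof -
    have d1: "((\<lambda>x. s x * m x) has_real_derivative s x * (m1 x + T x * m x)) (at x)" for x
      by (rule DERIV_cong[OF DERIV_mult[OF s_deriv m(1)]]) algebra
    have d2: "((\<lambda>x. s x * (m1 x + T x * m x)) has_real_derivative
        s x * (m2 x + 2 * T x * m1 x + ((T x)^2 + ?T1 x) * m x)) (at x)" for x
      by (rule DERIV_cong[OF DERIV_mult[OF s_deriv DERIV_add[OF m(2) DERIV_mult[OF T_deriv m(1)]]]]) algebra
    have c2: "isCont (\<lambda>x. s x * (m2 x + 2 * T x * m1 x + ((T x)^2 + ?T1 x) * m x)) x" for x
      by (intro continuous_intros isCont_s isCont_T isCont_P isCont_N nc m) (use c_pos in auto)
    have "bdd_fun (\<lambda>x. s x * m x)" "bdd_fun (\<lambda>x. s x * (m1 x + T x * m x))"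
      "bdd_fun (\<lambda>x. s x * (m2 x + 2 * T x * m1 x + ((T x)^2 + ?T1 x) * m x))"
      by (intro bdd_fun_intros bdd_wave m T1b)+
    then obtain B1 B2 B3 where B: "\<And>x. \<bar>s x * m x\<bar> \<le> B1" "\<And>x. \<bar>s x * (m1 x + T x * m x)\<bar> \<le> B2"
      "\<And>x. \<bar>s x * (m2 x + 2 * T x * m1 x + ((T x)^2 + ?T1 x) * m x)\<bar> \<le> B3"
      unfolding bdd_fun_def by blast
    have "helmholtz_inv (\<lambda>x. s x * m x - s x * (m2 x + 2 * T x * m1 x + ((T x)^2 + ?T1 x) * m x)) x = s x * m x"
      by (rule helmholtz_inv_of_helmholtz[OF d1 d2 c2, where C = "max B1 (max B2 B3)"])
        (use B in \<open>simp_all only: le_max_iff_disj simp_thms\<close>)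
    then show ?thesis by (simp only: psi)
  qed
  define p where "p x = (a / s x ^ 3) powr (-8/3)" for x
  have p: "p x = K * s x ^ 8" for x
    using powr_momentum[of x 8] by (simp add: K_def p_def)
  have pd: "deriv p x = 8 * T x * p x" for x
    using weight_deriv[of x] by (simp only: p p_def[abs_def, symmetric])
  obtain B where B: "smooth p" "\<And>x. \<bar>p x\<bar> \<le> B" "\<And>x. \<bar>deriv p x\<bar> \<le> B"
    using weight_smooth_bounded[OF \<phi>] unfolding p_def by blast
  have \<mu>p: "(a / s x ^ 3) powr (-8/3) = p x" for x by (simp add: p_def)
  have E: "c * (2 * wave_E c k + c) = q^2 * (q^2 + 3 * k^2)"
  proof -
    have "c * (2 * wave_E c k + c) = k^2 * (c - 2 * k^2) + c * c"
      using c_pos by (simp add: wave_E_def field_simps)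
    also have "\<dots> = q^2 * (q^2 + 3 * k^2)" unfolding c_def by algebra
    finally show ?thesis .
  qed
  have wa: "wave_a c k = a" using wave_a_eq[OF q c_def] .
  have om0: "\<omega>0 c k = - 9 * (K * a^2)" by (simp add: \<omega>0_def wa powr_a(3)[simplified])
  have "AE x in lborel. \<L> c k (\<lambda>x. a / s x ^ 3) (\<lambda>x. complex_of_real (w x)) x =
     2/3 * (- 3 * (of_real (deriv p x) * of_real (w1 x) + of_real (p x) * of_real (w2 x))
            + of_real (8 * deriv (deriv (\<lambda>x. a / s x ^ 3)) x * (a / s x ^ 3) powr (-11/3)
                       - 44/3 * (deriv (\<lambda>x. a / s x ^ 3) x)^2 * (a / s x ^ 3) powr (-14/3)
                       + 15 * (a / s x ^ 3) powr (-8/3)) * of_real (w x))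
     - of_real (2 * \<omega>1 c k / 9 * (a / s x ^ 3) powr (-4/3)) * of_real (w x)
     + of_real (2 * \<omega>0 c k) * helmholtz_inv (\<lambda>x. complex_of_real (w x)) x"
    by (rule \<L>_eq[OF H(1-5) B \<mu>p])
  then have "AE x in lborel. \<L> c k (\<lambda>x. a / s x ^ 3) (\<lambda>x. complex_of_real (w x)) x =
      of_real (?V x)"
  proof eventually_elim
    case (elim x)
    have d1: "deriv (\<lambda>x. a / s x ^ 3) = (\<lambda>x. - 3 * T x * (a / s x ^ 3))"
      using inverse_s_cube_deriv by (auto intro: DERIV_imp_deriv)
    have d2: "deriv (deriv (\<lambda>x. a / s x ^ 3)) x = (9 * (T x)^2 - 3 * ?T1 x) * (a / s x ^ 3)"
      unfolding d1 by (rule DERIV_imp_deriv[OF momentum_deriv2])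
    have p11: "(a / s x ^ 3) powr (-11/3) = K / a * s x ^ 11"
      and p14: "(a / s x ^ 3) powr (-14/3) = K / a^2 * s x ^ 14"
      and p4: "(a / s x ^ 3) powr (-4/3) = a powr (-4/3) * s x ^ 4"
      using powr_momentum[of x 11] powr_momentum[of x 14] powr_momentum[of x 4] powr_a by simp_all
    have om1: "2 * \<omega>1 c k / 9 * (a / s x ^ 3) powr (-4/3) = K * (2 * (q^2 * (q^2 + 3 * k^2)) * s x ^ 4)"
    proof -
      have "2 * \<omega>1 c k / 9 * (a powr (-4/3) * s x ^ 4) =
          2 * (a powr (-4/3) * a powr (-4/3)) * (c * (2 * wave_E c k + c)) * s x ^ 4"
        by (simp add: \<omega>1_def wa)
      then show ?thesis unfolding p4 powr_a(4) E by simp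
    qed
    have h: "helmholtz_inv (\<lambda>x. complex_of_real (w x)) x = of_real (s x * m x)"
      by (simp add: helmholtz_inv_of_real helm)
    have s8: "s x ^ 8 = s x ^ 5 * s x ^ 3" by (simp flip: power_add)
    define V where "V = 2/3 * (- 3 * (8 * T x * p x * w1 x + p x * w2 x)
        + (8 * ((9 * (T x)^2 - 3 * ?T1 x) * (a / s x ^ 3)) * (K / a * s x ^ 11)
           - 44/3 * (- 3 * T x * (a / s x ^ 3))^2 * (K / a^2 * s x ^ 14) + 15 * p x) * w x)
        - K * (2 * (q^2 * (q^2 + 3 * k^2)) * s x ^ 4) * w x + 2 * (- 9 * (K * a^2)) * (s x * m x)"
    have "\<L> c k (\<lambda>x. a / s x ^ 3) (\<lambda>x. complex_of_real (w x)) x = of_real V"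
      unfolding elim pd d2 p11 p14 om1 om0 h \<mu>p V_def unfolding d1 by simp
    also have "V = ?V x"
    proof -
      have e1: "8 * ((9 * (T x)^2 - 3 * ?T1 x) * (a / s x ^ 3)) * (K / a * s x ^ 11) = 8 * (9 * (T x)^2 - 3 * ?T1 x) * p x"
        unfolding p using s0[of x] a0 by (simp add: field_simps power_add[symmetric])
      have e2: "44/3 * (- 3 * T x * (a / s x ^ 3))^2 * (K / a^2 * s x ^ 14) = 132 * (T x)^2 * p x"
        unfolding p using s0[of x] a0 by (simp add: field_simps power_add[symmetric] power_mult[symmetric])
      have e3: "p x * w1 x = K * (3 * a * s x ^ 5 * (n1 x - 3 * T x * n x))"
        "p x * w2 x = K * (3 * a * s x ^ 5 * (n2 x - 6 * T x * n1 x + (9 * (T x)^2 - 3 * ?T1 x) * n x))"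
        "p x * w x = K * (3 * a * s x ^ 5 * n x)"
        unfolding p w_def w1_def w2_def s8 using s0[of x] by (simp_all del: power_add_numeral)
      have e4: "s x ^ 4 * w x = 3 * a * s x ^ 5 * ((P x)^2 / c^2) * n x"
      proof -
        have "s x ^ 4 * w x = 3 * a * s x * n x"
          unfolding w_def using s0[of x] by (simp add: eval_nat_numeral)
        also have "\<dots> = 3 * a * s x * ((s x ^ 4 * (P x)^2) / c^2) * n x" unfolding s4P using c_pos by simp
        finally show ?thesis by (simp add: eval_nat_numeral)
      qed
      have "V = - 16 * T x * (p x * w1 x) - 2 * (p x * w2 x)
          + (16/3 * (9 * (T x)^2 - 3 * ?T1 x) - 88 * (T x)^2 + 10) * (p x * w x)
          - 2 * K * (q^2 * (q^2 + 3 * k^2)) * (s x ^ 4 * w x) - 18 * a^2 * K * s x * m x"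
        unfolding V_def e1 e2 by (simp add: algebra_simps)
      also have "\<dots> = K * (3 * a * s x ^ 5 * (- 2 * (n2 x + 2 * T x * n1 x)
          + (10 * (1 - (T x)^2 - ?T1 x) - 2 * (q^2 * (q^2 + 3 * k^2)) * ((P x)^2 / c^2)) * n x) - 18 * a^2 * s x * m x)"
        unfolding e3 e4 by algebra
      \<comment> \<open>After conjugation with the power of \<open>s\<close>, the coefficients with
        derivatives of the momentum combine to \<open>10 * (1 - T^2 - T')\<close>, which the
        Euler-Lagrange equation turns into a function of \<open>t\<close>.\<close>
      also have "10 * (1 - (T x)^2 - ?T1 x) - 2 * (q^2 * (q^2 + 3 * k^2)) * ((P x)^2 / c^2) =
          (P x)^2 / c^2 * (8 * (q^2 * (q^2 + 3 * k^2)) - 30 * a * t x)"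
        unfolding euler_lagrange by algebra
      finally show ?thesis .
    qed
    finally show ?case .
  qed
  then show "AE x in lborel. \<L> c k (\<lambda>x. a / s x ^ 3) (\<lambda>x. complex_of_real (3 * a * n x / s x ^ 3)) x =
      of_real (?V x)"
    by (simp only: w_def)
qed

text \<open>Up to the factor \<open>c / (k * q^2 * W)\<close>, the derivative of \<open>t\<close>
  with respect to \<open>k\<close> at fixed \<open>\<tau>\<close>.\<close>

definition \<theta> :: "real \<Rightarrow> real" where "\<theta> x = 2 * k * q - (q^2 + 3 * k^2) * t x"

lemma bdd_\<theta>: "bdd_fun \<theta>"
  unfolding \<theta>_def[abs_def] by (intro bdd_fun_intros bdd_t)

lemma isCont_\<theta>: "isCont \<theta> x"
  unfolding \<theta>_def[abs_def] by (intro continuous_intros isCont_t)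

lemma \<theta>_deriv: "(\<theta> has_real_derivative (q^2 + 3 * k^2) * (\<rho> x * u x * P x)) (at x)"
  unfolding \<theta>_def[abs_def]
  by (rule DERIV_cong[OF DERIV_diff[OF DERIV_const DERIV_cmult[OF t_deriv]]]) algebra

section \<open>The kernel element generated by translations\<close>

lemma PN_deriv:
  "((\<lambda>x. P x * N x / c^2) has_real_derivative - (\<rho> x * u x) * P x * (2 * t x * N x + P x * N' x) / c^2) (at x)"
  by (rule DERIV_cong[OF DERIV_cdivide[OF DERIV_mult[OF P_deriv N_deriv]]]) (simp only: mult_minus_left, algebra)

lemma PG_deriv:
  "((\<lambda>x. P x * G x / c^2) has_real_derivative - (\<rho> x * u x) * P x * (2 * t x * G x + P x * G' x) / c^2) (at x)"
  by (rule DERIV_cong[OF DERIV_cdivide[OF DERIV_mult[OF P_deriv G_deriv]]]) (simp only: mult_minus_left, algebra)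

lemma exp_decay_\<rho>u: "exp_decay (\<lambda>x. \<rho> x * u x)"
  by (intro exp_decay_mult bdd_wave exp_decay_u)

lemma exp_decay_G: "exp_decay G"
proof -
  have "G = (\<lambda>x. (q^2 * (3 * k * q * t x - q^2)) * u x)" by (auto simp: G_def)
  moreover have "exp_decay (\<lambda>x. (q^2 * (3 * k * q * t x - q^2)) * u x)"
    by (intro exp_decay_mult bdd_fun_intros bdd_wave exp_decay_u)
  ultimately show ?thesis by simp
qed

lemma exp_decay_N: "exp_decay N"
proof -
  have "N = (\<lambda>x. (q * (5 * k * q^2 * (t x)^2 - (2 * q ^ 3 + k^2 * q) * t x + k * q^2 - k ^ 3)) * u x)"
    by (auto simp: N_def)
  moreover have "exp_decay (\<lambda>x. (q * (5 * k * q^2 * (t x)^2 - (2 * q ^ 3 + k^2 * q) * t x + k * q^2 - k ^ 3)) * u x)"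
    by (intro exp_decay_mult bdd_fun_intros bdd_wave exp_decay_u)
  ultimately show ?thesis by simp
qed

lemma exp_decay_PN: "exp_decay (\<lambda>x. P x * N x / c^2)"
  and exp_decay_PG: "exp_decay (\<lambda>x. P x * G x / c^2)"
proof -
  have "exp_decay (\<lambda>x. (1 / c^2 * P x) * N x)" "exp_decay (\<lambda>x. (1 / c^2 * P x) * G x)"
    by (intro exp_decay_mult bdd_fun_intros bdd_wave exp_decay_N exp_decay_G)+
  then show "exp_decay (\<lambda>x. P x * N x / c^2)" "exp_decay (\<lambda>x. P x * G x / c^2)" by simp_all
qed

lemma exp_decay_PN': "exp_decay (\<lambda>x. - (\<rho> x * u x) * P x * (2 * t x * N x + P x * N' x) / c^2)" (is ?g1)
  and exp_decay_PG': "exp_decay (\<lambda>x. - (\<rho> x * u x) * P x * (2 * t x * G x + P x * G' x) / c^2)" (is ?g2)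
proof -
  have "exp_decay (\<lambda>x. (- (1 / c^2) * P x * (2 * t x * N x + P x * N' x)) * (\<rho> x * u x))"
    "exp_decay (\<lambda>x. (- (1 / c^2) * P x * (2 * t x * G x + P x * G' x)) * (\<rho> x * u x))"
    by (intro exp_decay_mult[OF _ exp_decay_\<rho>u] bdd_fun_intros bdd_wave)+
  then show ?g1
    ?g2
    by (simp_all add: mult_ac)
qed

text \<open>\<open>3 * a * T / s^3\<close> is minus the derivative of the momentum and
  \<open>s * \<rho> * u\<close> minus that of \<open>\<phi>\<close>, so \<open>\<L>_weighted\<close>
  applies with \<open>n = T\<close> and \<open>m = \<rho> * u\<close>.\<close>

lemma translation_mode:
  assumes \<phi>: "smooth \<phi>" "\<And>x. \<phi> x = s x * t x"
  shows "(\<lambda>x. complex_of_real (3 * a * T x / s x ^ 3)) \<in> H2" (is ?g1)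
    "AE x in lborel. \<L> c k (\<lambda>x. a / s x ^ 3) (\<lambda>x. complex_of_real (3 * a * T x / s x ^ 3)) x = 0" (is ?g2)
proof -
  let ?n1 = "\<lambda>x. P x * N x / c^2" and ?n2 = "\<lambda>x. - (\<rho> x * u x) * P x * (2 * t x * N x + P x * N' x) / c^2"
  let ?m = "\<lambda>x. \<rho> x * u x" and ?m1 = "\<lambda>x. P x * G x / c^2"
  let ?m2 = "\<lambda>x. - (\<rho> x * u x) * P x * (2 * t x * G x + P x * G' x) / c^2"
  have dec: "exp_decay T" "exp_decay ?n1" "exp_decay ?n2"
    using exp_decay_mult[OF bdd_t exp_decay_\<rho>u] exp_decay_PN exp_decay_PN' by (simp_all add: T_def[abs_def])
  have bdd: "bdd_fun ?m" "bdd_fun ?m1" "bdd_fun ?m2"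
    using exp_decay_\<rho>u exp_decay_PG exp_decay_PG' by (simp_all only: exp_decay_imp_bdd)
  have cont: "isCont ?n2 x" "isCont ?m2 x" for x
    by (intro continuous_intros isCont_t isCont_\<rho> isCont_u isCont_P isCont_N isCont_G isCont_N' isCont_G',
        use c_pos in simp)+
  have mn: "(P x)^2 * (q^2 * (q^2 + 3 * k^2) - 3 * a * t x) * ?m x - c^2 * ?m2 x - 2 * T x * c^2 * ?m1 x
      = 3 * a * (P x)^2 * T x" for x
  proof -
    have "c^2 * ?m2 x = - (\<rho> x * u x) * P x * (2 * t x * G x + P x * G' x)" "c^2 * ?m1 x = P x * G x"
      using c_pos by simp_all
    then show ?thesis unfolding G'_def T_def by algebra
  qed
  note L = \<L>_weighted[OF \<phi> T_deriv PN_deriv cont(1) dec \<rho>u_deriv PG_deriv cont(2) bdd mn]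
  show ?g1 by (rule L(1))
  from L(2) show ?g2
  proof eventually_elim
    case (elim x)
    have n2: "c^2 * ?n2 x = - (\<rho> x * u x) * P x * (2 * t x * N x + P x * N' x)" and n1: "c^2 * ?n1 x = P x * N x"
      using c_pos by simp_all
    have "c^2 * (- 2 * (?n2 x + 2 * T x * ?n1 x) + (P x)^2 / c^2 * (8 * (q^2 * (q^2 + 3 * k^2)) - 30 * a * t x) * T x) =
       - 2 * (c^2 * ?n2 x + 2 * T x * (c^2 * ?n1 x)) + (P x)^2 * (8 * (q^2 * (q^2 + 3 * k^2)) - 30 * a * t x) * T x"
    proof -
      have "c^2 * ((P x)^2 / c^2 * (8 * (q^2 * (q^2 + 3 * k^2)) - 30 * a * t x) * T x) =
          (P x)^2 * (8 * (q^2 * (q^2 + 3 * k^2)) - 30 * a * t x) * T x"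
        using c_pos by simp
      then show ?thesis by algebra
    qed
    also have "\<dots> = 6 * a * (P x)^2 * (\<rho> x * u x)"
      unfolding n1 n2 unfolding N'_def T_def by algebra
    finally have *: "- 2 * (?n2 x + 2 * T x * ?n1 x) + (P x)^2 / c^2 * (8 * (q^2 * (q^2 + 3 * k^2)) - 30 * a * t x) * T x =
        6 * a * (P x)^2 * (\<rho> x * u x) / c^2"
      using c_pos by (simp add: eq_divide_eq mult.commute)
    have "s x ^ 5 * (P x)^2 = s x * c^2" unfolding s4P[of x, symmetric] by (simp add: eval_nat_numeral)
    then have "3 * a * s x ^ 5 * (6 * a * (P x)^2 * (\<rho> x * u x) / c^2) - 18 * a^2 * s x * (\<rho> x * u x) = 0"
      using c_pos by (simp add: field_simps) (simp add: power2_eq_square)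
    then show ?case using elim unfolding * by simp
  qed
qed

lemma \<rho>_nonzero: "x \<noteq> 0 \<Longrightarrow> \<rho> x \<noteq> 0"
proof -
  assume x: "x \<noteq> 0"
  have "\<exists>d. (\<rho> has_real_derivative d) (at y) \<and> 0 < d" for y
  proof (intro exI conjI)
    show "(\<rho> has_real_derivative a / (k^2 + q^2)^2 * (t y - k / q) * (1 + (t y)^2)) (at y)"
      by (rule \<rho>')
    show "0 < a / (k^2 + q^2)^2 * (t y - k / q) * (1 + (t y)^2)"
      using u_pos[of y] P_pos[of y] c_pos k q unfolding u_def P_def c_def
      by (intro mult_pos_pos divide_pos_pos) auto
  qed
  then have "\<rho> y < \<rho> z" if "y < z" for y z using DERIV_pos_imp_increasing[OF that] by blast
  then show ?thesis using \<rho>_0 x by (metis less_irrefl linorder_neqE_linordered_idom)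
qed

text \<open>\<open>\<rho>\<close> is strictly increasing, so the translation mode vanishes only at
  the crest.\<close>

lemma T_nonzero: "\<not> (AE x in lborel. complex_of_real (3 * a * T x / s x ^ 3) = 0)"
proof
  assume "AE x in lborel. complex_of_real (3 * a * T x / s x ^ 3) = 0"
  then have "AE x in lborel. x = (0::real)"
  proof eventually_elim
    case (elim x)
    have "0 < k / q" using k q by simp
    then have "t x \<noteq> 0" using t_gt[of x] by linarith
    then show ?case
      using elim \<rho>_nonzero[of x] u_pos[of x] s_pos[of x] k q by (auto simp: T_def)
  qed
  from this AE_lborel_singleton[of 0] have "eventually (\<lambda>x::real. False) (ae_filter lborel)"
    by (rule eventually_elim2) simp
  then show False
    by (simp add: ae_filter_eq_bot_iff)
qed

text \<open>Linearity holds only almost everywhere, because \<open>wderiv\<close> selects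
  representatives.\<close>

lemma \<L>_lincomb:
  assumes \<phi>: "smooth \<phi>" "\<And>x. \<phi> x = s x * t x" and v: "v \<in> H2" and w: "w \<in> H2"
  shows "(\<lambda>x. v x + d * w x) \<in> H2"
    "AE x in lborel. \<L> c k (\<lambda>x. a / s x ^ 3) (\<lambda>x. v x + d * w x) x =
      \<L> c k (\<lambda>x. a / s x ^ 3) v x + d * \<L> c k (\<lambda>x. a / s x ^ 3) w x" (is ?g2)
proof -
  obtain v1 v2 where v: "v \<in> L2" "v1 \<in> L2" "v2 \<in> L2" "is_weak_deriv v v1" "is_weak_deriv v1 v2"
    using v by (auto simp: H2_def)
  obtain w1 w2 where w: "w \<in> L2" "w1 \<in> L2" "w2 \<in> L2" "is_weak_deriv w w1" "is_weak_deriv w1 w2"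
    using w by (auto simp: H2_def)
  have L: "(\<lambda>x. v x + d * w x) \<in> L2" "(\<lambda>x. v1 x + d * w1 x) \<in> L2" "(\<lambda>x. v2 x + d * w2 x) \<in> L2"
    using v w by (intro L2_add L2_scale; simp)+
  have D: "is_weak_deriv (\<lambda>x. v x + d * w x) (\<lambda>x. v1 x + d * w1 x)"
    "is_weak_deriv (\<lambda>x. v1 x + d * w1 x) (\<lambda>x. v2 x + d * w2 x)"
    using v w by (intro is_weak_deriv_lincomb; simp)+
  show "(\<lambda>x. v x + d * w x) \<in> H2" using L D by (auto simp: H2_def)
  define p where "p x = (a / s x ^ 3) powr (-8/3)" for x
  obtain C where p: "smooth p" "\<And>x. \<bar>p x\<bar> \<le> C" "\<And>x. \<bar>deriv p x\<bar> \<le> C"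
    using weight_smooth_bounded[OF \<phi>] unfolding p_def by blast
  note eq = \<L>_eq[OF _ _ _ _ _ p p_def[symmetric], of _ _ _ c k]
  from eq[OF v] eq[OF w] eq[OF L D]
  show ?g2
  proof eventually_elim
    case (elim x)
    show ?case
      unfolding elim helmholtz_inv_lincomb[OF v(1) w(1)] by algebra
  qed
qed

text \<open>Up to a constant factor, \<open>\<Xi>\<close> is the derivative with respect to \<open>k\<close>, at a fixed value of the
  reciprocal coordinate, of the physical coordinate \<open>x\<close>; accordingly the next two functions are the
  \<open>k\<close>-derivatives at fixed \<open>x\<close> of \<open>\<mu>/k\<close> and \<open>\<phi>/k\<close>, up to the weights \<open>s\<^sup>-\<^sup>3\<close> and \<open>s\<close>.\<close>

definition shift_deriv :: "(real \<Rightarrow> real) \<Rightarrow> bool" where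
  "shift_deriv \<Xi> \<longleftrightarrow> (\<forall>x. (\<Xi> has_real_derivative k^2 * (5 * q^2 - 3 * k^2) - 2 * c * t x * \<theta> x / P x) (at x))"

definition n :: "(real \<Rightarrow> real) \<Rightarrow> real \<Rightarrow> real" where
  "n \<Xi> x = t x * (c * \<theta> x / P x + \<rho> x * u x * \<Xi> x) - k^2 * W"

definition m :: "(real \<Rightarrow> real) \<Rightarrow> real \<Rightarrow> real" where
  "m \<Xi> x = c * \<theta> x / P x + \<rho> x * u x * \<Xi> x - q^2 * W * t x"

text \<open>Any antiderivative will do: another constant changes \<open>n \<Xi>\<close> by a
  multiple of \<open>T\<close>, which is the translation mode.\<close>

lemma shift_exists: "\<exists>\<Xi>. shift_deriv \<Xi>"
proof -
  have "isCont (\<lambda>x. k^2 * (5 * q^2 - 3 * k^2) - 2 * c * t x * \<theta> x / P x) x" for x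
    by (intro continuous_intros isCont_t isCont_\<theta> isCont_P) (use P_pos[of x] in simp)
  from continuous_antiderivative[of "\<lambda>x. k^2 * (5 * q^2 - 3 * k^2) - 2 * c * t x * \<theta> x / P x", OF this]
  show ?thesis unfolding shift_deriv_def by blast
qed

lemma shift_bound:
  assumes "shift_deriv \<Xi>"
  obtains A B where "\<And>x. \<bar>\<Xi> x\<bar> \<le> A + B * \<bar>x\<bar>" "0 \<le> B"
proof -
  have "bdd_fun (\<lambda>x. k^2 * (5 * q^2 - 3 * k^2) - 2 * c * t x * \<theta> x * (1 / P x))"
    by (intro bdd_fun_intros bdd_wave bdd_\<theta>)
  then obtain B where B: "\<And>x. \<bar>k^2 * (5 * q^2 - 3 * k^2) - 2 * c * t x * \<theta> x / P x\<bar> \<le> B"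
    by (auto simp: bdd_fun_def)
  have "norm (\<Xi> x - \<Xi> 0) \<le> B * norm (x - 0)" for x
    by (rule field_differentiable_bound[where S = UNIV])
      (use assms B in \<open>auto simp: shift_deriv_def\<close>)
  then have "\<bar>\<Xi> x\<bar> \<le> \<bar>\<Xi> 0\<bar> + B * \<bar>x\<bar>" for x
    using abs_triangle_ineq2[of "\<Xi> x" "\<Xi> 0"] by (simp add: order_trans add.commute) (smt (verit))
  moreover have "0 \<le> B" using order_trans[OF abs_ge_zero B[of 0]] .
  ultimately show thesis by (rule that)
qed

lemma exp_decay_mult_shift: "shift_deriv \<Xi> \<Longrightarrow> exp_decay f \<Longrightarrow> exp_decay (\<lambda>x. f x * \<Xi> x)"
  by (metis exp_decay_mult_linear shift_bound)

text \<open>The explicit factor \<open>u\<close> shows the decay gained by subtracting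
  \<open>\<mu> / k\<close>: the part of \<open>n\<close> free of \<open>\<Xi>\<close> vanishes at
  \<open>t = k / q\<close>.\<close>

lemma n_factor: "n \<Xi> x = (q * (k * W - q * (q^2 + 5 * k^2) * t x) * (1 / P x)) * u x + T x * \<Xi> x"
proof -
  have e: "P x * (1 / P x) = 1" using P_pos[of x] by simp
  have "n \<Xi> x = t x * (c * \<theta> x * (1 / P x) + \<rho> x * u x * \<Xi> x) - k^2 * W" by (simp add: n_def)
  then show ?thesis using e qu[of x] c_def \<theta>_def[of x] T_def[of x] P_def[of x] by algebra
qed

lemma
  assumes "shift_deriv \<Xi>"
  shows n_deriv: "(n \<Xi> has_real_derivative
    \<rho> x * u x * ((2 * q ^ 4 + 13 * k^2 * q^2 + 3 * k ^ 4) * t x - 2 * k * q * c) + P x * N x / c^2 * \<Xi> x) (at x)" (is ?g1)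
    and m_deriv: "(m \<Xi> has_real_derivative
    \<rho> x * u x * (q^2 * (q^2 + 9 * k^2)) + P x * G x / c^2 * \<Xi> x + q^2 * W * (\<rho> x * u x * P x)) (at x)" (is ?g2)
proof -
  let ?\<Xi>1 = "\<lambda>x. k^2 * (5 * q^2 - 3 * k^2) - 2 * c * t x * \<theta> x / P x"
  let ?L = "\<lambda>x. c * \<theta> x / P x + \<rho> x * u x * \<Xi> x"
  have \<Xi>: "(\<Xi> has_real_derivative ?\<Xi>1 x) (at x)"
    using assms by (simp add: shift_deriv_def)
  have P0: "P x \<noteq> 0" using P_pos[of x] by simp
  have "((\<lambda>x. c * \<theta> x / P x) has_real_derivative
      (c * ((q^2 + 3 * k^2) * (\<rho> x * u x * P x)) * P x - c * \<theta> x * (2 * t x * (- (\<rho> x * u x) * P x))) / (P x * P x)) (at x)"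
    by (rule DERIV_divide[OF DERIV_cmult[OF \<theta>_deriv] P_deriv P0])
  then have "((\<lambda>x. c * \<theta> x / P x) has_real_derivative
      \<rho> x * u x * (c * (q^2 + 3 * k^2) + 2 * c * t x * \<theta> x / P x)) (at x)"
    by (rule DERIV_cong) (use P0 in \<open>simp add: field_simps\<close>)
  \<comment> \<open>The terms \<open>2 * c * t * \<theta> / P\<close> cancel against the derivative
    of \<open>\<Xi>\<close>, and \<open>c * (q^2 + 3 * k^2) + k^2 * (5 * q^2 - 3 * k^2)\<close>
    equals \<open>q^2 * (q^2 + 9 * k^2)\<close>.\<close>
  from DERIV_add[OF this DERIV_mult[OF \<rho>u_deriv \<Xi>]]
  have L: "(?L has_real_derivative \<rho> x * u x * (q^2 * (q^2 + 9 * k^2)) + P x * G x / c^2 * \<Xi> x) (at x)"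
    by (rule DERIV_cong) (use c_def in algebra)
  show ?g2
    unfolding m_def[abs_def]
    by (rule DERIV_cong[OF DERIV_diff[OF L DERIV_cmult[OF t_deriv]]]) algebra
  have tG: "P x * N x / c^2 = t x * (P x * G x / c^2) - P x * (\<rho> x * u x)^2"
    using DERIV_unique[OF T_deriv[of x] DERIV_mult[OF t_deriv \<rho>u_deriv, folded T_def]]
    by (simp add: algebra_simps power2_eq_square)
  have t\<theta>: "q^2 * (q^2 + 9 * k^2) * t x - c * \<theta> x = (2 * q ^ 4 + 13 * k^2 * q^2 + 3 * k ^ 4) * t x - 2 * k * q * c"
    unfolding \<theta>_def c_def by algebra
  show ?g1
    unfolding n_def[abs_def] t\<theta>[symmetric] tG
  proof (rule DERIV_cong[OF DERIV_diff[OF DERIV_mult[OF t_deriv L] DERIV_const]])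
    have "P x * (c * \<theta> x / P x) = c * \<theta> x" using P0 by simp
    then show "- (\<rho> x * u x) * P x * (c * \<theta> x / P x + \<rho> x * u x * \<Xi> x) +
       (\<rho> x * u x * (q^2 * (q^2 + 9 * k^2)) + P x * G x / c^2 * \<Xi> x) * t x - 0 =
       \<rho> x * u x * (q^2 * (q^2 + 9 * k^2) * t x - c * \<theta> x) +
       (t x * (P x * G x / c^2) - P x * (\<rho> x * u x)^2) * \<Xi> x"
      by algebra
  qed
qed

lemma exp_decay_n: "shift_deriv \<Xi> \<Longrightarrow> exp_decay (n \<Xi>)"
  unfolding n_factor[abs_def]
  by (intro exp_decay_add exp_decay_mult_shift exp_decay_mult exp_decay_u bdd_fun_intros bdd_wave)
    (auto simp: T_def[abs_def] intro!: exp_decay_mult bdd_wave exp_decay_u)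

text \<open>The image is a multiple of \<open>s * u\<close>, which is half of
  \<open>\<delta>\<F>\<close> on the wave. The factor \<open>d\<close> is left free for the
  normalisation.\<close>

lemma preimage:
  assumes \<phi>: "smooth \<phi>" "\<And>x. \<phi> x = s x * t x" and \<Xi>: "shift_deriv \<Xi>"
  shows "(\<lambda>x. complex_of_real (3 * a * (d * n \<Xi> x) / s x ^ 3)) \<in> H2" (is ?g1)
    "AE x in lborel. \<L> c k (\<lambda>x. a / s x ^ 3) (\<lambda>x. complex_of_real (3 * a * (d * n \<Xi> x) / s x ^ 3)) x =
      of_real (d * (36 * K * a * c * q * (k * q^2 * W)) * s x * u x)" (is ?g2)
proof -
  let ?\<nu>' = "2 * q ^ 4 + 13 * k^2 * q^2 + 3 * k ^ 4"
  let ?\<nu> = "\<lambda>x. ?\<nu>' * t x - 2 * k * q * c"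
  let ?\<Xi>1 = "\<lambda>x. k^2 * (5 * q^2 - 3 * k^2) - 2 * c * t x * \<theta> x / P x"
  let ?PN = "\<lambda>x. - (\<rho> x * u x) * P x * (2 * t x * N x + P x * N' x) / c^2"
  let ?PG = "\<lambda>x. - (\<rho> x * u x) * P x * (2 * t x * G x + P x * G' x) / c^2"
  define n1 where "n1 x = \<rho> x * u x * ?\<nu> x + P x * N x / c^2 * \<Xi> x" for x
  define n2 where "n2 x = P x * G x / c^2 * ?\<nu> x + \<rho> x * u x * (?\<nu>' * (- (\<rho> x * u x) * P x))
     + (?PN x * \<Xi> x + P x * N x / c^2 * ?\<Xi>1 x)" for x
  define m1 where "m1 x = \<rho> x * u x * (q^2 * (q^2 + 9 * k^2)) + P x * G x / c^2 * \<Xi> x + q^2 * W * (\<rho> x * u x * P x)" for x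
  define m2 where "m2 x = P x * G x / c^2 * (q^2 * (q^2 + 9 * k^2)) + (?PG x * \<Xi> x + P x * G x / c^2 * ?\<Xi>1 x)
     + q^2 * W * (P x * G x / c^2 * P x + \<rho> x * u x * (2 * t x * (- (\<rho> x * u x) * P x)))" for x
  have \<Xi>1: "(\<Xi> has_real_derivative ?\<Xi>1 x) (at x)" for x
    using \<Xi> by (simp add: shift_deriv_def)
  have P0: "P x \<noteq> 0" for x using P_pos[of x] by simp
  have c0: "c \<noteq> 0" and q0: "q \<noteq> 0" using c_pos q by simp_all
  have dn1: "((\<lambda>x. d * n \<Xi> x) has_real_derivative d * n1 x) (at x)" for x
    unfolding n1_def by (rule DERIV_cmult[OF n_deriv[OF \<Xi>]])
  have dm1: "((\<lambda>x. d * m \<Xi> x) has_real_derivative d * m1 x) (at x)" for x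
    unfolding m1_def by (rule DERIV_cmult[OF m_deriv[OF \<Xi>]])
  have dn2: "((\<lambda>x. d * n1 x) has_real_derivative d * n2 x) (at x)" for x
  proof (rule DERIV_cmult)
    have "(?\<nu> has_real_derivative ?\<nu>' * (- (\<rho> x * u x) * P x)) (at x)"
      by (rule DERIV_cong[OF DERIV_diff[OF DERIV_cmult[OF t_deriv] DERIV_const]]) simp
    from DERIV_add[OF DERIV_mult[OF \<rho>u_deriv this] DERIV_mult[OF PN_deriv \<Xi>1]]
    show "(n1 has_real_derivative n2 x) (at x)"
      unfolding n1_def[abs_def] by (rule DERIV_cong) (simp only: n2_def, algebra)
  qed
  have dm2: "((\<lambda>x. d * m1 x) has_real_derivative d * m2 x) (at x)" for x
  proof (rule DERIV_cmult)
    from DERIV_add[OF DERIV_add[OF DERIV_mult[OF \<rho>u_deriv DERIV_const] DERIV_mult[OF PG_deriv \<Xi>1]]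
        DERIV_cmult[OF DERIV_mult[OF \<rho>u_deriv P_deriv]]]
    show "(m1 has_real_derivative m2 x) (at x)"
      unfolding m1_def[abs_def] by (rule DERIV_cong) (simp only: m2_def, algebra)
  qed
  have cX: "isCont \<Xi> x" for x using \<Xi>1 DERIV_isCont by blast
  have cont: "isCont (\<lambda>x. d * n2 x) x" "isCont (\<lambda>x. d * m2 x) x" for x
  proof -
    have c20: "c^2 \<noteq> 0" using c0 by simp
    show "isCont (\<lambda>x. d * n2 x) x" "isCont (\<lambda>x. d * m2 x) x"
      unfolding n2_def m2_def
      by (intro continuous_intros isCont_t isCont_\<rho> isCont_u isCont_P isCont_N isCont_G isCont_N' isCont_G'
          isCont_\<theta> cX c20 P0)+
  qed
  have b\<Xi>1: "bdd_fun ?\<Xi>1"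
  proof -
    have "bdd_fun (\<lambda>x. k^2 * (5 * q^2 - 3 * k^2) - 2 * c * t x * \<theta> x * (1 / P x))"
      by (intro bdd_fun_intros bdd_wave bdd_\<theta>)
    then show ?thesis by simp
  qed
  have dec: "exp_decay (\<lambda>x. d * n \<Xi> x)" "exp_decay (\<lambda>x. d * n1 x)" "exp_decay (\<lambda>x. d * n2 x)"
    unfolding n1_def n2_def
    by (intro exp_decay_mult[OF bdd_fun_const] exp_decay_n[OF \<Xi>] exp_decay_add exp_decay_mult_shift[OF \<Xi>]
        exp_decay_mult'[OF exp_decay_\<rho>u] exp_decay_mult'[OF exp_decay_PG] exp_decay_mult'[OF exp_decay_PN] exp_decay_PN exp_decay_PN' b\<Xi>1 bdd_fun_intros bdd_wave)+
  have bdd: "bdd_fun (\<lambda>x. d * m \<Xi> x)" "bdd_fun (\<lambda>x. d * m1 x)" "bdd_fun (\<lambda>x. d * m2 x)"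
  proof -
    have "bdd_fun (\<lambda>x. d * (c * \<theta> x * (1 / P x) + \<rho> x * u x * \<Xi> x - q^2 * W * t x))"
      by (rule bdd_fun_mult bdd_fun_diff bdd_fun_add bdd_fun_const bdd_\<theta> bdd_wave
          exp_decay_imp_bdd[OF exp_decay_mult_shift[OF \<Xi> exp_decay_\<rho>u]])+
    then show "bdd_fun (\<lambda>x. d * m \<Xi> x)" by (simp add: m_def)
    show "bdd_fun (\<lambda>x. d * m1 x)" "bdd_fun (\<lambda>x. d * m2 x)"
      unfolding m1_def m2_def
      by (rule exp_decay_imp_bdd[OF exp_decay_mult_shift[OF \<Xi> exp_decay_PG]] exp_decay_imp_bdd[OF exp_decay_mult_shift[OF \<Xi> exp_decay_PG']]
          exp_decay_imp_bdd[OF exp_decay_PG] b\<Xi>1 bdd_fun_mult bdd_fun_diff bdd_fun_add bdd_fun_const bdd_fun_minus bdd_wave)+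
  qed
  have c2: "c^2 * (P x * N x / c^2) = P x * N x" "c^2 * (P x * G x / c^2) = P x * G x"
    "c^2 * ?PN x = - (\<rho> x * u x) * P x * (2 * t x * N x + P x * N' x)"
    "c^2 * ?PG x = - (\<rho> x * u x) * P x * (2 * t x * G x + P x * G' x)"
    "P x * (c * \<theta> x / P x) = c * \<theta> x" "P x * (2 * c * t x * \<theta> x / P x) = 2 * c * t x * \<theta> x" for x
    using c0 P0[of x] by simp_all
  have \<Xi>P: "P x * ?\<Xi>1 x = P x * (k^2 * (5 * q^2 - 3 * k^2)) - 2 * c * t x * \<theta> x" for x
    by (simp only: right_diff_distrib c2)
  have Pm: "(P x)^2 * m \<Xi> x = P x * c * \<theta> x - (P x)^2 * (q^2 * W * t x) + (P x)^2 * (\<rho> x * u x * \<Xi> x)" for x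
    using c2(5)[of x] unfolding m_def by algebra
  have Pn: "(P x)^2 * n \<Xi> x = P x * (t x * c * \<theta> x) - (P x)^2 * (k^2 * W) + (P x)^2 * (t x * (\<rho> x * u x) * \<Xi> x)" for x
    using c2(5)[of x] unfolding n_def by algebra
  let ?R = "\<lambda>x. q^2 * (q^2 - k^2 - 2 * k * q * t x)"
  have mn0: "(P x)^2 * (q^2 * (q^2 + 3 * k^2) - 3 * a * t x) * m \<Xi> x - c^2 * m2 x - 2 * T x * c^2 * m1 x
      = 3 * a * (P x)^2 * n \<Xi> x" for x
  proof -
    have "c^2 * m2 x = (c^2 * (P x * G x / c^2)) * (q^2 * (q^2 + 9 * k^2)) + ((c^2 * ?PG x) * \<Xi> x + (c^2 * (P x * G x / c^2)) * ?\<Xi>1 x)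
       + q^2 * W * ((c^2 * (P x * G x / c^2)) * P x - 2 * t x * P x * (c^2 * (\<rho> x * u x)^2))"
      unfolding m2_def by algebra
    also have "\<dots> = P x * G x * (q^2 * (q^2 + 9 * k^2)) - \<rho> x * u x * P x * (2 * t x * G x + P x * G' x) * \<Xi> x
       + G x * (P x * ?\<Xi>1 x) + q^2 * W * ((P x)^2 * G x - 2 * t x * P x * ?R x * (u x)^2)"
      unfolding c2 \<rho>u_sq by algebra
    finally have m2: "c^2 * m2 x = P x * G x * (q^2 * (q^2 + 9 * k^2)) - \<rho> x * u x * P x * (2 * t x * G x + P x * G' x) * \<Xi> x
       + G x * (P x * (k^2 * (5 * q^2 - 3 * k^2)) - 2 * c * t x * \<theta> x) + q^2 * W * ((P x)^2 * G x - 2 * t x * P x * ?R x * (u x)^2)"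
      unfolding \<Xi>P .
    have "2 * T x * c^2 * m1 x = 2 * t x * (c^2 * (\<rho> x * u x)^2) * (q^2 * (q^2 + 9 * k^2) + q^2 * W * P x)
       + 2 * t x * (\<rho> x * u x) * (c^2 * (P x * G x / c^2)) * \<Xi> x"
      unfolding m1_def T_def by algebra
    then have m1: "2 * T x * c^2 * m1 x = 2 * t x * ?R x * (u x)^2 * (q^2 * (q^2 + 9 * k^2) + q^2 * W * P x)
       + 2 * t x * (\<rho> x * u x) * (P x * G x) * \<Xi> x"
      unfolding c2 \<rho>u_sq by (simp only: mult.assoc)
    note psi = helmholtz_identity[OF qu[of x] c_def refl P_def \<theta>_def G_def q0]
    have "(P x)^2 * (q^2 * (q^2 + 3 * k^2) - 3 * a * t x) * m \<Xi> x - c^2 * m2 x - 2 * T x * c^2 * m1 x =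
       (q^2 * (q^2 + 3 * k^2) - 3 * a * t x) * ((P x)^2 * m \<Xi> x) - c^2 * m2 x - 2 * T x * c^2 * m1 x"
      by algebra
    also have "\<dots> = 3 * a * (P x * (t x * c * \<theta> x) - (P x)^2 * (k^2 * W)) + 3 * a * ((P x)^2 * (t x * (\<rho> x * u x) * \<Xi> x))"
      unfolding m2 m1 Pm psi[symmetric] G'_def by algebra
    also have "\<dots> = 3 * a * ((P x)^2 * n \<Xi> x)" unfolding Pn by algebra
    finally show ?thesis by (simp only: mult.assoc)
  qed
  have mn: "(P x)^2 * (q^2 * (q^2 + 3 * k^2) - 3 * a * t x) * (d * m \<Xi> x) - c^2 * (d * m2 x) - 2 * T x * c^2 * (d * m1 x)
      = 3 * a * (P x)^2 * (d * n \<Xi> x)" for x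
    using mn0[of x] by algebra
  \<comment> \<open>\<open>\<Xi>\<close> multiplies \<open>T\<close> in \<open>n\<close> and
    \<open>\<rho> * u\<close> in \<open>m\<close>, so its total coefficient is the kernel equation
    of the translation mode and vanishes. The rest is \<open>preimage_identity\<close>.\<close>
  have main: "- 2 * (c^2 * (n2 x + 2 * T x * n1 x)) + (P x)^2 * (8 * (q^2 * (q^2 + 3 * k^2)) - 30 * a * t x) * n \<Xi> x
      - 6 * a * (P x)^2 * m \<Xi> x = (P x)^2 * (12 * c * q * u x * (k * q^2 * W))" for x
  proof -
    have "c^2 * (n2 x + 2 * T x * n1 x) = (c^2 * (P x * G x / c^2)) * ?\<nu> x - P x * (c^2 * (\<rho> x * u x)^2) * ?\<nu>'
       + ((c^2 * ?PN x) * \<Xi> x + (c^2 * (P x * N x / c^2)) * ?\<Xi>1 x) + 2 * t x * (c^2 * (\<rho> x * u x)^2) * ?\<nu> x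
       + 2 * t x * (\<rho> x * u x) * (c^2 * (P x * N x / c^2)) * \<Xi> x"
      unfolding n2_def n1_def T_def by algebra
    also have "\<dots> = P x * G x * ?\<nu> x - P x * ?R x * (u x)^2 * ?\<nu>' + N x * (P x * ?\<Xi>1 x)
       + 2 * t x * ?R x * (u x)^2 * ?\<nu> x - \<rho> x * u x * (P x)^2 * N' x * \<Xi> x"
      unfolding c2 \<rho>u_sq by algebra
    finally have n: "c^2 * (n2 x + 2 * T x * n1 x) = P x * G x * ?\<nu> x - P x * ?R x * (u x)^2 * ?\<nu>'
       + N x * (P x * (k^2 * (5 * q^2 - 3 * k^2)) - 2 * c * t x * \<theta> x)
       + 2 * t x * ?R x * (u x)^2 * ?\<nu> x - \<rho> x * u x * (P x)^2 * N' x * \<Xi> x"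
      unfolding \<Xi>P .
    note alg = preimage_identity[OF qu[of x] c_def refl P_def \<theta>_def refl refl N_def G_def q0]
    have "- 2 * (c^2 * (n2 x + 2 * T x * n1 x)) + (P x)^2 * (8 * (q^2 * (q^2 + 3 * k^2)) - 30 * a * t x) * n \<Xi> x
      - 6 * a * (P x)^2 * m \<Xi> x = - 2 * (c^2 * (n2 x + 2 * T x * n1 x))
      + (8 * q^2 * (q^2 + 3 * k^2) - 30 * a * t x) * ((P x)^2 * n \<Xi> x) - 6 * a * ((P x)^2 * m \<Xi> x)"
      by algebra
    also have "\<dots> = (P x)^2 * (12 * c * q * u x * (k * q^2 * W))"
      unfolding n Pm Pn alg[symmetric] N'_def by algebra
    finally show ?thesis .
  qed
  note L = \<L>_weighted[OF \<phi> dn1 dn2 cont(1) dec dm1 dm2 cont(2) bdd mn]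
  show ?g1 by (rule L(1))
  from L(2) show ?g2
  proof eventually_elim
    case (elim x)
    have s5: "s x ^ 5 * (P x)^2 = s x * c^2" unfolding s4P[of x, symmetric] by (simp add: eval_nat_numeral)
    define e where "e = (P x)^2 / c^2"
    have e: "c^2 * e = (P x)^2" using c0 by (simp add: e_def)
    let ?V = "K * (3 * a * s x ^ 5 * (- 2 * (d * n2 x + 2 * T x * (d * n1 x))
         + e * (8 * (q^2 * (q^2 + 3 * k^2)) - 30 * a * t x) * (d * n \<Xi> x)) - 18 * a^2 * s x * (d * m \<Xi> x))"
    have "c^2 * ?V = c^2 * (d * (36 * K * a * c * q * (k * q^2 * W)) * s x * u x)"
      using e main[of x] s5 by algebra
    then have "?V = d * (36 * K * a * c * q * (k * q^2 * W)) * s x * u x"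
      using c0 by simp
    then show ?case using elim unfolding e_def by (simp only:)
  qed
qed

subsection \<open>The functional on waves\<close>

lemma helmholtz_momentum:
  assumes \<phi>: "smooth \<phi>" "\<And>x. \<phi> x = s x * t x" "\<And>x. deriv \<phi> x = - s x * \<rho> x * (t x - k / q)"
    "\<And>x. momentum \<phi> x = a / s x ^ 3"
  shows "helmholtz_inv (momentum \<phi>) x = s x * t x"
proof -
  have d2: "deriv (deriv \<phi>) x = s x * t x - a / s x ^ 3" for x
    using \<phi>(4)[of x] \<phi>(2)[of x] by (simp add: momentum_def)
  have "bdd_fun \<phi>" "bdd_fun (deriv \<phi>)" "bdd_fun (deriv (deriv \<phi>))"
  proof -
    show "bdd_fun \<phi>" unfolding \<phi>(2)[abs_def] by (intro bdd_fun_intros bdd_wave)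
    show "bdd_fun (deriv \<phi>)" unfolding \<phi>(3)[abs_def] u_def[symmetric] by (intro bdd_fun_intros bdd_wave)
    have "bdd_fun (\<lambda>x. s x * t x - a * (1 / s x) ^ 3)" by (intro bdd_fun_intros bdd_wave)
    then show "bdd_fun (deriv (deriv \<phi>))" by (simp add: d2[abs_def] power_divide)
  qed
  then obtain B1 B2 B3 where B: "\<And>x. \<bar>\<phi> x\<bar> \<le> B1" "\<And>x. \<bar>deriv \<phi> x\<bar> \<le> B2" "\<And>x. \<bar>deriv (deriv \<phi>) x\<bar> \<le> B3"
    unfolding bdd_fun_def by blast
  have "helmholtz_inv (\<lambda>y. \<phi> y - deriv (deriv \<phi>) y) x = \<phi> x"
    by (rule helmholtz_inv_of_helmholtz[where C = "max B1 (max B2 B3)" and f' = "deriv \<phi>"])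
      (use B in \<open>auto simp: le_max_iff_disj intro!: smooth_has_deriv smooth_deriv smooth_isCont \<phi>(1)\<close>)
  then show ?thesis by (simp add: momentum_def[abs_def] \<phi>(2))
qed

lemma powr_third_a: "a powr (2/3) = k powr (2/3) * q^2" "k powr (4/3) * a powr (-1/3) = k / q"
proof -
  have q3: "(q ^ 3) powr (x / 3) = q powr x" for x
    using powr_of_root[of q "q ^ 3" 3 x] q by simp
  show "a powr (2/3) = k powr (2/3) * q^2"
    using k q q3[of 2] by (simp add: powr_mult powr_numeral)
  have "k powr (4/3) * a powr (-1/3) = (k powr (4/3) * k powr (-1/3)) * (q ^ 3) powr (-1/3)"
    using k q by (simp add: powr_mult)
  also have "\<dots> = k powr (4/3 + -1/3) * q powr (-1)"
    using q3[of "-1"] by (simp only: powr_add)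
  also have "\<dots> = k / q"
    using k q by (simp add: powr_minus_divide)
  finally show "k powr (4/3) * a powr (-1/3) = k / q" .
qed

text \<open>The local term is \<open>2 * (k / q) * s\<close> and cancels the asymptotic value of
  \<open>2 * s * t\<close>, which is the source of the decay of \<open>\<delta>\<F>\<close>.\<close>

lemma \<delta>\<F>_wave:
  assumes h: "helmholtz_inv \<mu> x = s x * t x" and \<mu>: "\<mu> x = a / s x ^ 3"
  shows "\<delta>\<F> k \<mu> x = 2 * s x * u x"
proof -
  have "\<mu> x powr (-1/3) = a powr (-1/3) * s x"
    using powr_momentum[of x 1] by (simp add: \<mu>)
  then have "\<delta>\<F> k \<mu> x = 2 * (s x * t x) - 2 * (k powr (4/3) * a powr (-1/3)) * s x"
    by (simp add: \<delta>\<F>_def h)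
  also have "\<dots> = 2 * s x * u x"
    unfolding powr_third_a by (simp add: u_def algebra_simps)
  finally show ?thesis .
qed

text \<open>The integrand of \<open>\<F> k \<mu> / k^2\<close>; the fractional powers of
  \<open>k\<close> combine to \<open>k^2\<close>, and the subtracted constants produce the decaying
  factor \<open>u\<close>.\<close>

definition density :: "real \<Rightarrow> real" where
  "density x = (q^2 * u x / c) * (P x * (q / k) - 2 * (t x + k / q))"

lemma \<F>_wave:
  assumes h: "\<And>x. helmholtz_inv \<mu> x = s x * t x" and \<mu>: "\<And>x. \<mu> x = a / s x ^ 3"
  shows "1 / k^2 * \<F> k \<mu> = (\<integral>x. density x \<partial>lborel)"
proof -
  define f1 where "f1 x = (a / c) * (P x + t x * (k / q) + (k / q)^2) * u x" for x
  define f2 where "f2 x = (k powr (2/3) * q^2 / c) * (t x + k / q) * u x" for x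
  have is2: "1 / (s x)^2 = P x / c" for x
    unfolding sP[of x, symmetric] using s_pos[of x] P_pos[of x] by simp
  have q0: "q \<noteq> 0" "k \<noteq> 0" "c \<noteq> 0" using q k c_pos by auto
  have e1: "\<mu> x * helmholtz_inv \<mu> x - k^2 = f1 x" for x
  proof -
    have "\<mu> x * helmholtz_inv \<mu> x = a * t x * (1 / (s x)^2)"
      unfolding h \<mu> using s_pos[of x] by (simp add: eval_nat_numeral)
    also have "\<dots> = a * t x * P x / c" unfolding is2 by simp
    finally have 1: "c * (\<mu> x * helmholtz_inv \<mu> x - k^2) = a * t x * P x - c * k^2" using q0 by (simp add: right_diff_distrib)
    have "q^2 * (q * (a * t x * P x - c * k^2)) = q^2 * (q * (c * f1 x))"
    proof -
      have "q^2 * (q * (c * f1 x)) = a * (q^2 * P x + t x * k * q + k^2) * (q * u x)"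
        using q0 by (simp add: f1_def field_simps power2_eq_square)
      then show ?thesis using qu[of x] P_def[of x] c_def by algebra
    qed
    then have "c * (\<mu> x * helmholtz_inv \<mu> x - k^2) = c * f1 x" using q0 1 by simp
    then show ?thesis using q0 by simp
  qed
  have e2: "\<mu> x powr (2/3) - k powr (2/3) = f2 x" for x
  proof -
    have "(s x ^ 3) powr (2/3) = (s x)^2"
      using powr_of_root[of "s x" "s x ^ 3" 3 2] s_pos[of x] by (simp add: powr_numeral)
    then have "\<mu> x powr (2/3) = k powr (2/3) * q^2 * (1 / (s x)^2)"
      unfolding \<mu> powr_divide powr_third_a by simp
    then have *: "\<mu> x powr (2/3) - k powr (2/3) = k powr (2/3) * (q^2 * P x / c - 1)"
      unfolding is2 by (simp add: algebra_simps)
    have "q^2 * P x - c = (q * t x + k) * (q * u x)" using qu[of x] P_def[of x] c_def by algebra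
    also have "\<dots> = q^2 * (t x + k / q) * u x" using q0 by (simp add: field_simps power2_eq_square)
    finally have "(q^2 * P x - c) / c = q^2 * (t x + k / q) * u x / c" by (simp only:)
    then have "q^2 * P x / c - 1 = q^2 * (t x + k / q) * u x / c" using q0 by (simp add: diff_divide_distrib)
    then show ?thesis unfolding * f2_def by simp
  qed
  have i1: "integrable lborel f1" and i2: "integrable lborel f2"
  proof -
    have "exp_decay f1" "exp_decay f2" unfolding f1_def[abs_def] f2_def[abs_def]
      by (intro exp_decay_mult exp_decay_u bdd_fun_intros bdd_wave)+
    moreover have "isCont f1 x" "isCont f2 x" for x unfolding f1_def[abs_def] f2_def[abs_def]
      by (intro continuous_intros isCont_t isCont_u isCont_P)+
    ultimately show "integrable lborel f1" "integrable lborel f2" by (auto intro: exp_decay_integrable)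
  qed
  have "1 / k^2 * \<F> k \<mu> = 1 / k^2 * ((\<integral>x. f1 x \<partial>lborel) - 3 * k powr (4/3) * (\<integral>x. f2 x \<partial>lborel))"
    by (simp only: \<F>_def e1 e2)
  also have "\<dots> = (\<integral>x. 1 / k^2 * (f1 x - 3 * k powr (4/3) * f2 x) \<partial>lborel)"
    using i1 i2 by simp
  also have "\<dots> = (\<integral>x. density x \<partial>lborel)"
  proof (intro Bochner_Integration.integral_cong refl)
    fix x
    have kk: "k powr (4/3) * k powr (2/3) = k^2"
      using k by (simp add: powr_add[symmetric] powr_numeral)
    have "f1 x - 3 * k powr (4/3) * f2 x =
       (a / c) * (P x + t x * (k / q) + (k / q)^2) * u x - 3 * (k powr (4/3) * k powr (2/3)) * q^2 / c * (t x + k / q) * u x"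
      by (simp add: f1_def f2_def)
    also have "\<dots> = k^2 * density x"
      unfolding kk density_def using q0 by (simp add: field_simps power2_eq_square power3_eq_cube)
    finally show "1 / k^2 * (f1 x - 3 * k powr (4/3) * f2 x) = density x" using q0 by simp
  qed
  finally show ?thesis .
qed

section \<open>Change of variable from the real line to the interval from -1 to 1\<close>

definition \<tau> :: "real \<Rightarrow> real" where "\<tau> x = c * \<rho> x / (q * sqrt W)"

lemma W_pos: "0 < W" using kq by simp

lemma \<tau>_deriv: "(\<tau> has_real_derivative k * q^2 * u x * P x / (c * sqrt W)) (at x)"
proof -
  have "(\<rho> has_real_derivative a / c^2 * u x * P x) (at x)"
    using \<rho>'[of x] by (simp add: u_def P_def c_def)
  from DERIV_cdivide[OF DERIV_cmult[OF this, of c], of "q * sqrt W"]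
  show ?thesis unfolding \<tau>_def[abs_def]
    by (rule DERIV_cong) (use q c_pos in \<open>simp add: power2_eq_square power3_eq_cube\<close>)
qed

lemma \<tau>_sq: "1 - (\<tau> x)^2 = 2 * k * (q * u x) / W"
proof -
  have "(\<tau> x)^2 = (c^2 * (\<rho> x)^2) / (q^2 * W)"
    using W_pos by (simp add: \<tau>_def power_divide power_mult_distrib)
  also have "\<dots> = (q^2 - k^2 - 2 * k * q * t x) / W"
    unfolding \<rho>_square using q by simp
  finally have *: "(\<tau> x)^2 = (q^2 - k^2 - 2 * k * q * t x) / W" .
  have W0: "W \<noteq> 0" using W_pos by linarith
  have "1 - (\<tau> x)^2 = (W - (q^2 - k^2 - 2 * k * q * t x)) / W"
    unfolding * diff_divide_distrib[of W] divide_self[OF W0] ..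
  also have "W - (q^2 - k^2 - 2 * k * q * t x) = 2 * k * (q * u x)"
    unfolding qu by algebra
  finally show ?thesis .
qed

lemma \<tau>_bound: "\<bar>\<tau> x\<bar> < 1"
proof -
  have "0 < 1 - (\<tau> x)^2" unfolding \<tau>_sq using k q u_pos[of x] W_pos by simp
  then show ?thesis by (simp add: abs_square_less_1)
qed

text \<open>The square tends to 1 by \<open>\<tau>_sq\<close> and the decay of \<open>u\<close>;
  monotonicity and the zero at the origin decide the sign.\<close>

lemma \<tau>_lim: "(\<tau> \<longlongrightarrow> 1) at_top" "(\<tau> \<longlongrightarrow> -1) at_bot"
proof -
  have "\<exists>d. (\<tau> has_real_derivative d) (at y) \<and> 0 \<le> d" for y
  proof (intro exI conjI)
    show "(\<tau> has_real_derivative k * q^2 * u y * P y / (c * sqrt W)) (at y)" by (rule \<tau>_deriv)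
    show "0 \<le> k * q^2 * u y * P y / (c * sqrt W)"
      using k q u_pos[of y] P_pos[of y] c_pos W_pos by simp
  qed
  then have mono: "\<tau> y \<le> \<tau> z" if "y \<le> z" for y z
    using DERIV_nonneg_imp_nondecreasing[OF that] by blast
  have \<tau>0: "\<tau> 0 = 0" by (simp add: \<tau>_def \<rho>_0)
  have sq: "((\<lambda>x. sqrt ((\<tau> x)^2)) \<longlongrightarrow> 1) F" if "(u \<longlongrightarrow> 0) F" for F
  proof -
    have "((\<lambda>x. sqrt (1 - 2 * k * (q * u x) / W)) \<longlongrightarrow> sqrt (1 - 2 * k * (q * 0) / W)) F"
      by (intro tendsto_intros that) (use W_pos in simp)
    moreover have "1 - 2 * k * (q * u x) / W = (\<tau> x)^2" for x using \<tau>_sq[of x] by simp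
    ultimately show ?thesis by simp
  qed
  have pos: "sqrt ((\<tau> x)^2) = \<tau> x" if "0 \<le> x" for x
    using mono[OF that] \<tau>0 by simp
  have neg: "- sqrt ((\<tau> x)^2) = \<tau> x" if "x \<le> 0" for x
    using mono[OF that] \<tau>0 by simp
  show "(\<tau> \<longlongrightarrow> 1) at_top"
    by (rule Lim_transform_eventually[OF sq[OF exp_decay_tendsto_0(1)[OF exp_decay_u]]])
      (rule eventually_mono[OF eventually_ge_at_top[of 0] pos])
  have "((\<lambda>x. - sqrt ((\<tau> x)^2)) \<longlongrightarrow> - 1) at_bot"
    by (intro tendsto_minus sq exp_decay_tendsto_0(2)[OF exp_decay_u])
  then show "(\<tau> \<longlongrightarrow> -1) at_bot"
    by (rule Lim_transform_eventually)
      (rule eventually_mono[OF eventually_le_at_bot[of 0] neg])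
qed

text \<open>The indefinite integral of \<open>g\<close>, composed with \<open>\<tau>\<close>, is an
  antiderivative on the line. Integrability comes from the factor \<open>u\<close> in the derivative
  of \<open>\<tau>\<close>.\<close>

lemma integral_reciprocal:
  assumes g: "continuous_on {-1..1} g"
  shows "(\<integral>x. g (\<tau> x) * (k * q^2 * u x * P x / (c * sqrt W)) \<partial>lborel) = integral {-1..1} g"
proof -
  let ?d = "\<lambda>x. k * q^2 * u x * P x / (c * sqrt W)"
  define F where "F y = integral {-1..y} g" for y
  have Fc: "continuous_on {-1..1} F"
    unfolding F_def by (rule indefinite_integral_continuous_1[OF integrable_continuous_real[OF g]])
  have in1: "\<tau> x \<in> {-1..1}" "\<tau> x \<in> {-1<..<1}" for x using \<tau>_bound[of x] by auto
  have d: "((\<lambda>x. F (\<tau> x)) has_real_derivative g (\<tau> x) * ?d x) (at x)" for x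
  proof (rule DERIV_chain2[OF _ \<tau>_deriv])
    have "(F has_real_derivative g (\<tau> x)) (at (\<tau> x) within {-1..1})"
      unfolding F_def by (rule integral_has_real_derivative[OF g in1(1)])
    then show "(F has_real_derivative g (\<tau> x)) (at (\<tau> x))"
      using in1(2)[of x] by (metis at_within_Icc_at greaterThanLessThan_iff)
  qed
  have \<tau>c: "isCont \<tau> x" for x using \<tau>_deriv DERIV_isCont by blast
  have gc: "isCont (\<lambda>x. g (\<tau> x)) x" for x
  proof -
    have "continuous_on UNIV (\<lambda>x. g (\<tau> x))"
      by (rule continuous_on_compose2[OF g]) (use \<tau>c in1 in \<open>auto intro: continuous_at_imp_continuous_on\<close>)
    then show ?thesis by (simp add: continuous_on_eq_continuous_at)
  qed
  have cont: "isCont (\<lambda>x. g (\<tau> x) * ?d x) x" for x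
    by (intro continuous_intros gc isCont_u isCont_P) (use c_pos W_pos in simp)
  have "bounded (g ` {-1..1})"
    by (intro compact_imp_bounded compact_continuous_image g) simp
  then have gb: "bdd_fun (\<lambda>x. g (\<tau> x))"
    unfolding bounded_iff bdd_fun_def using in1 by (metis imageI real_norm_def)
  have "exp_decay (\<lambda>x. (g (\<tau> x) * (k * q^2 * (1 / (c * sqrt W))) * P x) * u x)"
    by (intro exp_decay_mult exp_decay_u bdd_fun_intros gb bdd_wave)
  then have dec: "exp_decay (\<lambda>x. g (\<tau> x) * ?d x)" by (simp add: mult_ac)
  have "(\<integral>x. g (\<tau> x) * ?d x \<partial>lborel) = F 1 - F (-1)"
  proof (rule integral_FTC_real_line[OF d cont exp_decay_integrable[OF dec cont]])
    show "((\<lambda>x. F (\<tau> x)) \<longlongrightarrow> F (-1)) at_bot"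
      by (rule continuous_on_tendsto_compose[OF Fc \<tau>_lim(2)]) (use in1 in auto)
    show "((\<lambda>x. F (\<tau> x)) \<longlongrightarrow> F 1) at_top"
      by (rule continuous_on_tendsto_compose[OF Fc \<tau>_lim(1)]) (use in1 in auto)
  qed
  then show ?thesis by (simp add: F_def)
qed

end

subsection \<open>Dependence on the asymptotic state\<close>

text \<open>\<open>wave_t\<close> is \<open>t\<close> as a function of the parameter \<open>\<kappa>\<close> and of \<open>y = \<tau>\<close>; \<open>wave_f\<close> is the density of
  \<open>\<F>/\<kappa>\<^sup>2\<close> with respect to \<open>d\<tau>\<close>. Primes denote derivatives in \<open>\<kappa>\<close>.\<close>

definition wave_t :: "real \<Rightarrow> real \<Rightarrow> real \<Rightarrow> real" where
  "wave_t c \<kappa> y = \<kappa> / sqrt (c - \<kappa>^2) + (c - 4 * \<kappa>^2) / (2 * \<kappa> * sqrt (c - \<kappa>^2)) * (1 - y^2)"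

definition wave_t' :: "real \<Rightarrow> real \<Rightarrow> real \<Rightarrow> real" where
  "wave_t' c \<kappa> y = c / sqrt (c - \<kappa>^2) ^ 3
     - c * (c + 2 * \<kappa>^2) / (2 * \<kappa>^2 * sqrt (c - \<kappa>^2) ^ 3) * (1 - y^2)"

definition wave_f :: "real \<Rightarrow> real \<Rightarrow> real \<Rightarrow> real" where
  "wave_f c \<kappa> y = sqrt (c - 4 * \<kappa>^2) / \<kappa> *
     (sqrt (c - \<kappa>^2) / \<kappa> - 2 * (wave_t c \<kappa> y + \<kappa> / sqrt (c - \<kappa>^2)) / (1 + (wave_t c \<kappa> y)^2))"

definition wave_f' :: "real \<Rightarrow> real \<Rightarrow> real \<Rightarrow> real" where
  "wave_f' c \<kappa> y =
     (- 4 / sqrt (c - 4 * \<kappa>^2) - sqrt (c - 4 * \<kappa>^2) / \<kappa>^2) *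
     (sqrt (c - \<kappa>^2) / \<kappa> - 2 * (wave_t c \<kappa> y + \<kappa> / sqrt (c - \<kappa>^2)) / (1 + (wave_t c \<kappa> y)^2))
     + sqrt (c - 4 * \<kappa>^2) / \<kappa> *
     (- 1 / sqrt (c - \<kappa>^2) - sqrt (c - \<kappa>^2) / \<kappa>^2
      - (2 * (wave_t' c \<kappa> y + c / sqrt (c - \<kappa>^2) ^ 3) / (1 + (wave_t c \<kappa> y)^2)
         - 4 * (wave_t c \<kappa> y + \<kappa> / sqrt (c - \<kappa>^2)) * wave_t c \<kappa> y * wave_t' c \<kappa> y / (1 + (wave_t c \<kappa> y)^2)^2))"

lemma
  assumes "0 < \<kappa>" "4 * \<kappa>^2 < c"
  shows wave_t_deriv: "((\<lambda>\<kappa>. wave_t c \<kappa> y) has_real_derivative wave_t' c \<kappa> y) (at \<kappa>)" (is ?g1)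
    and sqrt_ratio_deriv: "((\<lambda>\<kappa>. \<kappa> / sqrt (c - \<kappa>^2)) has_real_derivative c / sqrt (c - \<kappa>^2) ^ 3) (at \<kappa>)" (is ?g2)
    and sqrt_deriv: "((\<lambda>\<kappa>. sqrt (c - \<kappa>^2)) has_real_derivative - \<kappa> / sqrt (c - \<kappa>^2)) (at \<kappa>)" (is ?g3)
proof -
  define q where "q = sqrt (c - \<kappa>^2)"
  have k2: "\<kappa>^2 < c" using assms zero_le_power2[of \<kappa>] by linarith
  then have q: "0 < q" "q^2 = c - \<kappa>^2" by (simp_all add: q_def)
  show dq: ?g3
    using k2 by (auto intro!: derivative_eq_intros simp: field_simps)
  have "((\<lambda>\<kappa>. \<kappa> / sqrt (c - \<kappa>^2)) has_real_derivative (1 * q - \<kappa> * (- \<kappa> / q)) / (q * q)) (at \<kappa>)"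
    unfolding q_def by (rule DERIV_divide[OF DERIV_ident dq]) (use q in \<open>simp add: q_def[symmetric]\<close>)
  moreover have "(1 * q - \<kappa> * (- \<kappa> / q)) / (q * q) = c / q ^ 3"
    using q by (simp add: field_simps power2_eq_square power3_eq_cube)
  ultimately show d0: ?g2
    by (simp add: q_def)
  have "((\<lambda>\<kappa>. c - 4 * \<kappa>^2) has_real_derivative - 8 * \<kappa>) (at \<kappa>)"
    by (auto intro!: derivative_eq_intros)
  moreover have "((\<lambda>\<kappa>. 2 * \<kappa> * sqrt (c - \<kappa>^2)) has_real_derivative 2 * q - 2 * \<kappa>^2 / q) (at \<kappa>)"
    by (rule DERIV_cong[OF DERIV_mult[OF DERIV_cmult[OF DERIV_ident] dq]]) (simp add: q_def power2_eq_square)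
  ultimately have "((\<lambda>\<kappa>. (c - 4 * \<kappa>^2) / (2 * \<kappa> * sqrt (c - \<kappa>^2))) has_real_derivative
      (- 8 * \<kappa> * (2 * \<kappa> * q) - (c - 4 * \<kappa>^2) * (2 * q - 2 * \<kappa>^2 / q)) / ((2 * \<kappa> * q) * (2 * \<kappa> * q))) (at \<kappa>)"
    unfolding q_def by (rule DERIV_divide) (use q assms in \<open>simp add: q_def[symmetric]\<close>)
  moreover have "(- 8 * \<kappa> * (2 * \<kappa> * q) - (c - 4 * \<kappa>^2) * (2 * q - 2 * \<kappa>^2 / q)) / ((2 * \<kappa> * q) * (2 * \<kappa> * q)) =
      - (c * (c + 2 * \<kappa>^2) / (2 * \<kappa>^2 * q ^ 3))"
  proof -
    have c: "c = q^2 + \<kappa>^2" using q by simp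
    have "- 8 * \<kappa> * (2 * \<kappa> * q) - (c - 4 * \<kappa>^2) * (2 * q - 2 * \<kappa>^2 / q) = - 2 * (c * (c + 2 * \<kappa>^2)) / q"
      using q(1) unfolding c by (simp add: field_simps) algebra
    then have "(- 8 * \<kappa> * (2 * \<kappa> * q) - (c - 4 * \<kappa>^2) * (2 * q - 2 * \<kappa>^2 / q)) / ((2 * \<kappa> * q) * (2 * \<kappa> * q)) =
        (- 2 * (c * (c + 2 * \<kappa>^2)) / q) / ((2 * \<kappa> * q) * (2 * \<kappa> * q))" by (simp only:)
    also have "\<dots> = - (c * (c + 2 * \<kappa>^2) / (2 * \<kappa>^2 * q ^ 3))"
      using q(1) assms(1) by (simp add: field_simps power2_eq_square power3_eq_cube)
    finally show ?thesis .
  qed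
  ultimately have dh: "((\<lambda>\<kappa>. (c - 4 * \<kappa>^2) / (2 * \<kappa> * sqrt (c - \<kappa>^2))) has_real_derivative
      - (c * (c + 2 * \<kappa>^2) / (2 * \<kappa>^2 * q ^ 3))) (at \<kappa>)"
    by simp
  show ?g1
    unfolding wave_t_def wave_t'_def
    by (rule DERIV_cong[OF DERIV_add[OF d0 DERIV_cmult_right[OF dh]]]) (simp add: q_def)
qed

lemma wave_f_deriv:
  assumes k: "0 < \<kappa>" "4 * \<kappa>^2 < c"
  shows "((\<lambda>\<kappa>. wave_f c \<kappa> y) has_real_derivative wave_f' c \<kappa> y) (at \<kappa>)"
proof -
  let ?r = "sqrt (c - 4 * \<kappa>^2)" and ?q = "sqrt (c - \<kappa>^2)" and ?t = "wave_t c \<kappa> y" and ?t1 = "wave_t' c \<kappa> y"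
  have k2: "\<kappa>^2 < c" using k zero_le_power2[of \<kappa>] by linarith
  have q: "0 < ?q" and r: "0 < ?r" using k2 k by simp_all
  have P: "1 + ?t^2 \<noteq> 0" by (smt (verit) zero_le_power2)
  have dr: "((\<lambda>\<kappa>. sqrt (c - 4 * \<kappa>^2)) has_real_derivative - 4 * \<kappa> / ?r) (at \<kappa>)"
    using k by (auto intro!: derivative_eq_intros simp: field_simps)
  have 1: "((\<lambda>\<kappa>. sqrt (c - 4 * \<kappa>^2) / \<kappa>) has_real_derivative - 4 / ?r - ?r / \<kappa>^2) (at \<kappa>)"
    by (rule DERIV_cong[OF DERIV_divide[OF dr DERIV_ident]])
      (use k r in \<open>simp_all add: diff_divide_distrib power2_eq_square\<close>)
  have 2: "((\<lambda>\<kappa>. sqrt (c - \<kappa>^2) / \<kappa>) has_real_derivative - 1 / ?q - ?q / \<kappa>^2) (at \<kappa>)"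
    by (rule DERIV_cong[OF DERIV_divide[OF sqrt_deriv[OF k] DERIV_ident]])
      (use k q in \<open>simp_all add: diff_divide_distrib power2_eq_square\<close>)
  have 3: "((\<lambda>\<kappa>. 2 * (wave_t c \<kappa> y + \<kappa> / sqrt (c - \<kappa>^2))) has_real_derivative 2 * (?t1 + c / ?q ^ 3)) (at \<kappa>)"
    by (rule DERIV_cmult[OF DERIV_add[OF wave_t_deriv[OF k] sqrt_ratio_deriv[OF k]]])
  have 4: "((\<lambda>\<kappa>. 1 + (wave_t c \<kappa> y)^2) has_real_derivative 2 * ?t * ?t1) (at \<kappa>)"
    by (rule DERIV_cong[OF DERIV_add[OF DERIV_const DERIV_power[OF wave_t_deriv[OF k]]]]) simp
  have 5: "((\<lambda>\<kappa>. 2 * (wave_t c \<kappa> y + \<kappa> / sqrt (c - \<kappa>^2)) / (1 + (wave_t c \<kappa> y)^2)) has_real_derivative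
      2 * (?t1 + c / ?q ^ 3) / (1 + ?t^2) - 4 * (?t + \<kappa> / ?q) * ?t * ?t1 / (1 + ?t^2)^2) (at \<kappa>)"
    by (rule DERIV_cong[OF DERIV_divide[OF 3 4 P]])
      (use P in \<open>simp add: diff_divide_distrib power2_eq_square[of "1 + ?t^2"] mult_ac\<close>)
  show ?thesis
    unfolding wave_f_def wave_f'_def
    by (rule DERIV_cong[OF DERIV_mult[OF 1 DERIV_diff[OF 2 5]]]) algebra
qed

lemma one_plus_square_ne_0: "1 + (x::real)^2 \<noteq> 0"
  by (smt (verit) zero_le_power2)

lemma continuous_wave_f:
  assumes k: "0 < \<kappa>" "4 * \<kappa>^2 < c"
  shows "continuous_on {-1..1} (wave_f c \<kappa>)" "continuous_on {-1..1} (wave_f' c \<kappa>)"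
proof -
  have k2: "\<kappa>^2 < c" using k zero_le_power2[of \<kappa>] by linarith
  have n: "sqrt (c - \<kappa>^2) \<noteq> 0" "sqrt (c - 4 * \<kappa>^2) \<noteq> 0" "\<kappa> \<noteq> 0" "\<kappa>^2 \<noteq> 0"
    "2 * \<kappa> * sqrt (c - \<kappa>^2) \<noteq> 0" "sqrt (c - \<kappa>^2) ^ 3 \<noteq> 0" "2 * \<kappa>^2 * sqrt (c - \<kappa>^2) ^ 3 \<noteq> 0"
    using k k2 by auto
  have p: "(1 + (wave_t c \<kappa> y)^2)^2 \<noteq> 0" for y using one_plus_square_ne_0 by simp
  have t: "continuous_on {-1..1} (wave_t c \<kappa>)" "continuous_on {-1..1} (wave_t' c \<kappa>)"
    unfolding wave_t_def[abs_def] wave_t'_def[abs_def] by (intro continuous_intros ballI n)+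
  show "continuous_on {-1..1} (wave_f c \<kappa>)" "continuous_on {-1..1} (wave_f' c \<kappa>)"
    unfolding wave_f_def[abs_def] wave_f'_def[abs_def]
    by (intro continuous_intros ballI n t one_plus_square_ne_0 p)+
qed

text \<open>The factor \<open>u\<close> of the density cancels against the one in the derivative of
  \<open>\<tau>\<close>, so the integrand is regular up to the endpoints; joint continuity of
  \<open>wave_f'\<close> is then enough for the Leibniz rule on the compact interval.\<close>

lemma integral_wave_f_deriv:
  assumes c: "0 < c" and k: "0 < k" "k < sqrt c / 2"
  shows "((\<lambda>\<kappa>. integral {-1..1} (wave_f c \<kappa>)) has_real_derivative integral {-1..1} (wave_f' c k)) (at k)"
proof -
  let ?U = "{0<..<sqrt c / 2}"
  have U: "0 < \<kappa>" "4 * \<kappa>^2 < c" "\<kappa>^2 < c" if "\<kappa> \<in> ?U" for \<kappa>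
  proof -
    have "2 * \<kappa> < sqrt c" "0 < \<kappa>" using that by auto
    then have "(2 * \<kappa>)^2 < (sqrt c)^2" by (intro power_strict_mono) auto
    then show "0 < \<kappa>" "4 * \<kappa>^2 < c" using c \<open>0 < \<kappa>\<close> by (simp_all add: power_mult_distrib)
    then show "\<kappa>^2 < c" using zero_le_power2[of \<kappa>] by linarith
  qed
  have "((\<lambda>\<kappa>. integral (cbox (-1) 1) (wave_f c \<kappa>)) has_field_derivative integral (cbox (-1) 1) (wave_f' c k)) (at k within ?U)"
  proof (rule leibniz_rule_field_derivative)
    show "((\<lambda>\<kappa>. wave_f c \<kappa> y) has_field_derivative wave_f' c \<kappa> y) (at \<kappa> within ?U)" if "\<kappa> \<in> ?U" for \<kappa> y
      by (rule has_field_derivative_at_within[OF wave_f_deriv[OF U(1,2)[OF that]]])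
    show "wave_f c \<kappa> integrable_on cbox (-1) 1" if "\<kappa> \<in> ?U" for \<kappa>
      using continuous_wave_f(1)[OF U(1,2)[OF that]] by (simp add: integrable_continuous_real)
    have n: "sqrt (c - (fst z)^2) \<noteq> 0" "sqrt (c - 4 * (fst z)^2) \<noteq> 0" "fst z \<noteq> 0" "(fst z)^2 \<noteq> 0"
      "2 * fst z * sqrt (c - (fst z)^2) \<noteq> 0" "sqrt (c - (fst z)^2) ^ 3 \<noteq> 0"
      "2 * (fst z)^2 * sqrt (c - (fst z)^2) ^ 3 \<noteq> 0" if "z \<in> ?U \<times> cbox (-1) 1" for z :: "real \<times> real"
      using U[of "fst z"] that by auto
    have p: "(1 + (wave_t c \<kappa> y)^2)^2 \<noteq> 0" for \<kappa> y using one_plus_square_ne_0 by simp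
    have t: "continuous_on (?U \<times> cbox (-1) 1) (\<lambda>z. wave_t c (fst z) (snd z))"
      "continuous_on (?U \<times> cbox (-1) 1) (\<lambda>z. wave_t' c (fst z) (snd z))"
      unfolding wave_t_def wave_t'_def by (intro continuous_intros ballI n; assumption)+
    have "continuous_on (?U \<times> cbox (-1) 1) (\<lambda>z. wave_f' c (fst z) (snd z))"
      unfolding wave_f'_def
      by (intro continuous_intros ballI n t one_plus_square_ne_0 p; assumption)
    then show "continuous_on (?U \<times> cbox (-1) 1) (\<lambda>(\<kappa>, y). wave_f' c \<kappa> y)"
      by (simp add: case_prod_beta')
    show "k \<in> ?U" using k by simp
  qed simp
  moreover have "at k within ?U = at k"
    by (rule at_within_open) (use k in auto)
  ultimately show ?thesis by (simp only: box_real)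
qed

section \<open>The parametric derivative expressed on a wave and compared with the pairing\<close>

context novikov_wave
begin

lemma sqrt_q: "sqrt (c - k^2) = q" and sqrt_W: "c - 4 * k^2 = W"
  using q by (simp_all add: c_def)

lemma W_ne_0: "W \<noteq> 0"
  using W_pos by linarith

lemma wave_t_\<tau>: "wave_t c k (\<tau> x) = t x"
proof -
  have "wave_t c k (\<tau> x) = k / q + W / (2 * k * q) * (2 * k * (q * u x) / W)"
    unfolding wave_t_def sqrt_q sqrt_W \<tau>_sq ..
  also have "\<dots> = k / q + u x" using W_ne_0 k q by simp
  finally show ?thesis by (simp add: u_def)
qed

lemma wave_t'_\<tau>: "wave_t' c k (\<tau> x) = c * \<theta> x / (k * q^2 * W)"
proof -
  have "wave_t' c k (\<tau> x) = c / q ^ 3 - c * (c + 2 * k^2) / (2 * k^2 * q ^ 3) * (2 * k * (q * u x) / W)"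
    unfolding wave_t'_def sqrt_q \<tau>_sq ..
  also have "\<dots> = c / q ^ 3 - c * (c + 2 * k^2) * (q * u x) / (k * q ^ 3 * W)"
    using W_ne_0 k q by (simp add: power2_eq_square)
  also have "\<dots> = c * (k * W - (c + 2 * k^2) * (q * u x)) / (k * q ^ 3 * W)"
  proof -
    have "c / q ^ 3 = c * (k * W) / (k * q ^ 3 * W)" using W_ne_0 k by simp
    then show ?thesis by (simp only: right_diff_distrib diff_divide_distrib mult.assoc)
  qed
  also have "k * W - (c + 2 * k^2) * (q * u x) = q * \<theta> x"
    unfolding qu c_def \<theta>_def by algebra
  finally show ?thesis
    using q by (simp add: power2_eq_square power3_eq_cube)
qed

lemma density_eq: "density x = wave_f c k (\<tau> x) * (k * q^2 * u x * P x / (c * sqrt W))"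
proof -
  have P0: "P x \<noteq> 0" using P_pos[of x] by simp
  have r0: "sqrt W \<noteq> 0" using W_ne_0 by simp
  have "wave_f c k (\<tau> x) * (k * q^2 * u x * P x / (c * sqrt W)) =
      (sqrt W / k * (q / k - 2 * (t x + k / q) / P x)) * (k * q^2 * u x * P x / (c * sqrt W))"
    unfolding wave_f_def wave_t_\<tau> sqrt_q sqrt_W P_def ..
  also have "\<dots> = (q^2 * u x / c) * (P x * (q / k - 2 * (t x + k / q) / P x))"
    using r0 k by simp
  also have "P x * (q / k - 2 * (t x + k / q) / P x) = P x * (q / k) - 2 * (t x + k / q)"
    using P0 by (simp add: right_diff_distrib)
  finally show ?thesis by (simp add: density_def)
qed

text \<open>The density of the \<open>k\<close>-derivative of \<open>\<F>/k\<^sup>2\<close> with respect to \<open>dx\<close>, rescaled.\<close>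

definition D :: "real \<Rightarrow> real" where
  "D x = q * u x * (- (k * q^2 * (2 * q^2 - 3 * k^2) * P x) + 2 * k^2 * q^2 * (q * t x + k) - 2 * k^2 * q * \<theta> x
      - 2 * k ^ 3 * W + 4 * k^2 * (q * t x + k) * t x * \<theta> x * (1 / P x))"

lemma D_eq: "k * q^2 * W * k^2 * (wave_f' c k (\<tau> x) * (k * q^2 * u x * P x / (c * sqrt W))) = D x"
proof -
  \<comment> \<open>The square root and all reciprocals become variables tied by relations such as
    \<open>W * l = 1\<close>, which makes the claim polynomial; those products are regrouped below
    so that they can be replaced by 1.\<close>
  define r where "r = sqrt W"
  define e where "e = inverse (P x)"
  define i where "i = inverse q"
  define j where "j = inverse k"
  define l where "l = inverse W"
  define z where "z = inverse c"
  have r: "r * r = W" "r \<noteq> 0" using W_pos by (simp_all add: r_def)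
  have e: "P x * e = 1" and i: "q * i = 1" and j: "k * j = 1" and l: "W * l = 1" and z: "c * z = 1"
    using P_pos[of x] q k W_ne_0 c_pos by (simp_all add: e_def i_def j_def l_def z_def)
  let ?A = "(- (4 * l) - j^2) * (q * j - 2 * (t x + k * i) * e)
     + j * (- i - q * j^2 - (2 * (c * \<theta> x * (j * i^2 * l) + c * i ^ 3) * e
         - 4 * (t x + k * i) * t x * (c * \<theta> x * (j * i^2 * l)) * e^2))"
  have "wave_f' c k (\<tau> x) =
     (- 4 / r - r / k^2) * (q / k - 2 * (t x + k / q) / P x)
     + r / k * (- 1 / q - q / k^2 - (2 * (c * \<theta> x / (k * q^2 * W) + c / q ^ 3) / P x
         - 4 * (t x + k / q) * t x * (c * \<theta> x / (k * q^2 * W)) / (P x)^2))"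
    unfolding wave_f'_def wave_t_\<tau> wave_t'_\<tau> sqrt_q sqrt_W P_def r_def ..
  also have "- 4 / r = - (4 * l) * r"
  proof -
    have "r * (- (4 * l) * r) = - 4 * ((r * r) * l)" by algebra
    then have "r * (- 4 / r) = r * (- (4 * l) * r)" using r(2) unfolding r(1) l by simp
    then show ?thesis using r(2) by (simp only: mult_cancel_left) simp
  qed
  finally have f: "wave_f' c k (\<tau> x) = r * ?A"
    unfolding divide_inverse inverse_mult_distrib power_inverse[symmetric]
      e_def[symmetric] i_def[symmetric] j_def[symmetric] l_def[symmetric] by algebra
  have "r * ?A * (k * q^2 * u x * P x / (c * r)) = k * q^2 * u x * P x * z * ?A"
    using r(2) by (simp add: z_def divide_inverse)
  then have "k * q^2 * W * k^2 * (wave_f' c k (\<tau> x) * (k * q^2 * u x * P x / (c * sqrt W))) =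
     k * q^2 * W * k^2 * (k * q^2 * u x * P x * z * ?A)"
    unfolding f r_def[symmetric] by (simp only:)
  also have "\<dots> = k^2 * q ^ 4 * u x * P x * z * (k^2 * W * (- (4 * l) - j^2)) * (q * j - 2 * (t x + k * i) * e)
     + k ^ 3 * (k * j) * q ^ 4 * W * u x * P x * z * (- i - q * j^2)
     - 2 * (k * j) * (P x * e) * (c * z) * u x * (k^2 * (k * j) * q^2 * (q * i)^2 * (W * l) * \<theta> x + k ^ 3 * q * (q * i) ^ 3 * W)
     + 4 * (k * j)^2 * (q * i)^2 * (W * l) * (P x * e) * (c * z) * k^2 * q * u x * (q * t x + k * (q * i)) * t x * \<theta> x * e"
    by algebra
  also have "k^2 * W * (- (4 * l) - j^2) = - c"
  proof -
    have "k^2 * W * (- (4 * l) - j^2) = - (4 * k^2 * (W * l)) - (k * j)^2 * W" by algebra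
    then show ?thesis unfolding l j by (simp add: c_def)
  qed
  also have "k^2 * q ^ 4 * u x * P x * z * (- c) * (q * j - 2 * (t x + k * i) * e) =
      - ((c * z) * u x * (k * q ^ 5 * (k * j) * P x - 2 * k^2 * q ^ 3 * (P x * e) * (q * t x + k * (q * i))))"
    by algebra
  also have "k ^ 3 * (k * j) * q ^ 4 * W * u x * P x * z * (- i - q * j^2) =
      - ((k * j) * u x * P x * W * (k * q ^ 3) * (k^2 * (q * i) + q^2 * (k * j)^2) * z)"
    by algebra
  also have "(k * j) * u x * P x * W * (k * q ^ 3) * (k^2 * (q * i) + q^2 * (k * j)^2) * z =
      u x * P x * W * (k * q ^ 3) * (c * z)"
    unfolding i j c_def by simp
  finally have "k * q^2 * W * k^2 * (wave_f' c k (\<tau> x) * (k * q^2 * u x * P x / (c * sqrt W))) =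
     - (u x * (k * q ^ 5 * P x - 2 * k^2 * q ^ 3 * (q * t x + k))) - u x * P x * W * (k * q ^ 3)
     - 2 * u x * (k^2 * q^2 * \<theta> x + k ^ 3 * q * W) + 4 * k^2 * q * u x * (q * t x + k) * t x * \<theta> x * e"
    unfolding i j l z e by (simp only: mult_1_right mult_1_left power_one)
  also have "\<dots> = D x"
    unfolding D_def by (simp only: e_def[symmetric] inverse_eq_divide[symmetric]) algebra
  finally show ?thesis .
qed

text \<open>The antiderivative of \<open>6 * t * u\<close> with respect to \<open>t\<close> that has
  a double zero at \<open>t = k / q\<close>, hence decays along the wave.\<close>

lemma potential_deriv: "((\<lambda>x. (u x)^2 * (3 * t x - u x)) has_real_derivative 6 * t x * u x * (- (\<rho> x * u x) * P x)) (at x)"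
  by (rule DERIV_cong[OF DERIV_mult[OF DERIV_power[OF u_deriv] DERIV_diff[OF DERIV_cmult[OF t_deriv] u_deriv]]])
    (simp add: algebra_simps power2_eq_square)

lemma weight_\<delta>\<F>: "3 * a * y / s x ^ 3 * (2 * s x * u x) = 6 * a / c * P x * u x * y"
proof -
  have is2: "1 / (s x)^2 = P x / c"
    unfolding sP[of x, symmetric] using s_pos[of x] P_pos[of x] by simp
  have "3 * a * y / s x ^ 3 * (2 * s x * u x) = 6 * a * y * u x * (1 / (s x)^2)"
    using s_pos[of x] by (simp add: power2_eq_square power3_eq_cube)
  then show ?thesis unfolding is2 by simp
qed

lemma integral_T_\<delta>\<F>:
  "integrable lborel (\<lambda>x. 3 * a * T x / s x ^ 3 * (2 * s x * u x))" (is ?g1)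
  "(\<integral>x. 3 * a * T x / s x ^ 3 * (2 * s x * u x) \<partial>lborel) = 0" (is ?g2)
proof -
  have dec: "exp_decay (\<lambda>x. 6 * a / c * P x * u x * T x)"
  proof -
    have "exp_decay (\<lambda>x. (6 * a / c * P x * T x) * u x)" by (intro exp_decay_mult exp_decay_u bdd_fun_intros bdd_wave)
    then show ?thesis by (simp add: mult_ac)
  qed
  have cont: "isCont (\<lambda>x. 6 * a / c * P x * u x * T x) x" for x
    by (intro continuous_intros isCont_P isCont_u isCont_T)
  note int = exp_decay_integrable[OF dec cont]
  then show ?g1 unfolding weight_\<delta>\<F> .
  have decH: "exp_decay (\<lambda>x. - (a / c) * ((u x)^2 * (3 * t x - u x)))"
  proof -
    have "exp_decay (\<lambda>x. (- (a / c) * u x * (3 * t x - u x)) * u x)" by (intro exp_decay_mult exp_decay_u bdd_fun_intros bdd_wave)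
    then show ?thesis by (simp add: mult_ac power2_eq_square)
  qed
  have "(\<integral>x. 6 * a / c * P x * u x * T x \<partial>lborel) = 0 - 0"
  proof (rule integral_FTC_real_line[OF _ cont int exp_decay_tendsto_0(2,1)[OF decH]])
    show "((\<lambda>x. - (a / c) * ((u x)^2 * (3 * t x - u x))) has_real_derivative 6 * a / c * P x * u x * T x) (at x)" for x
      by (rule DERIV_cong[OF DERIV_cmult[OF potential_deriv]]) (simp add: T_def)
  qed
  then show ?g2 unfolding weight_\<delta>\<F> by simp
qed

text \<open>Takes the place of the chain rule. The left integrand is built from the derivative at
  fixed \<open>x\<close>, the right side from the one at fixed \<open>\<tau>\<close>, rewritten as
  the integral of \<open>D\<close>; a decaying antiderivative of the difference shows that the
  integrals agree.\<close>

lemma integral_n_\<delta>\<F>: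
  assumes \<Xi>: "shift_deriv \<Xi>"
  shows "integrable lborel (\<lambda>x. 3 * a * n \<Xi> x / s x ^ 3 * (2 * s x * u x))" (is ?g1)
    "(\<integral>x. 3 * a * n \<Xi> x / s x ^ 3 * (2 * s x * u x) \<partial>lborel) = k * q^2 * W * k^2 * integral {-1..1} (wave_f' c k)"
proof -
  let ?y' = "k^2 * (5 * q^2 - 3 * k^2)"
  let ?y = "\<lambda>x. ?y' * t x + 2 * k * q * c"
  have c0: "c \<noteq> 0" using c_pos by simp
  have P0: "P x \<noteq> 0" for x using P_pos[of x] by simp
  have \<Xi>1: "(\<Xi> has_real_derivative ?y' - 2 * c * t x * \<theta> x / P x) (at x)" for x
    using \<Xi> by (simp add: shift_deriv_def)
  have nc: "isCont (n \<Xi>) x" "isCont \<Xi> x" for x using n_deriv[OF \<Xi>] \<Xi>1 DERIV_isCont by blast+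
  have dec: "exp_decay (\<lambda>x. 6 * a / c * P x * u x * n \<Xi> x)"
    by (intro exp_decay_mult exp_decay_n[OF \<Xi>] bdd_fun_intros bdd_wave)
  have cont: "isCont (\<lambda>x. 6 * a / c * P x * u x * n \<Xi> x) x" for x
    by (intro continuous_intros isCont_P isCont_u nc)
  note int = exp_decay_integrable[OF dec cont]
  then show ?g1 unfolding weight_\<delta>\<F> .
  have decD: "exp_decay D"
  proof -
    have "exp_decay (\<lambda>x. (q * (- (k * q^2 * (2 * q^2 - 3 * k^2) * P x) + 2 * k^2 * q^2 * (q * t x + k) - 2 * k^2 * q * \<theta> x
      - 2 * k ^ 3 * W + 4 * k^2 * (q * t x + k) * t x * \<theta> x * (1 / P x))) * u x)"
      by (intro exp_decay_mult exp_decay_u bdd_fun_intros bdd_wave bdd_\<theta>)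
    then show ?thesis by (simp only: D_def[abs_def] mult_ac)
  qed
  have contD: "isCont D x" for x
    unfolding D_def[abs_def] by (intro continuous_intros isCont_P isCont_u isCont_t isCont_\<theta> P0)
  note intD = exp_decay_integrable[OF decD contD]
  \<comment> \<open>An antiderivative of the difference of the two integrands: the first term integrates the
    \<open>\<Xi>\<close>-part by parts, the second is the Wronskian of \<open>\<phi>\<close> and its \<open>k\<close>-derivative.\<close>
  define Z where "Z x = - (a / c) * ((u x)^2 * (3 * t x - u x) * \<Xi> x) - c * (\<rho> x * u x * (1 / P x * ?y x))" for x
  have decZ: "exp_decay Z"
  proof -
    have "exp_decay (\<lambda>x. (- (a / c) * u x * (3 * t x - u x)) * u x)" by (intro exp_decay_mult exp_decay_u bdd_fun_intros bdd_wave)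
    from exp_decay_mult_shift[OF \<Xi> this]
    have "exp_decay (\<lambda>x. (- (a / c) * u x * (3 * t x - u x)) * u x * \<Xi> x + (- c * (1 / P x) * ?y x) * (\<rho> x * u x))"
      by (rule exp_decay_add) (intro exp_decay_mult[OF _ exp_decay_\<rho>u] bdd_fun_intros bdd_wave)
    moreover have "(- (a / c) * u x * (3 * t x - u x)) * u x * \<Xi> x + (- c * (1 / P x) * ?y x) * (\<rho> x * u x) = Z x" for x
      unfolding Z_def by algebra
    ultimately show ?thesis by (simp only:)
  qed
  have dZ: "(Z has_real_derivative 6 * a / c * P x * u x * n \<Xi> x - D x) (at x)" for x
  proof -
    define e where "e = 1 / P x"
    have e: "P x * e = 1" using P0 by (simp add: e_def)
    have d1: "((\<lambda>x. 1 / P x) has_real_derivative 2 * t x * (\<rho> x * u x) * e) (at x)"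
      by (rule DERIV_cong[OF DERIV_divide[OF DERIV_const P_deriv P0]]) (use P0 in \<open>simp add: e_def\<close>)
    have d2: "(?y has_real_derivative ?y' * (- (\<rho> x * u x) * P x)) (at x)"
      by (rule DERIV_cong[OF DERIV_add[OF DERIV_cmult[OF t_deriv] DERIV_const]]) simp
    have d3: "((\<lambda>x. \<rho> x * u x * (1 / P x * ?y x)) has_real_derivative
        G x * ?y x / c^2 + (\<rho> x * u x)^2 * (2 * t x * e * ?y x - ?y')) (at x)"
    proof (rule DERIV_cong[OF DERIV_mult[OF \<rho>u_deriv DERIV_mult[OF d1 d2]]])
      have "P x * G x / c^2 * (1 / P x * ?y x) = G x * ?y x / c^2" using P0 by simp
      then show "P x * G x / c^2 * (1 / P x * ?y x) +
        (2 * t x * (\<rho> x * u x) * e * ?y x + ?y' * (- (\<rho> x * u x) * P x) * (1 / P x)) * (\<rho> x * u x) =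
        G x * ?y x / c^2 + (\<rho> x * u x)^2 * (2 * t x * e * ?y x - ?y')"
        using e unfolding e_def[symmetric] by algebra
    qed
    have "(Z has_real_derivative - (a / c) * (6 * t x * u x * (- (\<rho> x * u x) * P x) * \<Xi> x + (?y' - 2 * c * t x * \<theta> x * e) * ((u x)^2 * (3 * t x - u x)))
        - c * (G x * ?y x / c^2 + (\<rho> x * u x)^2 * (2 * t x * e * ?y x - ?y'))) (at x)"
      unfolding Z_def[abs_def] using DERIV_mult[OF potential_deriv \<Xi>1[of x]]
      by (intro DERIV_diff DERIV_cmult d3) (simp add: e_def)
    moreover have "- (a / c) * (6 * t x * u x * (- (\<rho> x * u x) * P x) * \<Xi> x + (?y' - 2 * c * t x * \<theta> x * e) * ((u x)^2 * (3 * t x - u x)))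
        - c * (G x * ?y x / c^2 + (\<rho> x * u x)^2 * (2 * t x * e * ?y x - ?y')) = 6 * a / c * P x * u x * n \<Xi> x - D x"
      (is "?l = ?r")
    proof -
      let ?R = "q^2 * (q^2 - k^2 - 2 * k * q * t x)"
      have h1: "c * (a / c) = a" "c * (6 * a / c) = 6 * a" "c^2 * (G x * ?y x / c^2) = G x * ?y x" using c0 by simp_all
      have "c * ?l = - (c * (a / c)) * (6 * t x * u x * (- (\<rho> x * u x) * P x) * \<Xi> x + (?y' - 2 * c * t x * \<theta> x * e) * ((u x)^2 * (3 * t x - u x)))
        - (c^2 * (G x * ?y x / c^2) + (c^2 * (\<rho> x * u x)^2) * (2 * t x * e * ?y x - ?y'))"
        by algebra
      also have "\<dots> = 6 * a * P x * u x * (t x * (\<rho> x * u x) * \<Xi> x)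
        + (- a * (u x)^2 * (3 * t x - u x) * (?y' - 2 * c * t x * \<theta> x * e) - G x * ?y x
          - 2 * t x * ?R * (u x)^2 * e * ?y x + ?R * (u x)^2 * ?y')"
        unfolding h1 \<rho>u_sq by algebra
      also have "- a * (u x)^2 * (3 * t x - u x) * (?y' - 2 * c * t x * \<theta> x * e) - G x * ?y x
          - 2 * t x * ?R * (u x)^2 * e * ?y x + ?R * (u x)^2 * ?y' = 6 * a * P x * u x * (t x * c * \<theta> x * e - k^2 * W) - c * D x"
        by (rule potential_identity[OF qu c_def refl P_def e \<theta>_def refl refl G_def _ D_def[of x, folded e_def], symmetric]) (use q in simp)
      also have "6 * a * P x * u x * (t x * (\<rho> x * u x) * \<Xi> x) + (6 * a * P x * u x * (t x * c * \<theta> x * e - k^2 * W) - c * D x) =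
         6 * a * P x * u x * n \<Xi> x - c * D x"
      proof -
        have "n \<Xi> x = t x * c * \<theta> x * e - k^2 * W + t x * (\<rho> x * u x) * \<Xi> x"
          by (simp add: n_def e_def algebra_simps)
        then show ?thesis by algebra
      qed
      also have "\<dots> = c * ?r" using h1(2) by algebra
      finally show ?thesis using c0 by simp
    qed
    ultimately show ?thesis by simp
  qed
  have "(\<integral>x. 6 * a / c * P x * u x * n \<Xi> x - D x \<partial>lborel) = 0 - 0"
  proof (rule integral_FTC_real_line[OF dZ _ _ exp_decay_tendsto_0(2,1)[OF decZ]])
    show "isCont (\<lambda>x. 6 * a / c * P x * u x * n \<Xi> x - D x) x" for x
      by (intro continuous_intros isCont_P isCont_u nc contD)
    show "integrable lborel (\<lambda>x. 6 * a / c * P x * u x * n \<Xi> x - D x)"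
      using int intD by (rule Bochner_Integration.integrable_diff)
  qed
  then have "(\<integral>x. 6 * a / c * P x * u x * n \<Xi> x \<partial>lborel) = (\<integral>x. D x \<partial>lborel)"
    using Bochner_Integration.integral_diff[OF int intD] by simp
  also have "\<dots> = k * q^2 * W * k^2 * integral {-1..1} (wave_f' c k)"
  proof -
    have "continuous_on {-1..1} (wave_f' c k)"
      by (rule continuous_wave_f(2)) (use k W_pos sqrt_W in linarith)+
    from integral_reciprocal[OF this] show ?thesis
      unfolding D_eq[symmetric] by (simp only: integral_mult_right_zero)
  qed
  finally show "(\<integral>x. 3 * a * n \<Xi> x / s x ^ 3 * (2 * s x * u x) \<partial>lborel) = k * q^2 * W * k^2 * integral {-1..1} (wave_f' c k)"
    unfolding weight_\<delta>\<F> .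
qed

lemma K_pos: "0 < K"
  using k q by (simp add: K_def)

lemma inverse_Ka: "1 / (K * a) = k powr (5/3) * q ^ 5"
proof -
  have a: "0 < a" using k q by simp
  have "K * a = a powr (-8/3 + 1)" using a by (simp only: powr_add K_def powr_one)
  then have "1 / (K * a) = a powr (5/3)" by (simp add: powr_minus_divide)
  also have "\<dots> = k powr (5/3) * (q ^ 3) powr (5/3)" using k q by (simp add: powr_mult)
  also have "(q ^ 3) powr (5/3) = q ^ 5"
    using powr_of_root[of q "q ^ 3" 3 5] q by (simp add: powr_numeral)
  finally show ?thesis .
qed

lemma isCont_\<delta>\<F>_wave: "isCont (\<lambda>x. 2 * s x * u x) x"
  by (intro continuous_intros isCont_s isCont_u)

end

section \<open>From arbitrary profiles to the explicit formulas\<close>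

lemma profile_params:
  fixes c k :: real
  assumes "0 < c" "0 < k" "k < sqrt c / 2"
  shows "c = k^2 + (sqrt (c - k^2))^2" "0 < sqrt (c - k^2)" "3 * k^2 < (sqrt (c - k^2))^2"
proof -
  have "(2 * k)^2 < (sqrt c)^2" using assms by (intro power_strict_mono) auto
  then have "4 * k^2 < c" using assms by (simp add: power_mult_distrib)
  moreover have "0 < k^2" using assms by simp
  ultimately have "k^2 < c" "3 * k^2 < c - k^2" by linarith+
  then show "c = k^2 + (sqrt (c - k^2))^2" "0 < sqrt (c - k^2)" "3 * k^2 < (sqrt (c - k^2))^2"
    by simp_all
qed

text \<open>The right side no longer refers to the profile, so the functional is an explicit
  function of \<open>k\<close> whichever profiles are given, and no smoothness of the family in
  \<open>k\<close> has to be assumed.\<close>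

lemma \<F>_profile:
  assumes c: "0 < c" and k: "0 < k" "k < sqrt c / 2" and prof: "solitary_profile c k \<phi>"
  shows "1 / k^2 * \<F> k (momentum \<phi>) = integral {-1..1} (wave_f c k)"
proof -
  define q where "q = sqrt (c - k^2)"
  note p = profile_params[OF c k, folded q_def]
  obtain t s \<rho> where w: "novikov_wave k q t s \<rho>" and \<phi>: "smooth \<phi>" "\<And>x. \<phi> x = s x * t x"
    "\<And>x. deriv \<phi> x = - s x * \<rho> x * (t x - k / q)" "\<And>x. momentum \<phi> x = k * q ^ 3 / s x ^ 3"
    using solitary_profile_wave[OF prof p(1,2) k(1) p(3)] by metis
  interpret novikov_wave k q t s \<rho> by (rule w)
  have cc: "novikov_wave.c k q = c" using p(1) by (simp add: c_def)
  have "1 / k^2 * \<F> k (momentum \<phi>) = (\<integral>x. density x \<partial>lborel)"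
    by (rule \<F>_wave[OF helmholtz_momentum[OF \<phi>] \<phi>(4)])
  also have "\<dots> = integral {-1..1} (wave_f (novikov_wave.c k q) k)"
    unfolding density_eq[abs_def]
  proof (rule integral_reciprocal)
    show "continuous_on {-1..1} (wave_f (novikov_wave.c k q) k)"
      by (rule continuous_wave_f(1)) (use k W_pos sqrt_W in linarith)+
  qed
  finally show ?thesis unfolding cc .
qed

theorem lemma4p8:
  fixes c k :: real and \<phi> :: "real \<Rightarrow> real \<Rightarrow> real"
  assumes c: "c > 0"
    and k: "0 < k" "k < sqrt c / 2"
    and profile: "\<And>\<kappa>. 0 < \<kappa> \<Longrightarrow> \<kappa> < sqrt c / 2 \<Longrightarrow> solitary_profile c \<kappa> (\<phi> \<kappa>)"
    and A: "spectral_assumption_A c k (momentum (\<phi> k))"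
  shows "(\<lambda>\<kappa>. 1 / \<kappa>\<^sup>2 * \<F> \<kappa> (momentum (\<phi> \<kappa>))) differentiable (at k) \<and>
    (\<exists>w\<in>H2. AE x in lborel. \<L> c k (momentum (\<phi> k)) w x = of_real (\<delta>\<F> k (momentum (\<phi> k)) x)) \<and>
    (\<forall>w\<in>H2. (AE x in lborel. \<L> c k (momentum (\<phi> k)) w x = of_real (\<delta>\<F> k (momentum (\<phi> k)) x)) \<longrightarrow>
       l2inner w (\<lambda>x. of_real (\<delta>\<F> k (momentum (\<phi> k)) x)) =
       of_real (k powr (11/3) * (c - k\<^sup>2)\<^sup>2 / (18 * c) *
         deriv (\<lambda>\<kappa>. 1 / \<kappa>\<^sup>2 * \<F> \<kappa> (momentum (\<phi> \<kappa>))) k))"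
proof -
  define J where "J = integral {-1..1} (wave_f' c k)"
  have dF: "((\<lambda>\<kappa>. 1 / \<kappa>^2 * \<F> \<kappa> (momentum (\<phi> \<kappa>))) has_real_derivative J) (at k)"
    unfolding J_def
  proof (rule has_field_derivative_transform_within_open[OF integral_wave_f_deriv[OF c k]])
    \<comment> \<open>The reduction to a wave is carried out anew for each \<open>\<kappa>\<close>
      of an open interval around \<open>k\<close>, so the derivative carries over.\<close>
    show "integral {-1..1} (wave_f c \<kappa>) = 1 / \<kappa>^2 * \<F> \<kappa> (momentum (\<phi> \<kappa>))" if "\<kappa> \<in> {0<..<sqrt c / 2}" for \<kappa>
      by (rule \<F>_profile[OF c _ _ profile, symmetric]) (use that in auto)
  qed (use k in auto)
  define q where "q = sqrt (c - k^2)"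
  note p = profile_params[OF c k, folded q_def]
  obtain t s \<rho> where w: "novikov_wave k q t s \<rho>" and \<phi>: "smooth (\<phi> k)" "\<And>x. \<phi> k x = s x * t x"
    "\<And>x. deriv (\<phi> k) x = - s x * \<rho> x * (t x - k / q)" "\<And>x. momentum (\<phi> k) x = k * q ^ 3 / s x ^ 3"
    using solitary_profile_wave[OF profile[OF k] p(1,2) k(1) p(3)] by metis
  interpret wave: novikov_wave k q t s \<rho> by (rule w)
  have cc: "wave.c = c" using p(1) by (simp add: wave.c_def)
  define \<mu> where "\<mu> = (\<lambda>x. k * q ^ 3 / s x ^ 3)"
  have \<mu>: "momentum (\<phi> k) = \<mu>" using \<phi>(4) by (auto simp: \<mu>_def)
  define L where "L = \<L> c k \<mu>"
  define f where "f x = 2 * s x * wave.u x" for x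
  have f: "\<delta>\<F> k \<mu> x = f x" for x
    unfolding f_def by (rule wave.\<delta>\<F>_wave[OF wave.helmholtz_momentum[OF \<phi>, unfolded \<mu>]]) (simp add: \<mu>_def)
  obtain \<Xi> where \<Xi>: "wave.shift_deriv \<Xi>" using wave.shift_exists by blast
  define M where "M = k * q^2 * (q^2 - 3 * k^2)"
  \<comment> \<open>For factor 1, \<open>preimage\<close> gives
    \<open>36 * K * a * c * q * M * s * u\<close>, and \<open>\<delta>\<F>\<close> is
    \<open>2 * s * u\<close>. The factor \<open>M\<close> is there because
    \<open>3 * a * n \<Xi> / s^3\<close> is \<open>M\<close> times the variation of the
    momentum.\<close>
  define d where "d = 1 / (18 * wave.K * (k * q ^ 3) * c * q * M)"
  have nz: "wave.K \<noteq> 0" "k \<noteq> 0" "q \<noteq> 0" "c \<noteq> 0" "M \<noteq> 0"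
    using wave.K_pos k p(2) c wave.W_ne_0 by (auto simp: M_def)
  define v where "v x = 3 * (k * q ^ 3) * (d * wave.n \<Xi> x) / s x ^ 3" for x
  define e where "e x = 3 * (k * q ^ 3) * wave.T x / s x ^ 3" for x
  have v: "(\<lambda>x. complex_of_real (v x)) \<in> H2" "AE x in lborel. L (\<lambda>x. complex_of_real (v x)) x = of_real (f x)"
  proof -
    have 2: "d * (36 * wave.K * (k * q ^ 3) * c * q * M) = 2" using nz by (simp add: d_def)
    show "(\<lambda>x. complex_of_real (v x)) \<in> H2"
      unfolding v_def by (rule wave.preimage(1)[OF \<phi>(1,2) \<Xi>])
    show "AE x in lborel. L (\<lambda>x. complex_of_real (v x)) x = of_real (f x)"
      using wave.preimage(2)[OF \<phi>(1,2) \<Xi>, of d, folded M_def]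
      unfolding L_def v_def \<mu>_def f_def cc 2 .
  qed
  have e: "(\<lambda>x. complex_of_real (e x)) \<in> H2" "AE x in lborel. L (\<lambda>x. complex_of_real (e x)) x = 0"
    "\<not> (AE x in lborel. complex_of_real (e x) = 0)"
    unfolding L_def \<mu>_def e_def
    by (rule wave.translation_mode[OF \<phi>(1,2), unfolded cc] wave.T_nonzero)+
  have inner: "l2inner w (\<lambda>x. of_real (f x)) = of_real (k powr (11/3) * (c - k^2)^2 / (18 * c) * J)"
    if w: "w \<in> H2" and Lw: "AE x in lborel. L w x = of_real (f x)" for w
  proof -
    define z where "z x = w x + (- 1) * of_real (v x)" for x
    have z: "z \<in> H2" "AE x in lborel. L z x = 0"
    proof -
      note lin = wave.\<L>_lincomb[OF \<phi>(1,2) w v(1), of "- 1", unfolded cc, folded \<mu>_def, folded L_def]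
      show "z \<in> H2" using lin(1) unfolding z_def[abs_def] .
      from lin(2) Lw v(2) show "AE x in lborel. L z x = 0"
        unfolding z_def[abs_def] by eventually_elim simp
    qed
    \<comment> \<open>Simplicity of the eigenvalue 0 makes both the difference \<open>z\<close> of
      two preimages and the translation mode \<open>e\<close> multiples of one function; as
      \<open>e\<close> is not null, \<open>z\<close> is a multiple of \<open>e\<close>, and
      \<open>e\<close> does not contribute to the pairing.\<close>
    have "simple_eigenvalue H2 L 0"
      using A unfolding spectral_assumption_A_def \<mu> L_def by blast
    then obtain v0 where "\<forall>w\<in>H2. (AE x in lborel. L w x = 0 * w x) \<longrightarrow> (\<exists>r. AE x in lborel. w x = r * v0 x)"
      unfolding simple_eigenvalue_def by blast
    then have ker: "\<exists>r. AE x in lborel. w x = r * v0 x" if "w \<in> H2" "AE x in lborel. L w x = 0" for w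
      using that by (simp only: mult_zero_left)
    obtain r1 where r1: "AE x in lborel. complex_of_real (e x) = r1 * v0 x"
      using ker[OF e(1,2)] by blast
    obtain r2 where r2: "AE x in lborel. z x = r2 * v0 x"
      using ker[OF z] by blast
    have "r1 \<noteq> 0" using r1 e(3) by auto
    define r where "r = r2 / r1"
    from r1 r2 have w_eq: "AE x in lborel. w x = of_real (v x) + r * of_real (e x)"
    proof eventually_elim
      case (elim x)
      have "r * of_real (e x) = r2 * v0 x" using elim(1) \<open>r1 \<noteq> 0\<close> by (simp add: r_def)
      then show ?case using elim(2) by (simp add: z_def diff_eq_eq)
    qed
    have fm: "(\<lambda>x. complex_of_real (f x)) \<in> borel_measurable lborel"
      using continuous_borel_measurable_lborel[OF wave.isCont_\<delta>\<F>_wave] unfolding f_def by measurable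
    have iv: "integrable lborel (\<lambda>x. v x * f x)" "(\<integral>x. v x * f x \<partial>lborel) = d * (M * k^2 * J)"
    proof -
      have vf: "v x * f x = d * (3 * (k * q ^ 3) * wave.n \<Xi> x / s x ^ 3 * (2 * s x * wave.u x))" for x
        by (simp add: v_def f_def)
      note n = wave.integral_n_\<delta>\<F>[OF \<Xi>, unfolded cc, folded M_def J_def]
      show "integrable lborel (\<lambda>x. v x * f x)"
        unfolding vf by (rule integrable_mult_right[OF n(1)])
      show "(\<integral>x. v x * f x \<partial>lborel) = d * (M * k^2 * J)"
        unfolding vf integral_mult_right_zero n(2) ..
    qed
    have ie: "integrable lborel (\<lambda>x. e x * f x)" "(\<integral>x. e x * f x \<partial>lborel) = 0"
      using wave.integral_T_\<delta>\<F> by (simp_all add: e_def f_def)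
    have wm: "w \<in> borel_measurable lborel" using w by (auto simp: H2_def L2_def)
    have vm: "(\<lambda>x. complex_of_real (v x)) \<in> borel_measurable lborel"
      "(\<lambda>x. complex_of_real (e x)) \<in> borel_measurable lborel"
      using v(1) e(1) by (auto simp: H2_def L2_def)
    have "l2inner w (\<lambda>x. of_real (f x)) = (\<integral>x. of_real (v x * f x) + r * of_real (e x * f x) \<partial>lborel)"
      unfolding l2inner_def
    proof (rule integral_cong_AE)
      show "(\<lambda>x. w x * cnj (of_real (f x))) \<in> borel_measurable lborel"
        using wm fm by simp
      show "(\<lambda>x. complex_of_real (v x * f x) + r * of_real (e x * f x)) \<in> borel_measurable lborel"
        using vm fm by simp
      from w_eq show "AE x in lborel. w x * cnj (of_real (f x)) = of_real (v x * f x) + r * of_real (e x * f x)"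
        by eventually_elim (simp add: algebra_simps)
    qed
    also have "\<dots> = of_real (\<integral>x. v x * f x \<partial>lborel) + r * of_real (\<integral>x. e x * f x \<partial>lborel)"
      using iv(1) ie(1) by (simp add: integral_complex_of_real del: of_real_mult)
    also have "\<dots> = of_real (d * (M * k^2 * J))"
      unfolding iv ie by simp
    \<comment> \<open>\<open>M\<close> cancels, and \<open>1 / (K * a) = k powr (5/3) * q^5\<close>
      leaves \<open>q^4 = (c - k^2)^2\<close> after division by \<open>q\<close>.\<close>
    also have "d * (M * k^2 * J) = k powr (11/3) * (c - k^2)^2 / (18 * c) * J"
    proof -
      have "d * (M * k^2 * J) = (1 / (wave.K * (k * q ^ 3))) * (k^2 / (18 * c * q)) * J"
        using nz by (simp add: d_def)
      also have "\<dots> = (k powr (5/3) * k^2) * (q^2)^2 / (18 * c) * J"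
        unfolding wave.inverse_Ka using nz by (simp add: eval_nat_numeral)
      also have "k powr (5/3) * k^2 = k powr (5/3 + 2)"
        using k by (simp only: powr_add powr_numeral)
      finally show ?thesis using p(1) by (simp add: q_def[symmetric])
    qed
    finally show ?thesis .
  qed
  show ?thesis
    unfolding \<mu> f L_def[symmetric] DERIV_imp_deriv[OF dF]
    using dF v inner by (auto simp: real_differentiable_def)
qed

end
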